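(* Let $U$ and $V$ be any $m\times m$ matrix weights on $\mathbb{R}^d$, let $B$ be a locally integrable $m\times m$ matrix-valued function, and suppose that $C$ and $D$ are Young functions with $\bar D\in B_{p,q}$ and $\bar C\in B_{q'}$. Then $$\|[M_B,I_\alpha]\|_{L^p(U^{p/q})\to L^q(V)}\le K\,\min\{\kappa_1,\kappa_2\},$$ where $$\kappa_1=\sup_Q\Big\|\big\|V^{1/q}(x)(B(x)-B(y))U^{-1/q}(y)\big\|_{C_x,Q}\Big\|_{D_y,Q},\qquad \kappa_2=\sup_Q\Big\|\big\|V^{1/q}(x)(B(x)-B(y))U^{-1/q}(y)\big\|_{D_y,Q}\Big\|_{C_x,Q},$$ the suprema are over all cubes $Q\subseteq\mathbb{R}^d$, and the constant $K$ is independent of $U,V$ and $B$ (it may depend on $m,d,p,q,\alpha,C,D$).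
   Context: Throughout $0<\alpha<d$, $p,q>1$ and $\frac{\alpha}{d}+\frac1q=\frac1p$; $q'$ is the conjugate exponent of $q$. An $m\times m$ matrix weight is a function on $\mathbb{R}^d$ with values in the $m\times m$ complex matrices that is positive definite a.e. For $r>1$, $L^r(W)$ is the space of $\mathbb{C}^m$-valued $\vec f$ with $\|\vec f\|_{L^r(W)}=\left(\int_{\mathbb{R}^d}|W^{1/r}(x)\vec f(x)|^r\,dx\right)^{1/r}<\infty$. The fractional integral operator is $I_\alpha f(x)=\int_{\mathbb{R}^d}\frac{f(y)}{|x-y|^{d-\alpha}}\,dy$, acting on $\mathbb{C}^m$-valued functions coordinatewise; $M_B$ is multiplication by $B$ and $[M_B,I_\alpha]=M_BI_\alpha-I_\alpha M_B$. Orlicz definitions (standard): a Young function is a continuous, convex, strictly increasing $\Phi:[0,\infty)\to[0,\infty)$ with $\Phi(0)=0$ and $\Phi(t)/t\to\infty$ as $t\to\infty$. Its associate function is $\bar\Phi(t)=\sup_{s>0}\{st-\Phi(s)\}$. For a cube $Q$, $\|f\|_{\Phi,Q}=\inf\{\lambda>0:\fint_Q\Phi(|f(y)|/\lambda)\,dy\le1\}$ where $\fint_Q$ is the average over $Q$. For $1<r<\infty$, $\Phi\in B_r$ if $\int_1^\infty\frac{\Phi(t)}{t^r}\frac{dt}{t}<\infty$; for $1<p\le q<\infty$, $\Phi\in B_{p,q}$ if $\int_1^\infty\frac{\Phi(t)^{q/p}}{t^q}\frac{dt}{t}<\infty$. In $\kappa_1,\kappa_2$ the matrix is measured in the operator norm;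 the subscript $C_x,Q$ (resp. $D_y,Q$) means the norm $\|\cdot\|_{C,Q}$ taken in the variable $x$ (resp. $\|\cdot\|_{D,Q}$ taken in $y$), the inner norm being computed with the other variable fixed. *)

theory Defs
  imports "HOL-Analysis.Analysis"
begin

section \<open>Positive definite matrices and their real powers\<close>

definition cadjoint :: "complex^'n^'m \<Rightarrow> complex^'m^'n" where
  "cadjoint A = (\<chi> i j. cnj (A $ j $ i))"

definition cdiag :: "('m \<Rightarrow> real) \<Rightarrow> complex^'m^'m" where
  "cdiag l = (\<chi> i j. if i = j then of_real (l i) else 0)"

definition pos_def :: "complex^'m^'m \<Rightarrow> bool" where
  "pos_def A \<longleftrightarrow> cadjoint A = A \<and>
     (\<forall>v. v \<noteq> 0 \<longrightarrow> 0 < Re (\<Sum>i\<in>UNIV. cnj (v $ i) * (A *v v) $ i))"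

text \<open>
  The power \<open>A\<^sup>s\<close> is obtained from a unitary diagonalisation of \<open>A\<close>. For positive definite
  \<open>A\<close> one exists by the spectral theorem and the result does not depend on its choice;
  for other matrices the value is irrelevant.
\<close>
definition mat_powr :: "complex^'m^'m \<Rightarrow> real \<Rightarrow> complex^'m^'m" where
  "mat_powr A s = (THE P. \<exists>(Q :: complex^'m^'m) l.
     cadjoint Q ** Q = mat 1 \<and> (\<forall>i. 0 < l i) \<and>
     A = Q ** cdiag l ** cadjoint Q \<and>
     P = Q ** cdiag (\<lambda>i. l i powr s) ** cadjoint Q)"

text \<open>The operator norm with respect to the Euclidean norm on \<open>\<complex>\<^sup>m\<close>.\<close>
definition mat_norm :: "complex^'m^'m \<Rightarrow> real" where
  "mat_norm A = onorm (\<lambda>v. A *v v)"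


section \<open>Matrix weights and weighted Lebesgue spaces\<close>

definition matrix_weight :: "(real^'d \<Rightarrow> complex^'m^'m) \<Rightarrow> bool" where
  "matrix_weight W \<longleftrightarrow> W \<in> borel_measurable lebesgue \<and> (AE x in lebesgue. pos_def (W x))"

definition ennreal_powr :: "ennreal \<Rightarrow> real \<Rightarrow> ennreal" where
  "ennreal_powr t s = (if t = \<infinity> then \<infinity> else ennreal (enn2real t powr s))"

definition weighted_norm ::
  "real \<Rightarrow> (real^'d \<Rightarrow> complex^'m^'m) \<Rightarrow> (real^'d \<Rightarrow> complex^'m) \<Rightarrow> ennreal" where
  "weighted_norm r W f =
     ennreal_powr (\<integral>\<^sup>+x. ennreal (norm (mat_powr (W x) (1/r) *v f x) powr r) \<partial>lebesgue) (1/r)"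

definition weighted_Lp ::
  "real \<Rightarrow> (real^'d \<Rightarrow> complex^'m^'m) \<Rightarrow> (real^'d \<Rightarrow> complex^'m) set" where
  "weighted_Lp r W = {f \<in> borel_measurable lebesgue. weighted_norm r W f < \<infinity>}"

definition locally_integrable :: "(real^'d \<Rightarrow> complex^'m^'m) \<Rightarrow> bool" where
  "locally_integrable B \<longleftrightarrow> (\<forall>S. compact S \<longrightarrow> set_integrable lebesgue S B)"


section \<open>The fractional integral and its commutator\<close>

definition frac_kernel :: "real \<Rightarrow> (real^'d \<Rightarrow> complex) \<Rightarrow> real^'d \<Rightarrow> real^'d \<Rightarrow> complex" where
  "frac_kernel \<alpha> f x y = f y / of_real (norm (x - y) powr (real CARD('d) - \<alpha>))"

definition frac_int ::
  "real \<Rightarrow> (real^'d \<Rightarrow> complex^'m) \<Rightarrow> real^'d \<Rightarrow> complex^'m" where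
  "frac_int \<alpha> f x = (\<chi> i. \<integral>y. frac_kernel \<alpha> (\<lambda>z. f z $ i) x y \<partial>lebesgue)"

text \<open>
  The functions on which the fractional integral is given by an absolutely convergent
  integral at almost every point; outside of this set the Bochner integral in
  \<open>frac_int\<close> takes a default value and is meaningless.
\<close>
definition frac_int_dom :: "real \<Rightarrow> (real^'d \<Rightarrow> complex^'m) set" where
  "frac_int_dom \<alpha> =
     {f. AE x in lebesgue. \<forall>i. integrable lebesgue (frac_kernel \<alpha> (\<lambda>z. f z $ i) x)}"

definition mult_op ::
  "(real^'d \<Rightarrow> complex^'m^'m) \<Rightarrow> (real^'d \<Rightarrow> complex^'m) \<Rightarrow> real^'d \<Rightarrow> complex^'m" where
  "mult_op B f = (\<lambda>x. B x *v f x)"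

definition frac_commutator ::
  "(real^'d \<Rightarrow> complex^'m^'m) \<Rightarrow> real \<Rightarrow> (real^'d \<Rightarrow> complex^'m) \<Rightarrow> real^'d \<Rightarrow> complex^'m" where
  "frac_commutator B \<alpha> f =
     (\<lambda>x. mult_op B (frac_int \<alpha> f) x - frac_int \<alpha> (mult_op B f) x)"

text \<open>
  The maximal domain of the commutator. For locally integrable \<open>B\<close> it contains every bounded
  measurable function of bounded support, and the functions of this kind that belong to
  \<open>weighted_Lp r W\<close> are dense there for every matrix weight \<open>W\<close>.
\<close>
definition frac_commutator_dom ::
  "(real^'d \<Rightarrow> complex^'m^'m) \<Rightarrow> real \<Rightarrow> (real^'d \<Rightarrow> complex^'m) set" where
  "frac_commutator_dom B \<alpha> = {f \<in> frac_int_dom \<alpha>. mult_op B f \<in> frac_int_dom \<alpha>}"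

definition weighted_op_norm ::
  "real \<Rightarrow> (real^'d \<Rightarrow> complex^'m^'m) \<Rightarrow> real \<Rightarrow> (real^'d \<Rightarrow> complex^'m^'m) \<Rightarrow>
   (real^'d \<Rightarrow> complex^'m) set \<Rightarrow>
   ((real^'d \<Rightarrow> complex^'m) \<Rightarrow> real^'d \<Rightarrow> complex^'m) \<Rightarrow> ennreal" where
  "weighted_op_norm r W s X domain T =
     (SUP f\<in>{f \<in> weighted_Lp r W \<inter> domain. weighted_norm r W f \<le> 1}. weighted_norm s X (T f))"


section \<open>Young functions and Orlicz averages\<close>

text \<open>Only the values on \<open>[0, \<infinity>)\<close> are relevant.\<close>
definition young_function :: "(real \<Rightarrow> real) \<Rightarrow> bool" where
  "young_function \<Phi> \<longleftrightarrow>
     continuous_on {0..} \<Phi> \<and> convex_on {0..} \<Phi> \<and> strict_mono_on {0..} \<Phi> \<and>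
     \<Phi> 0 = 0 \<and> filterlim (\<lambda>t. \<Phi> t / t) at_top at_top"

definition young_assoc :: "(real \<Rightarrow> real) \<Rightarrow> real \<Rightarrow> real" where
  "young_assoc \<Phi> t = (SUP s\<in>{0<..}. s * t - \<Phi> s)"

definition B_class :: "real \<Rightarrow> (real \<Rightarrow> real) set" where
  "B_class r = {\<Phi>. (\<integral>\<^sup>+t\<in>{1..}. ennreal (\<Phi> t / t powr r / t) \<partial>lborel) < \<infinity>}"

definition B_class2 :: "real \<Rightarrow> real \<Rightarrow> (real \<Rightarrow> real) set" where
  "B_class2 p q = {\<Phi>. (\<integral>\<^sup>+t\<in>{1..}. ennreal (\<Phi> t powr (q/p) / t powr q / t) \<partial>lborel) < \<infinity>}"

definition cubes :: "(real^'d) set set" where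
  "cubes = {cbox a (a + vec l) |a l. 0 < l}"

text \<open>Orlicz averages are iterated below, so the argument may take the value \<open>\<infinity>\<close>.\<close>
definition young_ext :: "(real \<Rightarrow> real) \<Rightarrow> ennreal \<Rightarrow> ennreal" where
  "young_ext \<Phi> t = (if t = \<infinity> then \<infinity> else ennreal (\<Phi> (enn2real t)))"

definition orlicz_norm :: "(real \<Rightarrow> real) \<Rightarrow> (real^'d) set \<Rightarrow> (real^'d \<Rightarrow> ennreal) \<Rightarrow> ennreal" where
  "orlicz_norm \<Phi> Q f =
     Inf {ennreal l |l. 0 < l \<and>
       (\<integral>\<^sup>+y\<in>Q. young_ext \<Phi> (f y / ennreal l) \<partial>lebesgue) / emeasure lebesgue Q \<le> 1}"

definition bump_kernel ::
  "real \<Rightarrow> (real^'d \<Rightarrow> complex^'m^'m) \<Rightarrow> (real^'d \<Rightarrow> complex^'m^'m) \<Rightarrow>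
   (real^'d \<Rightarrow> complex^'m^'m) \<Rightarrow> real^'d \<Rightarrow> real^'d \<Rightarrow> ennreal" where
  "bump_kernel q U V B x y =
     ennreal (mat_norm (mat_powr (V x) (1/q) ** (B x - B y) ** mat_powr (U y) (- (1/q))))"

definition kappa1 ::
  "real \<Rightarrow> (real \<Rightarrow> real) \<Rightarrow> (real \<Rightarrow> real) \<Rightarrow> (real^'d \<Rightarrow> complex^'m^'m) \<Rightarrow>
   (real^'d \<Rightarrow> complex^'m^'m) \<Rightarrow> (real^'d \<Rightarrow> complex^'m^'m) \<Rightarrow> ennreal" where
  "kappa1 q C D U V B =
     (SUP Q\<in>cubes. orlicz_norm D Q (\<lambda>y. orlicz_norm C Q (\<lambda>x. bump_kernel q U V B x y)))"

definition kappa2 ::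
  "real \<Rightarrow> (real \<Rightarrow> real) \<Rightarrow> (real \<Rightarrow> real) \<Rightarrow> (real^'d \<Rightarrow> complex^'m^'m) \<Rightarrow>
   (real^'d \<Rightarrow> complex^'m^'m) \<Rightarrow> (real^'d \<Rightarrow> complex^'m^'m) \<Rightarrow> ennreal" where
  "kappa2 q C D U V B =
     (SUP Q\<in>cubes. orlicz_norm C Q (\<lambda>x. orlicz_norm D Q (\<lambda>y. bump_kernel q U V B x y)))"

end

theory Submission
  imports Defs
begin

text \<open>
  With \<open>g = |U\<^bsup>1/q\<^esup> f|\<close> and by duality, everything reduces to bounding
  \<open>\<integral>\<integral> k(x,y) g(y) h(x) |x - y|\<^bsup>\<alpha>-d\<^esup> dy dx\<close> for \<open>g\<close> and \<open>h\<close> in the unit balls of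
  \<open>L\<^sup>p\<close> and \<open>L\<^bsup>q'\<^esup>\<close>, where \<open>k\<close> is the bump kernel. Instead of dyadic grids and maximal operators, the
  kernel \<open>|x - y|\<^bsup>\<alpha>-d\<^esup>\<close> is averaged over all cubes \<open>Q(z,\<rho>)\<close> that contain \<open>x\<close> and \<open>y\<close>. Hoelder's
  inequality for Orlicz averages on each cube then leaves
  \<open>\<kappa> \<integral>\<integral> \<rho>\<^bsup>\<alpha>-1\<^esup> G(z,\<rho>) H(z,\<rho>) dz d\<rho>\<close>, where \<open>G\<close> and \<open>H\<close> are the Orlicz averages of \<open>g\<close> and
  \<open>h\<close> for (multiples of) the associates of \<open>D\<close> and \<open>C\<close>. If \<open>G(z,\<rho>) > l\<close>, then
  \<open>\<rho>\<^sup>d < A(l)\<close>, and the set of such \<open>z\<close> has measure at most \<open>A(l)\<close>, where \<open>A(l)\<close> is essentially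
  \<open>\<integral>\<^bsub>g > l\<^esub> \<Psi>(g/l)\<close>. With the analogous function \<open>B\<close> for \<open>h\<close>, the layer cake formula bounds the
  integral by a multiple of \<open>\<integral>\<integral> min (A(l)) (B(l'))\<^bsup>1+\<alpha>/d\<^esup> dl dl'\<close>. By Young's inequality for
  the distribution functions of \<open>A\<close> and \<open>B\<close> this is controlled by
  \<open>\<integral> l\<^bsup>q-1\<^esup> A(l)\<^bsup>q/p\<^esup> dl\<close> and \<open>\<integral> l\<^bsup>q'-1\<^esup> B(l) dl\<close>, and by Jensen's inequality
  these are finite because of the \<open>B\<^bsub>p,q\<^esub>\<close> and \<open>B\<^bsub>q'\<^esub>\<close> conditions.
\<close>

section \<open>Powers of positive definite matrices\<close>

text \<open>The exponents fit for the following reason. For fixed levels the corners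
  \<open>z\<close> fill a set of measure at most \<open>m = min (A l) (B l')\<close>, and only sides
  with \<open>\<rho>^d < m\<close> occur, so integrating \<open>\<rho> powr (\<alpha> - 1)\<close>
  over both gives at most \<open>m powr (1 + \<alpha>/d) / \<alpha>\<close>. The scaling relation
  says precisely that \<open>1 + \<alpha>/d = (q/p)/q + 1/q'\<close>. Hence Young's inequality with
  exponents \<open>q\<close> and \<open>q'\<close> leaves the power \<open>q/p\<close> on
  \<open>A\<close>, matched by \<open>B_class2 p q\<close>, and the power 1 on \<open>B\<close>,
  matched by \<open>B_class q'\<close>. Level sets are estimated for one side length at a time, so
  Chebyshev's inequality and Tonelli's theorem take the place of a covering argument. Restricting
  \<open>A(l)\<close> to \<open>{g > l}\<close> relies on \<open>\<Psi> 1 \<le> 1/2\<close>; this is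
  why multiples of the associates appear. Noncommutativity ends once the operator norm of the bump
  kernel is taken pointwise. The scalar estimate treats \<open>x\<close> and \<open>y\<close> alike,
  so it covers \<open>kappa1\<close> and \<open>kappa2\<close> by an exchange of variables. The
  definite description in \<open>mat_powr\<close> hides measurability, which is recovered from a
  series.\<close>

definition cip :: "complex^'m \<Rightarrow> complex^'m \<Rightarrow> complex" where
  "cip u v = (\<Sum>i\<in>UNIV. cnj (u $ i) * v $ i)"

lemma Re_cip: "Re (cip u v) = u \<bullet> v"
  by (simp add: cip_def inner_vec_def inner_complex_def)

lemma cip_commute: "cip v u = cnj (cip u v)"
  by (simp add: cip_def cnj_sum mult.commute)

lemma cip_add_right: "cip u (v + w) = cip u v + cip u w"
  by (simp add: cip_def sum.distrib algebra_simps)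

lemma cip_diff_right: "cip u (v - w) = cip u v - cip u w"
  by (simp add: cip_def sum_subtractf algebra_simps)

lemma cip_scale_right: "cip u (c *s v) = c * cip u v"
  by (simp add: cip_def sum_distrib_left algebra_simps)

lemma cip_scale_left: "cip (c *s u) v = cnj c * cip u v"
  by (simp add: cip_def sum_distrib_left algebra_simps)

lemma cip_scaleR_right: "cip u (r *\<^sub>R v) = of_real r * cip u v"
  by (simp add: cip_def sum_distrib_left algebra_simps scaleR_conv_of_real[where 'a = complex])

lemma cip_self: "cip v v = of_real ((norm v)\<^sup>2)"
proof -
  have "Im (cip v v) = 0" by (simp add: cip_def)
  moreover have "Re (cip v v) = (norm v)\<^sup>2" by (simp add: Re_cip power2_norm_eq_inner)
  ultimately show ?thesis by (simp add: complex_eq_iff)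
qed

lemma cip_matrix_right: "cip u (A *v v) = cip (cadjoint A *v u) v"
proof -
  have "cip u (A *v v) = (\<Sum>i\<in>UNIV. \<Sum>j\<in>UNIV. cnj (u $ i) * (A $ i $ j * v $ j))"
    by (simp add: cip_def matrix_vector_mult_def sum_distrib_left)
  also have "\<dots> = (\<Sum>j\<in>UNIV. \<Sum>i\<in>UNIV. cnj (u $ i) * (A $ i $ j * v $ j))"
    by (rule sum.swap)
  also have "\<dots> = cip (cadjoint A *v u) v"
    by (simp add: cip_def matrix_vector_mult_def cadjoint_def sum_distrib_right sum_distrib_left
        cnj_sum algebra_simps)
  finally show ?thesis .
qed

lemma pos_def_cip: "pos_def A \<longleftrightarrow> cadjoint A = A \<and> (\<forall>v. v \<noteq> 0 \<longrightarrow> 0 < Re (cip v (A *v v)))"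
  by (simp add: pos_def_def cip_def)

section \<open>Spectral theorem for Hermitian matrices\<close>

lemma quadratic_nonneg_imp_linear_zero:
  fixes a b :: real
  assumes "\<And>t. 0 \<le> t\<^sup>2 * a + t * b"
  shows "b = 0"
proof (rule ccontr)
  assume b: "b \<noteq> 0"
  \<comment> \<open>At \<open>t = - e * b\<close> the linear term contributes
    \<open>- e * b^2\<close>; this \<open>e\<close> is small enough for it to dominate the quadratic
    term.\<close>
  define e where "e = 1 / (\<bar>a\<bar> + 1)"
  have e: "e > 0" "e * \<bar>a\<bar> < 1" by (auto simp: e_def field_simps)
  have "(- e * b)\<^sup>2 * a + (- e * b) * b = e * b\<^sup>2 * (e * a - 1)"
    by (simp add: power2_eq_square algebra_simps)
  moreover have "e * a - 1 < 0" using e by (smt (verit) mult_left_mono)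
  ultimately have "(- e * b)\<^sup>2 * a + (- e * b) * b < 0"
    using e(1) b by (simp add: mult_pos_neg)
  with assms[of "- e * b"] show False by linarith
qed

text \<open>A maximiser \<open>v\<close> of the Rayleigh quotient on the unit sphere of the
  orthogonal complement \<open>E\<close> of \<open>S\<close> is an eigenvector: the vanishing first
  variation makes \<open>l v - A v\<close> orthogonal to \<open>E\<close>, while this vector lies in
  \<open>E\<close> itself because \<open>A\<close> maps \<open>E\<close> into
  \<open>E\<close>.\<close>

lemma hermitian_eigenvector_orthogonal:
  fixes A :: "complex^'m^'m"
  assumes A: "cadjoint A = A"
    and S: "finite S" "card S < CARD('m)"
    and eig: "\<And>u. u \<in> S \<Longrightarrow> \<exists>l::real. A *v u = complex_of_real l *s u"
  shows "\<exists>v. norm v = 1 \<and> (\<forall>u\<in>S. cip u v = 0) \<and> (\<exists>l::real. A *v v = complex_of_real l *s v)"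
proof -
  define E where "E = {w. \<forall>u\<in>S. cip u w = 0}"
  have E_cip: "w \<in> E" if w: "\<And>u. u \<in> S \<Longrightarrow> u \<bullet> w = 0 \<and> (\<i> *s u) \<bullet> w = 0" for w
  proof -
    have "cip u w = 0" if "u \<in> S" for u
    proof -
      have "Re (cip u w) = 0" "Re (cip (\<i> *s u) w) = 0"
        using w[OF \<open>u \<in> S\<close>] by (auto simp: Re_cip)
      then show ?thesis by (simp add: cip_scale_left complex_eq_iff)
    qed
    then show ?thesis by (simp add: E_def)
  qed
  have E_add: "v + w \<in> E" if "v \<in> E" "w \<in> E" for v w
    using that by (simp add: E_def cip_add_right)
  have E_diff: "v - w \<in> E" if "v \<in> E" "w \<in> E" for v w
    using that by (simp add: E_def cip_diff_right)
  have E_scale: "r *\<^sub>R v \<in> E" if "v \<in> E" for v r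
    using that by (simp add: E_def cip_scaleR_right)
  have E_A: "A *v v \<in> E" if "v \<in> E" for v
  proof -
    have "cip u (A *v v) = 0" if "u \<in> S" for u
    proof -
      obtain l :: real where "A *v u = complex_of_real l *s u" using eig[OF \<open>u \<in> S\<close>] by blast
      then show ?thesis using \<open>v \<in> E\<close> \<open>u \<in> S\<close> by (simp add: E_def cip_matrix_right A cip_scale_left)
    qed
    then show ?thesis by (simp add: E_def)
  qed
  \<comment> \<open>Complex orthogonality to \<open>u\<close> amounts to real orthogonality to
    \<open>u\<close> and \<open>\<i> *s u\<close>, so \<open>S\<close> uses up at most
    \<open>2 * card S\<close> of the \<open>2 * CARD('m)\<close> real dimensions, and
    \<open>E\<close> is nonzero.\<close>
  have "dim (S \<union> (\<lambda>u. \<i> *s u) ` S) \<le> card (S \<union> (\<lambda>u. \<i> *s u) ` S)"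
    using S(1) by (intro dim_le_card') auto
  also have "\<dots> \<le> card S + card ((\<lambda>u. \<i> *s u) ` S)" by (rule card_Un_le)
  also have "\<dots> \<le> card S + card S" using S(1) card_image_le by auto
  also have "\<dots> < DIM(complex^'m)" using S(2) by simp
  finally have "dim (S \<union> (\<lambda>u. \<i> *s u) ` S) < DIM(complex^'m)" .
  then obtain x where x: "x \<noteq> 0" "\<And>y. y \<in> span (S \<union> (\<lambda>u. \<i> *s u) ` S) \<Longrightarrow> orthogonal x y"
    using orthogonal_to_subspace_exists by blast
  have xE: "x \<in> E"
    by (rule E_cip) (use x(2) in \<open>auto simp: orthogonal_def inner_commute[of _ x] span_base\<close>)
  have "closed E"
  proof -
    have "E = (\<Inter>u\<in>S. {w. cip u w = 0})" by (auto simp: E_def)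
    moreover have "closed {w. cip u w = 0}" for u :: "complex^'m"
      unfolding cip_def by (intro closed_Collect_eq continuous_intros)
    ultimately show ?thesis by (auto intro!: closed_INT)
  qed
  then have "compact (sphere 0 1 \<inter> E)" by (intro compact_Int_closed) auto
  moreover have "(1 / norm x) *\<^sub>R x \<in> sphere 0 1 \<inter> E" using x(1) E_scale[OF xE] by simp
  moreover have "continuous_on (sphere 0 1 \<inter> E) (\<lambda>w. w \<bullet> (A *v w))"
    unfolding matrix_vector_mult_def by (intro continuous_intros)
  ultimately obtain v where v: "v \<in> sphere 0 1 \<inter> E"
    and vmax: "\<And>w. w \<in> sphere 0 1 \<inter> E \<Longrightarrow> w \<bullet> (A *v w) \<le> v \<bullet> (A *v v)"
    using continuous_attains_sup[of "sphere 0 1 \<inter> E" "\<lambda>w. w \<bullet> (A *v w)"] by blast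
  define l where "l = v \<bullet> (A *v v)"
  have vE: "v \<in> E" and nv: "norm v = 1" using v by auto
  have Asc: "A *v (r *\<^sub>R w) = r *\<^sub>R (A *v w)" for r w
    by (simp add: matrix_vector_mult_def vec_eq_iff scaleR_sum_right)
  have sym: "u \<bullet> (A *v w) = (A *v u) \<bullet> w" for u w
    using cip_matrix_right[of u A w] by (metis A Re_cip)
  have bound: "w \<bullet> (A *v w) \<le> l * (norm w)\<^sup>2" if "w \<in> E" for w
  proof (cases "w = 0")
    case False
    have "(1 / norm w) *\<^sub>R w \<in> sphere 0 1 \<inter> E" using False E_scale[OF that] by simp
    from vmax[OF this] have "w \<bullet> (A *v w) / (norm w)\<^sup>2 \<le> l"
      by (simp add: Asc l_def power2_eq_square)
    then show ?thesis using False by (simp add: field_simps)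
  qed simp
  \<comment> \<open>The estimate \<open>bound\<close> at \<open>v + t u\<close> says that a
    quadratic in \<open>t\<close> without constant term is nonnegative, so its linear coefficient
    vanishes.\<close>
  have orth: "u \<bullet> (l *\<^sub>R v - A *v v) = 0" if u: "u \<in> E" for u
  proof -
    have "0 \<le> t\<^sup>2 * (l * (norm u)\<^sup>2 - u \<bullet> (A *v u)) + t * (2 * (u \<bullet> (l *\<^sub>R v - A *v v)))" for t
    proof -
      have "(v + t *\<^sub>R u) \<bullet> (A *v (v + t *\<^sub>R u)) =
          l + t * (2 * (u \<bullet> (A *v v))) + t\<^sup>2 * (u \<bullet> (A *v u))"
        using sym[of v u] inner_commute[of "A *v v" u]
        by (simp add: matrix_vector_right_distrib Asc inner_add_left inner_add_right l_def
            power2_eq_square algebra_simps)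
      moreover have "(norm (v + t *\<^sub>R u))\<^sup>2 = 1 + t * (2 * (u \<bullet> v)) + t\<^sup>2 * (norm u)\<^sup>2"
        using nv inner_commute[of u v] norm_eq_1[of v]
        unfolding power2_norm_eq_inner
        by (simp add: inner_add_left inner_add_right power2_eq_square[of t] algebra_simps)
      moreover have "v + t *\<^sub>R u \<in> E" using u vE E_add E_scale by blast
      note bound[OF this]
      ultimately show ?thesis by (simp add: inner_diff_right algebra_simps)
    qed
    from quadratic_nonneg_imp_linear_zero[OF this] show ?thesis by simp
  qed
  have "l *\<^sub>R v - A *v v = 0"
    using orth[of "l *\<^sub>R v - A *v v"] E_diff[OF E_scale[OF vE] E_A[OF vE]] by simp
  moreover have "l *\<^sub>R v = complex_of_real l *s v"
    by (simp add: vec_eq_iff scaleR_conv_of_real[where 'a = complex])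
  ultimately have "A *v v = complex_of_real l *s v" by (metis right_minus_eq)
  then show ?thesis using nv vE by (auto simp: E_def)
qed

lemma hermitian_orthonormal_eigenvectors:
  fixes A :: "complex^'m^'m"
  assumes A: "cadjoint A = A" and k: "k \<le> CARD('m)"
  shows "\<exists>S. finite S \<and> card S = k \<and> (\<forall>u\<in>S. norm u = 1 \<and> (\<exists>l::real. A *v u = complex_of_real l *s u)) \<and>
     (\<forall>u\<in>S. \<forall>v\<in>S. u \<noteq> v \<longrightarrow> cip u v = 0)"
  using k
proof (induction k)
  case 0
  show ?case by (rule exI[of _ "{}"]) simp
next
  case (Suc k)
  then obtain S where S: "finite S" "card S = k"
    "\<And>u. u \<in> S \<Longrightarrow> norm u = 1 \<and> (\<exists>l::real. A *v u = complex_of_real l *s u)"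
    "\<And>u v. u \<in> S \<Longrightarrow> v \<in> S \<Longrightarrow> u \<noteq> v \<Longrightarrow> cip u v = 0" by auto
  obtain v where v: "norm v = 1" "\<And>u. u \<in> S \<Longrightarrow> cip u v = 0"
    "\<exists>l::real. A *v v = complex_of_real l *s v"
    using hermitian_eigenvector_orthogonal[OF A S(1)] S(2,3) Suc.prems by auto
  have "v \<notin> S" using v(1) v(2)[of v] by (auto simp: cip_self)
  moreover have "cip v u = 0" if "u \<in> S" for u using v(2)[OF that] cip_commute[of v u] by simp
  ultimately show ?case using S v by (intro exI[of _ "insert v S"]) auto
qed

section \<open>Functional calculus and real powers\<close>

definition unitary :: "complex^'m^'m \<Rightarrow> bool" where
  "unitary Q \<longleftrightarrow> cadjoint Q ** Q = mat 1"

definition spec :: "complex^'m^'m \<Rightarrow> ('m \<Rightarrow> real) \<Rightarrow> complex^'m^'m" where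
  "spec Q l = Q ** cdiag l ** cadjoint Q"

lemma unitary_right: "unitary Q \<Longrightarrow> Q ** cadjoint Q = mat 1"
  unfolding unitary_def using matrix_left_right_inverse by blast

lemma cdiag_mult_left: "(cdiag l ** X) $ i $ j = of_real (l i) * X $ i $ j"
  by (simp add: matrix_matrix_mult_def cdiag_def if_distrib[of "\<lambda>z. z * _"] cong: if_cong)

lemma cdiag_mult_right: "(X ** cdiag l) $ i $ j = X $ i $ j * of_real (l j)"
  by (simp add: matrix_matrix_mult_def cdiag_def if_distrib[of "\<lambda>z. _ * z"] cong: if_cong)

lemma cdiag_mult_cdiag: "cdiag l ** cdiag m = cdiag (\<lambda>i. l i * m i)"
  by (simp add: vec_eq_iff cdiag_mult_left) (simp add: cdiag_def)

lemma cdiag_1: "cdiag (\<lambda>i. 1) = mat 1"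
  by (simp add: vec_eq_iff cdiag_def mat_def)

lemma spec_nth: "spec Q l $ i $ j = (\<Sum>k\<in>UNIV. Q $ i $ k * of_real (l k) * cnj (Q $ j $ k))"
  by (simp add: spec_def matrix_matrix_mult_def[of "Q ** cdiag l"] cdiag_mult_right cadjoint_def)

lemma spec_mult:
  assumes "unitary Q"
  shows "spec Q l ** spec Q m = spec Q (\<lambda>i. l i * m i)"
proof -
  have "spec Q l ** spec Q m = Q ** cdiag l ** (cadjoint Q ** Q) ** cdiag m ** cadjoint Q"
    by (simp add: spec_def matrix_mul_assoc)
  then show ?thesis using assms
    by (simp add: unitary_def spec_def cdiag_mult_cdiag flip: matrix_mul_assoc)
       (simp add: matrix_mul_assoc cdiag_mult_cdiag)
qed

lemma spec_1: "unitary Q \<Longrightarrow> spec Q (\<lambda>i. 1) = mat 1"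
  by (simp add: spec_def cdiag_1 unitary_right)

text \<open>\<open>W\<close>, the change of basis between the two eigenbases, intertwines the
  diagonals, so its entry at \<open>(i, j)\<close> vanishes unless \<open>l j = m i\<close>. It
  therefore intertwines every function of them. This is the uniqueness that the definite description
  in \<open>mat_powr\<close> asks for.\<close>

lemma spec_cong_function:
  assumes Q: "unitary Q" and R: "unitary R" and eq: "spec Q l = spec R m"
  shows "spec Q (\<lambda>i. \<phi> (l i)) = spec R (\<lambda>i. \<phi> (m i))"
proof -
  define W where "W = cadjoint R ** Q"
  have "cadjoint R ** spec Q l ** Q = W ** cdiag l"
    using Q by (simp add: W_def spec_def unitary_def flip: matrix_mul_assoc)
  moreover have "cadjoint R ** spec R m ** Q = cdiag m ** W"
    using R by (simp add: W_def spec_def unitary_def matrix_mul_assoc)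
  ultimately have "(W ** cdiag l) $ i $ j = (cdiag m ** W) $ i $ j" for i j
    using eq by simp
  then have "W $ i $ j * of_real (l j) = of_real (m i) * W $ i $ j" for i j
    by (simp only: cdiag_mult_left cdiag_mult_right)
  then have "W $ i $ j = 0 \<or> l j = m i" for i j
    by (metis mult.commute mult_cancel_right of_real_eq_iff)
  then have "W $ i $ j * of_real (\<phi> (l j)) = of_real (\<phi> (m i)) * W $ i $ j" for i j
    by (metis mult.commute mult_zero_left)
  then have *: "W ** cdiag (\<lambda>i. \<phi> (l i)) = cdiag (\<lambda>i. \<phi> (m i)) ** W"
    by (simp add: vec_eq_iff cdiag_mult_left cdiag_mult_right)
  have "R ** (W ** cdiag (\<lambda>i. \<phi> (l i))) ** cadjoint Q = spec Q (\<lambda>i. \<phi> (l i))"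
    using unitary_right[OF R] by (simp add: W_def spec_def matrix_mul_assoc)
  moreover have "R ** (cdiag (\<lambda>i. \<phi> (m i)) ** W) ** cadjoint Q = spec R (\<lambda>i. \<phi> (m i))"
    using unitary_right[OF Q] by (simp add: W_def spec_def flip: matrix_mul_assoc)
  ultimately show ?thesis using * by simp
qed

lemma mat_powr_spec:
  fixes Q :: "complex^'m^'m"
  assumes Q: "unitary Q" and l: "\<And>i. 0 < l i"
  shows "mat_powr (spec Q l) s = spec Q (\<lambda>i. l i powr s)"
  unfolding mat_powr_def
proof (rule the_equality)
  show "\<exists>(Q' :: complex^'m^'m) l'. cadjoint Q' ** Q' = mat 1 \<and> (\<forall>i. 0 < l' i) \<and> spec Q l = Q' ** cdiag l' ** cadjoint Q' \<and>
     spec Q (\<lambda>i. l i powr s) = Q' ** cdiag (\<lambda>i. l' i powr s) ** cadjoint Q'"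
    by (rule exI[of _ Q], rule exI[of _ l]) (use Q l in \<open>auto simp: spec_def unitary_def\<close>)
next
  fix P
  assume "\<exists>(Q' :: complex^'m^'m) l'. cadjoint Q' ** Q' = mat 1 \<and> (\<forall>i. 0 < l' i) \<and> spec Q l = Q' ** cdiag l' ** cadjoint Q' \<and>
     P = Q' ** cdiag (\<lambda>i. l' i powr s) ** cadjoint Q'"
  then obtain R m where R: "unitary R" "spec Q l = spec R m" "P = spec R (\<lambda>i. m i powr s)"
    by (auto simp: spec_def unitary_def)
  show "P = spec Q (\<lambda>i. l i powr s)"
    using spec_cong_function[OF Q R(1,2), of "\<lambda>x. x powr s"] R(3) by simp
qed

lemma pos_def_spectral:
  fixes A :: "complex^'m^'m"
  assumes "pos_def A"
  obtains Q l where "unitary Q" "\<And>i. 0 < l i" "A = spec Q l"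
proof -
  have A: "cadjoint A = A" and pos: "\<And>v. v \<noteq> 0 \<Longrightarrow> 0 < Re (cip v (A *v v))"
    using assms by (auto simp: pos_def_cip)
  obtain S where S: "finite S" "card S = CARD('m)"
    "\<And>u. u \<in> S \<Longrightarrow> norm u = 1 \<and> (\<exists>l::real. A *v u = complex_of_real l *s u)"
    "\<And>u v. u \<in> S \<Longrightarrow> v \<in> S \<Longrightarrow> u \<noteq> v \<Longrightarrow> cip u v = 0"
    using hermitian_orthonormal_eigenvectors[OF A order_refl] by auto
  \<comment> \<open>The eigenvectors come as a set with exactly \<open>CARD('m)\<close> elements;
    enumerating it by the index type turns them into the columns of a unitary matrix.\<close>
  obtain e :: "'m \<Rightarrow> complex^'m" where e: "bij_betw e UNIV S"
    using finite_same_card_bij[of "UNIV :: 'm set" S] S(1,2) by auto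
  have eS: "e j \<in> S" for j using e by (auto simp: bij_betw_def)
  obtain l :: "'m \<Rightarrow> real" where l: "\<And>j. A *v e j = complex_of_real (l j) *s e j"
    using S(3)[OF eS] by metis
  define Q where "Q = (\<chi> i j. e j $ i)"
  have "(cadjoint Q ** Q) $ i $ j = cip (e i) (e j)" for i j
    by (simp add: matrix_matrix_mult_def cadjoint_def Q_def cip_def)
  moreover have "cip (e i) (e j) = (if i = j then 1 else 0)" for i j
    using S(3)[OF eS, of i] S(4)[OF eS eS, of i j] e
    by (auto simp: cip_self bij_betw_def inj_on_def)
  ultimately have Q: "unitary Q"
    by (simp add: unitary_def vec_eq_iff mat_def)
  have "A ** Q = Q ** cdiag l"
  proof -
    have "(A ** Q) $ i $ j = (A *v e j) $ i" for i j
      by (simp add: matrix_matrix_mult_def matrix_vector_mult_def Q_def)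
    then show ?thesis by (simp add: vec_eq_iff cdiag_mult_right l) (simp add: Q_def)
  qed
  then have "A ** (Q ** cadjoint Q) = spec Q l"
    by (simp add: spec_def matrix_mul_assoc)
  then have "A = spec Q l" using unitary_right[OF Q] by simp
  moreover have "0 < l j" for j
  proof -
    have "e j \<noteq> 0" using S(3)[OF eS, of j] by auto
    from pos[OF this] show ?thesis using S(3)[OF eS, of j] by (simp add: l cip_scale_right cip_self)
  qed
  ultimately show ?thesis using Q that by blast
qed

text \<open>The norm of \<open>L^p(U^(p/q))\<close> involves \<open>(U^(p/q))^(1/p)\<close>, which
  has to be recognised as \<open>U^(1/q)\<close>.\<close>

lemma mat_powr_mat_powr:
  assumes "pos_def A"
  shows "mat_powr (mat_powr A a) b = mat_powr A (a * b)"
proof -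
  obtain Q l where Q: "unitary Q" "\<And>i. 0 < l i" "A = spec Q l" using pos_def_spectral[OF assms] by blast
  have "mat_powr (spec Q (\<lambda>i. l i powr a)) b = spec Q (\<lambda>i. (l i powr a) powr b)"
    by (rule mat_powr_spec) (use Q in \<open>auto simp: less_le\<close>)
  then show ?thesis using Q by (simp add: mat_powr_spec powr_powr)
qed

text \<open>Lets \<open>U^(-1/q) U^(1/q)\<close> be inserted between \<open>B(x) - B(y)\<close> and
  \<open>f(y)\<close>, which separates the bump kernel from the weighted function.\<close>

lemma mat_powr_minus_mult:
  assumes "pos_def A"
  shows "mat_powr A (- s) ** mat_powr A s = mat 1"
proof -
  obtain Q l where Q: "unitary Q" "\<And>i. 0 < l i" "A = spec Q l" using pos_def_spectral[OF assms] by blast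
  have "l i powr (- s) * l i powr s = 1" for i using Q(2)[of i] by (simp add: powr_minus)
  then show ?thesis using Q by (simp add: mat_powr_spec spec_mult spec_1)
qed

section \<open>Measurability of matrix powers\<close>

lemma borel_measurable_matrix_mult [measurable]:
  fixes f :: "'a \<Rightarrow> complex^'m^'n" and g :: "'a \<Rightarrow> complex^'k^'m"
  assumes "f \<in> borel_measurable M" "g \<in> borel_measurable M"
  shows "(\<lambda>x. f x ** g x) \<in> borel_measurable M"
proof (rule borel_measurable_continuous_Pair[OF assms])
  show "continuous_on UNIV (\<lambda>x. fst x ** snd x :: complex^'k^'n)"
    unfolding matrix_matrix_mult_def by (intro continuous_intros)
qed

lemma borel_measurable_matrix_vector_mult [measurable]:
  fixes f :: "'a \<Rightarrow> complex^'m^'n" and g :: "'a \<Rightarrow> complex^'m"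
  assumes "f \<in> borel_measurable M" "g \<in> borel_measurable M"
  shows "(\<lambda>x. f x *v g x) \<in> borel_measurable M"
proof (rule borel_measurable_continuous_Pair[OF assms])
  show "continuous_on UNIV (\<lambda>x. fst x *v snd x :: complex^'n)"
    unfolding matrix_vector_mult_def by (intro continuous_intros)
qed

text \<open>The trace bounds all eigenvalues of a positive definite matrix and is a measurable
  function of its entries, so it can serve as the scaling factor of the series below.\<close>

lemma spec_trace:
  assumes "unitary Q"
  shows "(\<Sum>i\<in>UNIV. Re (spec Q l $ i $ i)) = (\<Sum>k\<in>UNIV. l k)"
proof -
  have "(\<Sum>i\<in>UNIV. spec Q l $ i $ i) = (\<Sum>k\<in>UNIV. \<Sum>i\<in>UNIV. Q $ i $ k * of_real (l k) * cnj (Q $ i $ k))"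
    unfolding spec_nth by (rule sum.swap)
  also have "\<dots> = (\<Sum>k\<in>UNIV. of_real (l k) * (cadjoint Q ** Q) $ k $ k)"
    by (simp add: matrix_matrix_mult_def cadjoint_def sum_distrib_left algebra_simps)
  also have "\<dots> = (\<Sum>k\<in>UNIV. of_real (l k))"
    using assms by (simp add: unitary_def mat_def)
  finally show ?thesis by (metis Re_complex_of_real Re_sum of_real_sum)
qed

definition mat_pow :: "complex^'m^'m \<Rightarrow> nat \<Rightarrow> complex^'m^'m" where
  "mat_pow A k = (((**) A) ^^ k) (mat 1)"

lemma mat_pow_spec: "unitary Q \<Longrightarrow> mat_pow (spec Q l) k = spec Q (\<lambda>i. l i ^ k)"
  by (induction k) (simp_all add: mat_pow_def spec_1 spec_mult)

lemma borel_measurable_mat_pow [measurable]: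
  "f \<in> borel_measurable M \<Longrightarrow> (\<lambda>x. mat_pow (f x) k) \<in> borel_measurable M"
  by (induction k) (simp_all add: mat_pow_def)

lemma spec_diff_scale:
  assumes "unitary Q"
  shows "c *\<^sub>R spec Q l - mat 1 = spec Q (\<lambda>i. c * l i - 1)"
  unfolding spec_1[OF assms, symmetric] vec_eq_iff vector_minus_component vector_scaleR_component spec_nth
  by (simp add: scaleR_sum_right sum_subtractf sum_distrib_left scaleR_conv_of_real[where 'a = complex] algebra_simps)

lemma spec_sum: "(\<Sum>k\<in>K. b k *\<^sub>R spec Q (l k)) = spec Q (\<lambda>i. \<Sum>k\<in>K. b k * l k i)"
proof -
  have "(\<Sum>k\<in>K. b k *\<^sub>R spec Q (l k) $ i $ j) = spec Q (\<lambda>i. \<Sum>k\<in>K. b k * l k i) $ i $ j" for i j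
    unfolding spec_nth
    by (simp add: scaleR_sum_right sum_distrib_left sum_distrib_right scaleR_conv_of_real[where 'a = complex] algebra_simps sum.swap[of _ K])
  then show ?thesis by (simp add: vec_eq_iff)
qed

text \<open>
  The binomial series for \<open>A\<^sup>s = c\<^sup>s (1 + (A/c - 1))\<^sup>s\<close>, where \<open>c\<close> is the trace of \<open>A\<close>:
  the eigenvalues of \<open>A/c - 1\<close> lie in \<open>(-1, 0]\<close>. It exhibits \<open>A\<^sup>s\<close> as a limit of expressions
  that are measurable in \<open>A\<close>.
\<close>
lemma mat_powr_binomial_series:
  fixes A :: "complex^'m^'m"
  assumes "pos_def A"
  defines "c \<equiv> \<Sum>i\<in>UNIV. Re (A $ i $ i)"
  shows "(\<lambda>N. (c powr s) *\<^sub>R (\<Sum>k<N. (s gchoose k) *\<^sub>R mat_pow ((1 / c) *\<^sub>R A - mat 1) k)) \<longlonglongrightarrow> mat_powr A s"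
proof -
  obtain Q l where Q: "unitary Q" "\<And>i. 0 < l i" "A = spec Q l"
    using pos_def_spectral[OF assms(1)] by blast
  have c: "c = (\<Sum>k\<in>UNIV. l k)" using spec_trace[OF Q(1)] Q(3) by (simp add: c_def)
  have lc: "l i \<le> c" for i
    unfolding c by (rule member_le_sum) (use Q(2) in \<open>auto intro: less_imp_le\<close>)
  have c0: "0 < c" using lc Q(2) less_le_trans by blast
  define z where "z i = 1 / c * l i - 1" for i
  have z: "\<bar>z i\<bar> < 1" for i
    using lc[of i] Q(2)[of i] c0 by (simp add: z_def abs_less_iff field_simps)
  have *: "(c powr s) *\<^sub>R (\<Sum>k<N. (s gchoose k) *\<^sub>R mat_pow ((1 / c) *\<^sub>R A - mat 1) k) =
    spec Q (\<lambda>i. c powr s * (\<Sum>k<N. (s gchoose k) * z i ^ k))" for N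
    \<comment> \<open>The sum over the one-element set \<open>{0}\<close> moves the scalar
      \<open>c powr s\<close> into \<open>spec\<close>.\<close>
    using spec_sum[of "\<lambda>_. c powr s" Q "\<lambda>_ i. (\<Sum>k<N. (s gchoose k) * z i ^ k)" "{0::nat}"]
    unfolding z_def by (simp add: Q(3) spec_diff_scale Q(1) mat_pow_spec spec_sum)
  have lim: "(\<lambda>N. c powr s * (\<Sum>k<N. (s gchoose k) * z i ^ k)) \<longlonglongrightarrow> l i powr s" for i
  proof -
    have "(\<lambda>k. (s gchoose k) * z i ^ k) sums (1 + z i) powr s" by (rule gen_binomial_real[OF z])
    then have "(\<lambda>N. c powr s * (\<Sum>k<N. (s gchoose k) * z i ^ k)) \<longlonglongrightarrow> c powr s * (1 + z i) powr s"
      by (intro tendsto_mult_left) (simp add: sums_def)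
    moreover have "c powr s * (1 + z i) powr s = l i powr s"
      using c0 Q(2)[of i] by (simp add: z_def flip: powr_mult)
    ultimately show ?thesis by simp
  qed
  have "(\<lambda>N. spec Q (\<lambda>i. c powr s * (\<Sum>k<N. (s gchoose k) * z i ^ k))) \<longlonglongrightarrow> spec Q (\<lambda>i. l i powr s)"
    by (intro vec_tendstoI, simp only: spec_nth) (intro tendsto_intros lim)
  then show ?thesis unfolding * by (simp add: mat_powr_spec Q)
qed

lemma measurable_mat_powr:
  fixes W :: "real^'d \<Rightarrow> complex^'m^'m"
  assumes "matrix_weight W"
  shows "(\<lambda>x. mat_powr (W x) s) \<in> borel_measurable lebesgue"
proof -
  have [measurable]: "W \<in> borel_measurable lebesgue" and pd: "AE x in lebesgue. pos_def (W x)"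
    using assms by (auto simp: matrix_weight_def)
  define c where "c x = (\<Sum>i\<in>UNIV. Re (W x $ i $ i))" for x
  have [measurable]: "c \<in> borel_measurable lebesgue" 
    unfolding c_def
    by (intro borel_measurable_sum measurable_compose[OF \<open>W \<in> borel_measurable lebesgue\<close>]
        borel_measurable_continuous_onI continuous_intros)
  define P where "P N x = (c x powr s) *\<^sub>R (\<Sum>k<N. (s gchoose k) *\<^sub>R mat_pow ((1 / c x) *\<^sub>R W x - mat 1) k)" for N x
  have P[measurable]: "P N \<in> borel_measurable lebesgue" for N unfolding P_def by measurable
  have AEl: "AE x in lebesgue. (\<lambda>N. P N x) \<longlonglongrightarrow> mat_powr (W x) s"
    using pd unfolding P_def c_def by eventually_elim (rule mat_powr_binomial_series)
  \<comment> \<open>Off the null set \<open>S\<close> the series converges. Everything is set to 0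
    on \<open>S\<close>, and completeness of Lebesgue measure makes this change harmless.\<close>
  define S where "S = {x. \<not> (\<lambda>N. P N x) \<longlonglongrightarrow> mat_powr (W x) s}"
  have S: "S \<in> null_sets lebesgue" using AEl unfolding S_def by (simp add: completion.AE_iff_null_sets)
  then have [measurable]: "S \<in> sets lebesgue" by auto
  have "(\<lambda>x. if x \<in> S then 0 else mat_powr (W x) s) \<in> borel_measurable lebesgue"
  proof (rule borel_measurable_LIMSEQ_metric)
    show "(\<lambda>x. if x \<in> S then 0 else P N x) \<in> borel_measurable lebesgue" for N by measurable
    show "(\<lambda>N. if x \<in> S then 0 else P N x) \<longlonglongrightarrow> (if x \<in> S then 0 else mat_powr (W x) s)" for x
      by (auto simp: S_def)
  qed
  moreover have "AE x in lebesgue. (if x \<in> S then 0 else mat_powr (W x) s) = mat_powr (W x) s"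
    using AE_not_in[OF S] by eventually_elim simp
  ultimately show ?thesis by (rule borel_measurable_AE)
qed

section \<open>The operator norm\<close>

lemma mat_norm_nonneg: "0 \<le> mat_norm A"
  unfolding mat_norm_def by (rule onorm_pos_le) (rule matrix_vector_mul_bounded_linear)

lemma norm_matrix_vector_le: "norm (A *v v) \<le> mat_norm A * norm v"
  for A :: "complex^'m^'m"
  unfolding mat_norm_def by (rule onorm) (rule matrix_vector_mul_bounded_linear)

lemma mat_norm_le_sum: "mat_norm A \<le> (\<Sum>i\<in>UNIV. \<Sum>j\<in>UNIV. norm (A $ i $ j))"
  for A :: "complex^'m^'m"
  unfolding mat_norm_def
proof (rule onorm_le)
  fix v :: "complex^'m"
  have "norm (A *v v) \<le> (\<Sum>i\<in>UNIV. norm ((A *v v) $ i))"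
    by (auto simp: norm_vec_def intro: L2_set_le_sum)
  also have "\<dots> \<le> (\<Sum>i\<in>UNIV. (\<Sum>j\<in>UNIV. norm (A $ i $ j) * norm v))"
    unfolding matrix_vector_mult_def
    by (intro sum_mono) (auto intro!: sum_norm_le mult_left_mono Finite_Cartesian_Product.norm_nth_le simp: norm_mult)
  finally show "norm (A *v v) \<le> (\<Sum>i\<in>UNIV. \<Sum>j\<in>UNIV. norm (A $ i $ j)) * norm v"
    by (simp add: sum_distrib_right)
qed

text \<open>The triangle inequality and the entrywise bound control the difference of two norms.
  Continuity is what makes the bump kernel measurable.\<close>

lemma continuous_on_mat_norm: "continuous_on UNIV (mat_norm :: complex^'m^'m \<Rightarrow> real)"
proof -
  have tri: "mat_norm A \<le> mat_norm B + mat_norm (A - B)" for A B :: "complex^'m^'m"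
  proof -
    have "(\<lambda>v. A *v v) = (\<lambda>v. B *v v + (A - B) *v v)"
      by (simp add: matrix_vector_mult_diff_rdistrib)
    then show ?thesis unfolding mat_norm_def
      by (metis onorm_triangle matrix_vector_mul_bounded_linear)
  qed
  have "(mat_norm \<longlongrightarrow> mat_norm A) (at A)" for A :: "complex^'m^'m"
  proof (rule LIM_zero_cancel, rule Lim_null_comparison)
    let ?s = "\<lambda>X. \<Sum>i\<in>UNIV. \<Sum>j\<in>UNIV. norm (X $ i $ j :: complex)"
    have "\<bar>mat_norm X - mat_norm A\<bar> \<le> ?s (X - A)" for X
      using tri[of X A] tri[of A X] mat_norm_le_sum[of "X - A"] mat_norm_le_sum[of "A - X"]
      by (simp add: norm_minus_commute abs_le_iff)
    then show "\<forall>\<^sub>F X in at A. norm (mat_norm X - mat_norm A) \<le> ?s (X - A)" by simp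
    have "((\<lambda>X. ?s (X - A)) \<longlongrightarrow> ?s (A - A)) (at A)" by (intro tendsto_intros)
    then show "((\<lambda>X. ?s (X - A)) \<longlongrightarrow> 0) (at A)" by simp
  qed
  then show ?thesis by (simp add: continuous_on_def)
qed

lemma borel_measurable_mat_norm [measurable]:
  "f \<in> borel_measurable M \<Longrightarrow> (\<lambda>x. mat_norm (f x)) \<in> borel_measurable M"
  using measurable_compose[OF _ borel_measurable_continuous_onI[OF continuous_on_mat_norm]] by blast

section \<open>Level sets\<close>

text \<open>Completion does not change the measure of Borel sets, so the countable cover for
  \<open>lborel\<close> serves here too. Points live on \<open>lebesgue\<close>, while cube
  parameters and levels are integrated over \<open>lborel\<close>; both kinds of product occur in
  Tonelli's theorem below.\<close>

lemma sigma_finite_lebesgue: "sigma_finite_measure (lebesgue :: 'a::euclidean_space measure)"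
proof -
  obtain A :: "'a set set" where A: "countable A" "A \<subseteq> sets lborel" "\<Union>A = space lborel"
    "\<forall>a\<in>A. emeasure lborel a \<noteq> \<infinity>"
    using lborel.sigma_finite_countable by blast
  show ?thesis
    by (rule sigma_finite_measure.intro) (use A in \<open>auto intro!: exI[of _ A]\<close>)
qed

interpretation lebesgue: sigma_finite_measure "lebesgue :: 'a::euclidean_space measure"
  by (rule sigma_finite_lebesgue)

interpretation lebesgue_pair: pair_sigma_finite
  "lebesgue :: 'a::euclidean_space measure" "lebesgue :: 'b::euclidean_space measure" ..

interpretation lborel_lebesgue: pair_sigma_finite
  "lborel :: 'a::euclidean_space measure" "lebesgue :: 'b::euclidean_space measure" ..

section \<open>Power integrals and Jensen's inequality\<close>

lemma nn_integral_powr_lessThan: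
  assumes "0 < a" "0 \<le> m"
  shows "(\<integral>\<^sup>+t. ennreal (t powr (a - 1)) * indicator {0<..<m} t \<partial>lborel) = ennreal (m powr a / a)"
proof -
  have "((\<lambda>t. t powr (a - 1)) has_integral (m powr (a - 1 + 1) / (a - 1 + 1))) {0..m}"
    by (rule has_integral_powr_from_0) (use assms in auto)
  then have "(\<integral>\<^sup>+t. ennreal (indicator {0..m} t * t powr (a - 1)) \<partial>lborel) = ennreal (m powr a / a)"
    by (intro nn_integral_has_integral_lebesgue) auto
  also have "(\<integral>\<^sup>+t. ennreal (indicator {0..m} t * t powr (a - 1)) \<partial>lborel) =
     (\<integral>\<^sup>+t. ennreal (t powr (a - 1)) * indicator {0<..<m} t \<partial>lborel)"
  proof (rule nn_integral_cong_AE)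
    have "AE t in lborel. t \<noteq> m" by (rule AE_lborel_singleton)
    then show "AE t in lborel. ennreal (indicator {0..m} t * t powr (a - 1)) =
       ennreal (t powr (a - 1)) * indicator {0<..<m} t"
      by eventually_elim (auto simp: indicator_def)
  qed
  finally show ?thesis .
qed

lemma nn_integral_powr_atLeast:
  fixes a b :: real
  assumes "0 < a" "0 < b"
  shows "(\<integral>\<^sup>+t. ennreal (t powr (- b - 1)) * indicator {a..} t \<partial>lborel) = ennreal (a powr (- b) / b)"
proof -
  have "((\<lambda>t. t powr (- b - 1)) has_integral - (a powr (- b - 1 + 1)) / (- b - 1 + 1)) {a..}"
    by (rule has_integral_powr_to_inf) (use assms in auto)
  then have "(\<integral>\<^sup>+t. ennreal (indicator {a..} t * t powr (- b - 1)) \<partial>lborel) = ennreal (a powr (- b) / b)"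
    by (intro nn_integral_has_integral_lebesgue) auto
  then show ?thesis by (simp add: ennreal_mult' mult.commute ennreal_indicator)
qed

text \<open>A form of Young's inequality with the coefficient 1/2 on the first term, so that this
  term can be absorbed; the threshold \<open>x = a/2\<close> produces the factor
  \<open>2 powr (s - 1)\<close>.\<close>

lemma powr_Young_half:
  fixes a x s :: real
  assumes "0 < a" "0 \<le> x" "1 \<le> s"
  shows "a powr (s - 1) * x \<le> a powr s / 2 + 2 powr (s - 1) * x powr s"
proof (cases "x \<le> a / 2")
  case True
  have "a powr (s - 1) * x \<le> a powr (s - 1) * (a / 2)" using True by (intro mult_left_mono) auto
  also have "\<dots> = a powr s / 2" using assms(1) by (simp add: powr_diff)
  finally show ?thesis by (simp add: add_increasing2)
next
  case False
  then have x: "0 < x" "a \<le> 2 * x" using assms by auto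
  have "a powr (s - 1) * x \<le> (2 * x) powr (s - 1) * x"
    using assms x by (intro mult_right_mono powr_mono2) auto
  also have "\<dots> = 2 powr (s - 1) * x powr s" using x by (simp add: powr_mult powr_diff)
  finally show ?thesis by (simp add: add_increasing)
qed

text \<open>The lower bound \<open>a\<close> stands for the integral, which may be infinite.
  Multiplying \<open>a\<close> by \<open>a powr (s - 1)\<close> and applying
  \<open>powr_Young_half\<close> under the integral leaves \<open>a powr s / 2\<close> on the right
  because \<open>w\<close> has mass at most 1; absorbing it doubles the constant.\<close>

lemma weighted_Jensen_powr:
  fixes w \<phi> :: "'a \<Rightarrow> real"
  assumes [measurable]: "w \<in> borel_measurable M" "\<phi> \<in> borel_measurable M"
    and nonneg: "\<And>x. 0 \<le> w x" "\<And>x. 0 \<le> \<phi> x"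
    and w: "(\<integral>\<^sup>+x. ennreal (w x) \<partial>M) \<le> 1" and s: "1 \<le> s"
    and a: "0 < a" "ennreal a \<le> (\<integral>\<^sup>+x. ennreal (w x * \<phi> x) \<partial>M)"
  shows "ennreal (a powr s) \<le> ennreal (2 powr s) * (\<integral>\<^sup>+x. ennreal (w x * \<phi> x powr s) \<partial>M)"
    (is "_ \<le> _ * ?I")
proof (cases "?I = \<infinity>")
  case True
  then show ?thesis by (simp add: ennreal_mult_top)
next
  case False
  have "ennreal (a powr s) = ennreal (a powr (s - 1)) * ennreal a"
    using a by (simp add: powr_diff flip: ennreal_mult)
  also have "\<dots> \<le> ennreal (a powr (s - 1)) * (\<integral>\<^sup>+x. ennreal (w x * \<phi> x) \<partial>M)"
    using a by (intro mult_left_mono) auto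
  also have "\<dots> = (\<integral>\<^sup>+x. ennreal (w x * (a powr (s - 1) * \<phi> x)) \<partial>M)"
    by (subst nn_integral_cmult[symmetric]) (auto simp: nonneg ennreal_mult' [symmetric] mult_ac)
  also have "\<dots> \<le> (\<integral>\<^sup>+x. ennreal (a powr s / 2) * ennreal (w x) +
      ennreal (2 powr (s - 1)) * ennreal (w x * \<phi> x powr s) \<partial>M)"
  proof (rule nn_integral_mono)
    fix x
    have "w x * (a powr (s - 1) * \<phi> x) \<le> w x * (a powr s / 2 + 2 powr (s - 1) * \<phi> x powr s)"
      by (intro mult_left_mono powr_Young_half a nonneg s)
    then show "ennreal (w x * (a powr (s - 1) * \<phi> x)) \<le> ennreal (a powr s / 2) * ennreal (w x) +
      ennreal (2 powr (s - 1)) * ennreal (w x * \<phi> x powr s)"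
      using nonneg by (simp add: ennreal_mult[symmetric] ennreal_plus[symmetric] ring_distribs mult_ac ennreal_leI
         del: ennreal_plus)
  qed
  also have "\<dots> = ennreal (a powr s / 2) * (\<integral>\<^sup>+x. ennreal (w x) \<partial>M) + ennreal (2 powr (s - 1)) * ?I"
    by (simp add: nn_integral_add nn_integral_cmult)
  also have "\<dots> \<le> ennreal (a powr s / 2) * 1 + ennreal (2 powr (s - 1)) * ?I"
    by (intro add_right_mono mult_left_mono w) auto
  finally have main: "ennreal (a powr s) \<le> ennreal (a powr s / 2) + ennreal (2 powr (s - 1)) * ?I" by simp
  obtain r where r: "0 \<le> r" "?I = ennreal r" using False by (cases ?I) auto
  have "a powr s \<le> a powr s / 2 + 2 powr (s - 1) * r"
    using main r by (simp add: ennreal_mult[symmetric] ennreal_plus[symmetric] del: ennreal_plus)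
  then have "a powr s \<le> 2 powr s * r" by (simp add: powr_diff field_simps)
  then show ?thesis using r by (simp add: ennreal_mult[symmetric] ennreal_leI)
qed

text \<open>The substitution \<open>t = c/\<lambda>\<close>; it is routed through \<open>u = - c/\<lambda>\<close>, which is increasing in \<open>\<lambda>\<close>.\<close>
lemma nn_integral_reciprocal_substitution_le:
  fixes F :: "real \<Rightarrow> real"
  assumes [measurable]: "F \<in> borel_measurable borel" and F: "\<And>t. 0 \<le> F t" and c: "0 < c"
  shows "(\<integral>\<^sup>+l. ennreal (l powr (q - 1) * F (c / l)) * indicator {0<..<c} l \<partial>lborel) \<le>
    ennreal (c powr q) * (\<integral>\<^sup>+t\<in>{1..}. ennreal (F t / t powr q / t) \<partial>lborel)" (is "?L \<le> ?R")
proof -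
  \<comment> \<open>The substitution rule is applied on compact intervals; as \<open>N\<close> grows
    they exhaust \<open>{0<..<c}\<close>.\<close>
  have bound: "(\<integral>\<^sup>+l. ennreal (l powr (q - 1) * F (c / l)) * indicator {c / real (Suc N)..c} l \<partial>lborel) \<le> ?R" for N
  proof -
    let ?n = "real (Suc N)"
    let ?f = "\<lambda>l. ennreal (l powr (q - 1) * F (c / l))"
    have "(\<integral>\<^sup>+l. ?f l * indicator {c / ?n..c} l \<partial>lborel) =
      (\<integral>\<^sup>+l. ennreal (l powr (q - 1) * F (c / l)) * indicator {- c / (- ?n)..- c / (- 1)} l \<partial>lborel)"
      by (simp only: minus_divide_divide div_by_1)
    also have "\<dots> = (\<integral>\<^sup>+u. ennreal ((- c / u) powr (q - 1) * F (c / (- c / u)) * (c / u\<^sup>2)) * indicator {- ?n..- 1} u \<partial>lborel)"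
      unfolding nn_integral_set_ennreal
    proof (rule nn_integral_substitution[where g = "\<lambda>u. - c / u" and g' = "\<lambda>u. c / u\<^sup>2"])
      show "set_borel_measurable borel {- c / - ?n..- c / - 1} (\<lambda>l. l powr (q - 1) * F (c / l))"
        unfolding set_borel_measurable_def by measurable
      show "\<And>u. u \<in> {- ?n..- 1} \<Longrightarrow> ((\<lambda>u. - c / u) has_real_derivative c / u\<^sup>2) (at u)"
        by (auto intro!: derivative_eq_intros simp: power2_eq_square)
      show "continuous_on {- ?n..- 1} (\<lambda>u. c / u\<^sup>2)" by (intro continuous_intros) auto
      show "0 \<le> c / u\<^sup>2" for u using c by simp
      show "- ?n \<le> - 1" by simp
    qed
    also have "\<dots> = (\<integral>\<^sup>+u. ennreal ((c / u) powr (q - 1) * F u * (c / u\<^sup>2)) * indicator {1..?n} u \<partial>lborel)"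
      using c by (subst nn_integral_real_affine[of _ "-1" 0]) (auto intro!: nn_integral_cong simp: indicator_def)
    also have "\<dots> \<le> (\<integral>\<^sup>+t. ennreal (c powr q) * (ennreal (F t / t powr q / t) * indicator {1..} t) \<partial>lborel)"
    proof (rule nn_integral_mono)
      fix t :: real
      have "(c / t) powr (q - 1) * F t * (c / t\<^sup>2) = c powr q * (F t / t powr q / t)" if "1 \<le> t"
        using that c by (simp add: powr_divide powr_diff power2_eq_square)
      then show "ennreal ((c / t) powr (q - 1) * F t * (c / t\<^sup>2)) * indicator {1..?n} t \<le>
        ennreal (c powr q) * (ennreal (F t / t powr q / t) * indicator {1..} t)"
        by (auto simp: indicator_def simp flip: ennreal_mult')
    qed
    also have "\<dots> = ?R" by (rule nn_integral_cmult) measurable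
    finally show ?thesis .
  qed
  have "?L \<le> (\<integral>\<^sup>+l. (SUP N. ennreal (l powr (q - 1) * F (c / l)) * indicator {c / real (Suc N)..c} l) \<partial>lborel)"
  proof (rule nn_integral_mono)
    fix l :: real
    show "ennreal (l powr (q - 1) * F (c / l)) * indicator {0<..<c} l \<le>
      (SUP N. ennreal (l powr (q - 1) * F (c / l)) * indicator {c / real (Suc N)..c} l)"
    proof (cases "l \<in> {0<..<c}")
      case True
      obtain N where "c / l < real N" using reals_Archimedean2 by blast
      then have "c / real (Suc N) \<le> l" using True by (simp add: field_simps)
      then show ?thesis using True by (intro SUP_upper2[of N]) auto
    qed simp
  qed
  also have "\<dots> = (SUP N. (\<integral>\<^sup>+l. ennreal (l powr (q - 1) * F (c / l)) * indicator {c / real (Suc N)..c} l \<partial>lborel))"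
  proof (rule nn_integral_monotone_convergence_SUP)
    show "incseq (\<lambda>N l. ennreal (l powr (q - 1) * F (c / l)) * indicator {c / real (Suc N)..c} l)"
    proof (rule incseq_SucI, rule le_funI)
      fix N l
      have "c / real (Suc (Suc N)) \<le> c / real (Suc N)" using c by (intro divide_left_mono) auto
      then show "ennreal (l powr (q - 1) * F (c / l)) * indicator {c / real (Suc N)..c} l \<le>
        ennreal (l powr (q - 1) * F (c / l)) * indicator {c / real (Suc (Suc N))..c} l"
        by (auto simp: indicator_def)
    qed
  qed measurable
  also have "\<dots> \<le> ?R" by (rule SUP_least) (rule bound)
  finally show ?thesis .
qed

text \<open>
  A substitute for the statement \<open>\<integral> l powr (q - 1) * A l powr s \<le> C\<close> that avoids
  powers of extended reals: \<open>R\<close> plays the role of a majorant of \<open>A powr s\<close>.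
\<close>
definition power_profile :: "(real \<Rightarrow> ennreal) \<Rightarrow> real \<Rightarrow> real \<Rightarrow> real \<Rightarrow> bool" where
  "power_profile A s q C \<longleftrightarrow> A \<in> borel_measurable borel \<and>
     (\<forall>l l'. 0 < l \<longrightarrow> l \<le> l' \<longrightarrow> A l' \<le> A l) \<and>
     (\<exists>R\<in>borel_measurable borel.
        (\<forall>l a. 0 < l \<longrightarrow> 0 < a \<longrightarrow> ennreal a \<le> A l \<longrightarrow> ennreal (a powr s) \<le> R l) \<and>
        (\<integral>\<^sup>+l. ennreal (l powr (q - 1)) * R l * indicator {0<..} l \<partial>lborel) \<le> ennreal C)"

text \<open>The distribution function of \<open>A\<close> on the positive half-line; for decreasing
  \<open>A\<close> it is a generalised inverse.\<close>

definition profile_dist :: "(real \<Rightarrow> ennreal) \<Rightarrow> real \<Rightarrow> ennreal" where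
  "profile_dist A t = (\<integral>\<^sup>+l. (if 0 < l \<and> ennreal t < A l then 1 else 0) \<partial>lborel)"

lemma profile_dist_measurable [measurable]:
  assumes [measurable]: "A \<in> borel_measurable borel"
  shows "profile_dist A \<in> borel_measurable borel"
  unfolding profile_dist_def by measurable

text \<open>Since \<open>A\<close> decreases, \<open>R\<close> is at least \<open>a powr s\<close>
  on all of \<open>(0, l)\<close>, and integrating \<open>t powr (q - 1)\<close> over this interval
  gives \<open>l powr q / q\<close>.\<close>

lemma power_profile_Chebyshev:
  assumes A: "power_profile A s q C" and q: "0 < q" and C: "0 \<le> C"
    and l: "0 < l" and a: "0 < a" "ennreal a \<le> A l"
  shows "a powr s * l powr q \<le> q * C"
proof -
  obtain R where [measurable]: "R \<in> borel_measurable borel"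
    and R: "\<And>l a. 0 < l \<Longrightarrow> 0 < a \<Longrightarrow> ennreal a \<le> A l \<Longrightarrow> ennreal (a powr s) \<le> R l"
    and RC: "(\<integral>\<^sup>+l. ennreal (l powr (q - 1)) * R l * indicator {0<..} l \<partial>lborel) \<le> ennreal C"
    and anti: "\<And>l l'. 0 < l \<Longrightarrow> l \<le> l' \<Longrightarrow> A l' \<le> A l"
    using A by (auto simp: power_profile_def)
  have "ennreal (a powr s * (l powr q / q)) =
    ennreal (a powr s) * (\<integral>\<^sup>+t. ennreal (t powr (q - 1)) * indicator {0<..<l} t \<partial>lborel)"
    using q l by (subst nn_integral_powr_lessThan) (auto simp: ennreal_mult'[symmetric])
  also have "\<dots> = (\<integral>\<^sup>+t. ennreal (a powr s) * (ennreal (t powr (q - 1)) * indicator {0<..<l} t) \<partial>lborel)"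
    by (rule nn_integral_cmult[symmetric]) measurable
  also have "\<dots> \<le> (\<integral>\<^sup>+l. ennreal (l powr (q - 1)) * R l * indicator {0<..} l \<partial>lborel)"
  proof (rule nn_integral_mono)
    fix t
    show "ennreal (a powr s) * (ennreal (t powr (q - 1)) * indicator {0<..<l} t) \<le>
       ennreal (t powr (q - 1)) * R t * indicator {0<..} t"
    proof (cases "t \<in> {0<..<l}")
      case True
      then have "ennreal (a powr s) \<le> R t"
        using anti[of t l] a order_trans by (intro R) auto
      then show ?thesis using True by (simp add: mult.commute[of "ennreal (a powr s)"] mult_left_mono)
    qed simp
  qed
  also note RC
  finally have "a powr s * (l powr q / q) \<le> C" using C by simp
  then show ?thesis using q by (simp add: field_simps)
qed

lemma power_profile_finite:
  assumes A: "power_profile A s q C" and q: "0 < q" and C: "0 \<le> C" and s: "0 < s" and l: "0 < l"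
  shows "A l < \<infinity>"
proof (rule ccontr)
  assume "\<not> A l < \<infinity>"
  then have inf: "A l = \<infinity>" by (simp add: less_top[symmetric])
  \<comment> \<open>Chosen so that \<open>a powr s * l powr q = q * C + 1\<close>, just above the
    Chebyshev bound.\<close>
  define a where "a = ((q * C + 1) / l powr q) powr (1 / s)"
  have pos: "0 < q * C + 1" using q C by (simp add: add_nonneg_pos)
  then have a: "0 < a" using l by (simp add: a_def)
  have "a powr s = (q * C + 1) / l powr q"
    using s pos by (simp add: a_def powr_powr)
  then have "a powr s * l powr q = q * C + 1" using l by simp
  moreover have "a powr s * l powr q \<le> q * C"
    by (rule power_profile_Chebyshev[OF A q C l a]) (simp add: inf)
  ultimately show False by simp
qed

lemma profile_dist_finite:
  assumes A: "power_profile A s q C" and q: "0 < q" and C: "0 \<le> C" and t: "0 < t"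
  shows "profile_dist A t < \<infinity>"
proof -
  \<comment> \<open>\<open>L\<close> solves \<open>t powr s * L powr q = q * C\<close>, so no level
    beyond \<open>L\<close> can have \<open>A l > t\<close>.\<close>
  define L where "L = (q * C / t powr s) powr (1 / q)"
  have "profile_dist A t \<le> (\<integral>\<^sup>+l. indicator {0..L} l \<partial>lborel)"
    unfolding profile_dist_def
  proof (rule nn_integral_mono)
    fix l
    have "l \<le> L" if l: "0 < l" "ennreal t < A l"
    proof -
      have "t powr s * l powr q \<le> q * C"
        using l by (intro power_profile_Chebyshev[OF A q C l(1) t]) auto
      then have "l powr q \<le> q * C / t powr s" using t by (simp add: field_simps)
      then have "(l powr q) powr (1 / q) \<le> L"
        unfolding L_def using q by (intro powr_mono2) auto
      then show ?thesis using l q by (simp add: powr_powr)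
    qed
    then show "(if 0 < l \<and> ennreal t < A l then 1 else 0) \<le> (indicator {0..L} l :: ennreal)"
      by (auto simp: indicator_def)
  qed
  also have "\<dots> = ennreal L" by (simp add: L_def)
  also have "\<dots> < \<infinity>" by simp
  finally show ?thesis .
qed

text \<open>If \<open>A l \<le> t\<close>, then monotonicity confines all levels where
  \<open>A\<close> exceeds \<open>t\<close> to \<open>(0, l]\<close>, a set of measure
  \<open>l\<close>.\<close>

lemma profile_dist_gt:
  assumes anti: "\<And>l l'. 0 < l \<Longrightarrow> l \<le> l' \<Longrightarrow> A l' \<le> A l"
    and l: "0 < l" "ennreal l < profile_dist A t"
  shows "ennreal t < A l"
proof (rule ccontr)
  assume n: "\<not> ennreal t < A l"
  have "profile_dist A t \<le> (\<integral>\<^sup>+l'. indicator {0..l} l' \<partial>lborel)"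
    unfolding profile_dist_def
  proof (rule nn_integral_mono)
    fix l'
    have "l' \<le> l" if "0 < l'" "ennreal t < A l'"
      using that n anti[OF l(1), of l'] by (metis less_le_trans linear)
    then show "(if 0 < l' \<and> ennreal t < A l' then 1 else 0) \<le> (indicator {0..l} l' :: ennreal)"
      by (auto simp: indicator_def)
  qed
  also have "\<dots> = ennreal l" using l by simp
  finally show False using l by simp
qed

lemma ennreal_lessThan_indicator_powr:
  assumes "0 < s" "A < \<infinity>"
  shows "(\<integral>\<^sup>+t. ennreal (t powr (s - 1)) * indicator {t. 0 < t \<and> ennreal t < A} t \<partial>lborel) =
    ennreal (enn2real A powr s / s)"
proof -
  obtain r where r: "0 \<le> r" "A = ennreal r" using assms(2) by (cases A) auto
  then have "{t. 0 < t \<and> ennreal t < A} = {0<..<r}" by (auto simp: ennreal_less_iff)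
  then show ?thesis using nn_integral_powr_lessThan[OF assms(1) r(1)] r by simp
qed

text \<open>Every pair with \<open>l < profile_dist A t\<close> satisfies \<open>t < A l\<close>.
  Writing the power \<open>q\<close> as an integral over such \<open>l\<close> and exchanging the
  integrals turns it into the power \<open>s\<close> of \<open>A l\<close>, at the price of
  \<open>q / s\<close>.\<close>

lemma profile_dist_power_integral:
  assumes A: "power_profile A s q C" and q: "0 < q" and C: "0 \<le> C" and s: "0 < s"
  shows "(\<integral>\<^sup>+t. ennreal (t powr (s - 1) * enn2real (profile_dist A t) powr q) * indicator {0<..} t \<partial>lborel)
    \<le> ennreal (q / s * C)"
proof -
  obtain R where [measurable]: "R \<in> borel_measurable borel"
    and R: "\<And>l a. 0 < l \<Longrightarrow> 0 < a \<Longrightarrow> ennreal a \<le> A l \<Longrightarrow> ennreal (a powr s) \<le> R l"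
    and RC: "(\<integral>\<^sup>+l. ennreal (l powr (q - 1)) * R l * indicator {0<..} l \<partial>lborel) \<le> ennreal C"
    and anti: "\<And>l l'. 0 < l \<Longrightarrow> l \<le> l' \<Longrightarrow> A l' \<le> A l"
    and [measurable]: "A \<in> borel_measurable borel"
    using A by (auto simp: power_profile_def)
  let ?F = "\<lambda>t l. ennreal (t powr (s - 1)) * (ennreal q * ennreal (l powr (q - 1))) *
     indicator {0<..} t * indicator {0<..} l * (if ennreal t < A l then 1 else 0)"
  have "(\<integral>\<^sup>+t. ennreal (t powr (s - 1) * enn2real (profile_dist A t) powr q) * indicator {0<..} t \<partial>lborel)
    \<le> (\<integral>\<^sup>+t. (\<integral>\<^sup>+l. ?F t l \<partial>lborel) \<partial>lborel)"
  proof (rule nn_integral_mono)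
    fix t :: real
    show "ennreal (t powr (s - 1) * enn2real (profile_dist A t) powr q) * indicator {0<..} t \<le>
      (\<integral>\<^sup>+l. ?F t l \<partial>lborel)"
    proof (cases "0 < t")
      case True
      have fin: "profile_dist A t < \<infinity>" by (rule profile_dist_finite[OF A q C True])
      have "ennreal (t powr (s - 1) * enn2real (profile_dist A t) powr q) =
        ennreal (t powr (s - 1)) * (ennreal q * ennreal (enn2real (profile_dist A t) powr q / q))"
        using q by (simp add: ennreal_mult[symmetric])
      also have "\<dots> = ennreal (t powr (s - 1)) * (ennreal q * (\<integral>\<^sup>+l. ennreal (l powr (q - 1)) *
          indicator {l. 0 < l \<and> ennreal l < profile_dist A t} l \<partial>lborel))"
        by (simp add: ennreal_lessThan_indicator_powr[OF q fin])
      also have "\<dots> = (\<integral>\<^sup>+l. ennreal (t powr (s - 1)) * (ennreal q * (ennreal (l powr (q - 1)) *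
          indicator {l. 0 < l \<and> ennreal l < profile_dist A t} l)) \<partial>lborel)"
        by (simp add: nn_integral_cmult)
      also have "\<dots> \<le> (\<integral>\<^sup>+l. ?F t l \<partial>lborel)"
        by (rule nn_integral_mono)
           (use True profile_dist_gt[of A, OF anti] in \<open>auto simp: indicator_def mult_ac\<close>)
      finally show ?thesis using True by simp
    qed simp
  qed
  also have "\<dots> = (\<integral>\<^sup>+l. (\<integral>\<^sup>+t. ?F t l \<partial>lborel) \<partial>lborel)"
    by (rule lborel_pair.Fubini') measurable
  also have "\<dots> \<le> (\<integral>\<^sup>+l. ennreal (q / s) * (ennreal (l powr (q - 1)) * R l * indicator {0<..} l) \<partial>lborel)"
  proof (rule nn_integral_mono)
    fix l :: real
    show "(\<integral>\<^sup>+t. ?F t l \<partial>lborel) \<le> ennreal (q / s) * (ennreal (l powr (q - 1)) * R l * indicator {0<..} l)"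
    proof (cases "0 < l")
      case True
      have fin: "A l < \<infinity>" by (rule power_profile_finite[OF A q C s True])
      have "(\<integral>\<^sup>+t. ?F t l \<partial>lborel) = (\<integral>\<^sup>+t. (ennreal q * ennreal (l powr (q - 1))) *
         (ennreal (t powr (s - 1)) * indicator {t. 0 < t \<and> ennreal t < A l} t) \<partial>lborel)"
        by (rule nn_integral_cong) (use True in \<open>auto simp: indicator_def mult_ac\<close>)
      also have "\<dots> = (ennreal q * ennreal (l powr (q - 1))) * ennreal (enn2real (A l) powr s / s)"
        by (subst nn_integral_cmult) (auto simp: ennreal_lessThan_indicator_powr[OF s fin])
      also have "\<dots> = ennreal (q / s) * (ennreal (l powr (q - 1)) * ennreal (enn2real (A l) powr s))"
        using q s by (simp add: ennreal_mult[symmetric] field_simps)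
      also have "\<dots> \<le> ennreal (q / s) * (ennreal (l powr (q - 1)) * R l)"
      proof (intro mult_left_mono)
        show "ennreal (enn2real (A l) powr s) \<le> R l"
        \<comment> \<open>The majorant property of \<open>R\<close> speaks of positive
          \<open>a\<close> only.\<close>
        proof (cases "enn2real (A l) = 0")
          case False
          then have "0 < enn2real (A l)" by (simp add: less_le)
          then show ?thesis using True fin by (intro R) auto
        qed simp
      qed auto
      finally show ?thesis using True by simp
    qed simp
  qed
  also have "\<dots> = ennreal (q / s) * (\<integral>\<^sup>+l. ennreal (l powr (q - 1)) * R l * indicator {0<..} l \<partial>lborel)"
    by (rule nn_integral_cmult) measurable
  also have "\<dots> \<le> ennreal (q / s) * ennreal C" by (intro mult_left_mono RC) auto
  also have "\<dots> = ennreal (q / s * C)" using q s C by (simp add: ennreal_mult'[symmetric])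
  finally show ?thesis .
qed

lemma conjugate_exponent_gt_1:
  fixes q q' :: real
  assumes "1 < q" "1 / q + 1 / q' = 1"
  shows "1 < q'"
proof -
  have "1 / q' = 1 - 1 / q" using assms by simp
  moreover have "0 < 1 - 1 / q" "1 - 1 / q < 1" using assms by auto
  ultimately show ?thesis by (metis divide_less_eq_1_pos less_divide_eq_1_pos zero_less_divide_1_iff)
qed

lemma mult_le_powr_add_powr:
  fixes u v q q' :: real
  assumes "0 \<le> u" "0 \<le> v" "1 < q" "1 / q + 1 / q' = 1"
  shows "u * v \<le> u powr q + v powr q'"
proof -
  have q': "1 < q'" using assms(3,4) by (rule conjugate_exponent_gt_1)
  have "u * v \<le> u powr q / q + v powr q' / q'"
    using Youngs_inequality[of q q' u v] assms q' by simp
  also have "\<dots> \<le> u powr q + v powr q'"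
    using assms(3) q' mult_left_mono[of 1 q "u powr q"] mult_left_mono[of 1 q' "v powr q'"]
    by (intro add_mono) (auto simp: divide_le_eq)
  finally show ?thesis .
qed

text \<open>The power \<open>\<sigma>\<close> of the minimum is an integral over those
  \<open>t\<close> that lie below both values, and Tonelli's theorem then factors the integral over
  the levels into \<open>profile_dist A t * profile_dist B t\<close>. The exponent is the one for
  which \<open>t powr \<sigma>\<close> splits as \<open>t powr (s/q) * t powr (s'/q')\<close>, so
  that Young's inequality returns the integrals of
  \<open>profile_dist_power_integral\<close>.\<close>

lemma power_profile_pairing:
  assumes A: "power_profile A s q C" and B: "power_profile B s' q' C'"
    and q: "1 < q" "1 / q + 1 / q' = 1" and C: "0 \<le> C" "0 \<le> C'" and s: "0 < s" "0 < s'"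
  defines "\<sigma> \<equiv> s / q + s' / q'"
  shows "(\<integral>\<^sup>+l. (\<integral>\<^sup>+l'. ennreal (enn2real (min (A l) (B l')) powr \<sigma>) * indicator {0<..} l * indicator {0<..} l' \<partial>lborel) \<partial>lborel)
    \<le> ennreal (\<sigma> * (q / s * C + q' / s' * C'))"
proof -
  have q': "1 < q'" using q by (rule conjugate_exponent_gt_1)
  have \<sigma>: "0 < \<sigma>" using s q q' by (simp add: \<sigma>_def add_pos_pos)
  have [measurable]: "A \<in> borel_measurable borel" "B \<in> borel_measurable borel"
    using A B by (auto simp: power_profile_def)
  let ?F = "\<lambda>t l l'. ennreal (t powr (\<sigma> - 1)) * indicator {0<..} t *
      (if 0 < l \<and> ennreal t < A l then 1 else 0 :: ennreal) *
      (if 0 < l' \<and> ennreal t < B l' then 1 else 0 :: ennreal)"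
  let ?I = "\<integral>\<^sup>+t. ennreal (t powr (\<sigma> - 1)) * indicator {0<..} t * (profile_dist A t * profile_dist B t) \<partial>lborel"
  have eq: "ennreal (enn2real (min (A l) (B l')) powr \<sigma>) * indicator {0<..} l * indicator {0<..} l' =
     ennreal \<sigma> * (\<integral>\<^sup>+t. ?F t l l' \<partial>lborel)" for l l'
  proof (cases "0 < l \<and> 0 < l'")
    case True
    then have "A l < \<infinity>" using q s C by (intro power_profile_finite[OF A]) auto
    then have fin: "min (A l) (B l') < \<infinity>" by (simp add: min_less_iff_disj)
    have "(\<integral>\<^sup>+t. ?F t l l' \<partial>lborel) = (\<integral>\<^sup>+t. ennreal (t powr (\<sigma> - 1)) * indicator {t. 0 < t \<and> ennreal t < min (A l) (B l')} t \<partial>lborel)"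
      by (rule nn_integral_cong) (use True in \<open>auto simp: indicator_def\<close>)
    also have "\<dots> = ennreal (enn2real (min (A l) (B l')) powr \<sigma> / \<sigma>)"
      by (rule ennreal_lessThan_indicator_powr[OF \<sigma> fin])
    finally show ?thesis using True \<sigma> by (simp add: ennreal_mult[symmetric])
  qed (auto simp: indicator_def)
  have "(\<integral>\<^sup>+l. (\<integral>\<^sup>+l'. ennreal (enn2real (min (A l) (B l')) powr \<sigma>) * indicator {0<..} l * indicator {0<..} l' \<partial>lborel) \<partial>lborel)
     = ennreal \<sigma> * (\<integral>\<^sup>+l. (\<integral>\<^sup>+l'. (\<integral>\<^sup>+t. ?F t l l' \<partial>lborel) \<partial>lborel) \<partial>lborel)"
    unfolding eq by (simp add: nn_integral_cmult)
  also have "(\<integral>\<^sup>+l. (\<integral>\<^sup>+l'. (\<integral>\<^sup>+t. ?F t l l' \<partial>lborel) \<partial>lborel) \<partial>lborel) =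
      (\<integral>\<^sup>+l. (\<integral>\<^sup>+t. (\<integral>\<^sup>+l'. ?F t l l' \<partial>lborel) \<partial>lborel) \<partial>lborel)"
    by (intro nn_integral_cong lborel_pair.Fubini') measurable
  also have "\<dots> = (\<integral>\<^sup>+t. (\<integral>\<^sup>+l. (\<integral>\<^sup>+l'. ?F t l l' \<partial>lborel) \<partial>lborel) \<partial>lborel)"
    by (rule lborel_pair.Fubini') measurable
  also have "\<dots> = (\<integral>\<^sup>+t. ennreal (t powr (\<sigma> - 1)) * indicator {0<..} t * (profile_dist A t * profile_dist B t) \<partial>lborel)"
  proof (rule nn_integral_cong)
    fix t
    have "(\<integral>\<^sup>+l. (\<integral>\<^sup>+l'. ?F t l l' \<partial>lborel) \<partial>lborel) =
      (\<integral>\<^sup>+l. ennreal (t powr (\<sigma> - 1)) * indicator {0<..} t * (if 0 < l \<and> ennreal t < A l then 1 else 0 :: ennreal) *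
         (\<integral>\<^sup>+l'. (if 0 < l' \<and> ennreal t < B l' then 1 else 0 :: ennreal) \<partial>lborel) \<partial>lborel)"
      by (intro nn_integral_cong, subst nn_integral_cmult) auto
    also have "\<dots> = ennreal (t powr (\<sigma> - 1)) * indicator {0<..} t * (\<integral>\<^sup>+l. (if 0 < l \<and> ennreal t < A l then 1 else 0 :: ennreal) \<partial>lborel) *
         (\<integral>\<^sup>+l'. (if 0 < l' \<and> ennreal t < B l' then 1 else 0 :: ennreal) \<partial>lborel)"
      by (subst nn_integral_multc, measurable, subst nn_integral_cmult, measurable)
    also have "\<dots> = ennreal (t powr (\<sigma> - 1)) * indicator {0<..} t * (profile_dist A t * profile_dist B t)"
      by (simp add: profile_dist_def mult.assoc)
    finally show "(\<integral>\<^sup>+l. (\<integral>\<^sup>+l'. ?F t l l' \<partial>lborel) \<partial>lborel) =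
       ennreal (t powr (\<sigma> - 1)) * indicator {0<..} t * (profile_dist A t * profile_dist B t)" .
  qed
  finally have main: "(\<integral>\<^sup>+l. (\<integral>\<^sup>+l'. ennreal (enn2real (min (A l) (B l')) powr \<sigma>) * indicator {0<..} l * indicator {0<..} l' \<partial>lborel) \<partial>lborel)
    = ennreal \<sigma> * ?I" .
  have "?I \<le> (\<integral>\<^sup>+t. ennreal (t powr (s - 1) * enn2real (profile_dist A t) powr q) * indicator {0<..} t +
      ennreal (t powr (s' - 1) * enn2real (profile_dist B t) powr q') * indicator {0<..} t \<partial>lborel)"
  proof (rule nn_integral_mono)
    fix t :: real
    show "ennreal (t powr (\<sigma> - 1)) * indicator {0<..} t * (profile_dist A t * profile_dist B t) \<le>
      ennreal (t powr (s - 1) * enn2real (profile_dist A t) powr q) * indicator {0<..} t +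
      ennreal (t powr (s' - 1) * enn2real (profile_dist B t) powr q') * indicator {0<..} t"
    proof (cases "0 < t")
      case True
      obtain x where x: "0 \<le> x" "profile_dist A t = ennreal x"
        using profile_dist_finite[OF A _ C(1) True] q by (cases "profile_dist A t") auto
      obtain y where y: "0 \<le> y" "profile_dist B t = ennreal y"
        using profile_dist_finite[OF B _ C(2) True] q' by (cases "profile_dist B t") auto
      have "t powr (\<sigma> - 1) * (x * y) = (t powr (s / q) * x) * (t powr (s' / q') * y) / t"
        using True by (simp add: \<sigma>_def powr_diff powr_add)
      also have "\<dots> \<le> ((t powr (s / q) * x) powr q + (t powr (s' / q') * y) powr q') / t"
        using True x y by (intro divide_right_mono mult_le_powr_add_powr q) auto
      also have "\<dots> = t powr (s - 1) * x powr q + t powr (s' - 1) * y powr q'"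
        using True x y q q' by (simp add: powr_mult powr_powr powr_diff add_divide_distrib)
      finally show ?thesis using True x y
        by (simp add: ennreal_mult[symmetric] ennreal_plus[symmetric] del: ennreal_plus)
    qed simp
  qed
  also have "\<dots> \<le> ennreal (q / s * C) + ennreal (q' / s' * C')"
    by (subst nn_integral_add, measurable, measurable,
        intro add_mono profile_dist_power_integral[OF A _ C(1) s(1)]
          profile_dist_power_integral[OF B _ C(2) s(2)]) (use q q' in simp_all)
  also have "\<dots> = ennreal (q / s * C + q' / s' * C')" using q q' C s by simp
  finally have "?I \<le> ennreal (q / s * C + q' / s' * C')" .
  then have "ennreal \<sigma> * ?I \<le> ennreal \<sigma> * ennreal (q / s * C + q' / s' * C')"
    by (rule mult_left_mono) simp
  also have "\<dots> = ennreal (\<sigma> * (q / s * C + q' / s' * C'))"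
    using \<sigma> by (simp only: ennreal_mult')
  finally show ?thesis unfolding main .
qed

text \<open>Taken for \<open>2 * \<Psi>\<close>, this is the function called A(l) in the
  overview.\<close>

definition level_integral :: "(real \<Rightarrow> real) \<Rightarrow> ('a::euclidean_space \<Rightarrow> real) \<Rightarrow> real \<Rightarrow> ennreal" where
  "level_integral \<Psi> g l = (\<integral>\<^sup>+y. ennreal (\<Psi> (g y / l)) * (if l < g y then 1 else 0) \<partial>lebesgue)"

text \<open>Relative to \<open>g powr p\<close>, of total mass at most 1, the integrand has the
  density \<open>\<phi>\<close>, so Jensen's inequality moves the power \<open>q/p\<close> under the
  integral; \<open>R\<close> is the result. When \<open>l\<close> is integrated first, the
  substitution \<open>t = g/l\<close> produces \<open>g powr q * J\<close>, and the remaining factor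
  \<open>g powr (p - q)\<close> restores \<open>g powr p\<close>.\<close>

lemma level_integral_profile:
  fixes g :: "'a::euclidean_space \<Rightarrow> real"
  assumes g[measurable]: "g \<in> borel_measurable lebesgue" and g0: "\<And>y. 0 \<le> g y"
    and \<Psi>: "mono \<Psi>" "\<And>t. 0 \<le> \<Psi> t"
    and p: "0 < p" "p \<le> q"
    and gp: "(\<integral>\<^sup>+y. ennreal (g y powr p) \<partial>lebesgue) \<le> 1"
    and J: "(\<integral>\<^sup>+t\<in>{1..}. ennreal (\<Psi> t powr (q / p) / t powr q / t) \<partial>lborel) \<le> ennreal J" "0 \<le> J"
  shows "power_profile (level_integral \<Psi> g) (q / p) q (2 powr (q / p) * J)"
proof -
  define s where "s = q / p"
  have s: "1 \<le> s" "p * s = q" using p by (auto simp: s_def)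
  have [measurable]: "\<Psi> \<in> borel_measurable borel" by (rule borel_measurable_mono[OF \<Psi>(1)])
  define R where "R l = ennreal (2 powr s) *
    (\<integral>\<^sup>+y. ennreal (g y powr (p - q) * \<Psi> (g y / l) powr s) * (if l < g y then 1 else 0) \<partial>lebesgue)" for l
  show ?thesis unfolding power_profile_def
  proof (intro conjI bexI[of _ R] allI impI)
    have "(\<lambda>l. \<integral>\<^sup>+y. ennreal (\<Psi> (g y / l)) * (if l < g y then 1 else 0) \<partial>lebesgue) \<in> borel_measurable borel"
      by measurable
    then show "level_integral \<Psi> g \<in> borel_measurable borel"
      by (simp add: level_integral_def[abs_def])
    show "R \<in> borel_measurable borel" unfolding R_def by measurable
  next
    fix l l' :: real
    assume l: "0 < l" "l \<le> l'"
    have "g y / l' \<le> g y / l" for y using l g0 by (intro divide_left_mono) auto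
    then show "level_integral \<Psi> g l' \<le> level_integral \<Psi> g l"
      unfolding level_integral_def using l monoD[OF \<Psi>(1)]
      by (intro nn_integral_mono) (auto simp: indicator_def intro!: ennreal_leI)
  next
    fix l a :: real
    assume l: "0 < l" and a: "0 < a" "ennreal a \<le> level_integral \<Psi> g l"
    define \<phi> where "\<phi> y = \<Psi> (g y / l) * g y powr (- p) * indicator {y. l < g y} y" for y
    have [measurable]: "\<phi> \<in> borel_measurable lebesgue" unfolding \<phi>_def by measurable
    have \<phi>0: "0 \<le> \<phi> y" for y using \<Psi>(2) by (simp add: \<phi>_def)
    have "level_integral \<Psi> g l = (\<integral>\<^sup>+y. ennreal (g y powr p * \<phi> y) \<partial>lebesgue)"
      unfolding level_integral_def
    proof (rule nn_integral_cong)
      fix y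
      have "g y powr p * \<phi> y = \<Psi> (g y / l)" if "l < g y"
        using that l by (simp add: \<phi>_def powr_minus field_simps)
      then show "ennreal (\<Psi> (g y / l)) * (if l < g y then 1 else 0) = ennreal (g y powr p * \<phi> y)"
        by (cases "l < g y") (simp, simp add: \<phi>_def)
    qed
    then have "ennreal (a powr s) \<le> ennreal (2 powr s) * (\<integral>\<^sup>+y. ennreal (g y powr p * \<phi> y powr s) \<partial>lebesgue)"
      using a by (intro weighted_Jensen_powr gp s \<phi>0) auto
    also have "(\<integral>\<^sup>+y. ennreal (g y powr p * \<phi> y powr s) \<partial>lebesgue) = 
      (\<integral>\<^sup>+y. ennreal (g y powr (p - q) * \<Psi> (g y / l) powr s) * (if l < g y then 1 else 0) \<partial>lebesgue)"
    proof (rule nn_integral_cong)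
      fix y
      have "g y powr p * \<phi> y powr s = g y powr (p - q) * \<Psi> (g y / l) powr s" if "l < g y"
      proof -
        have "\<phi> y powr s = \<Psi> (g y / l) powr s * g y powr (- q)"
          using that l \<Psi>(2) s by (simp add: \<phi>_def powr_mult powr_powr)
        then show ?thesis using that l by (simp add: powr_diff powr_minus field_simps)
      qed
      then show "ennreal (g y powr p * \<phi> y powr s) =
        ennreal (g y powr (p - q) * \<Psi> (g y / l) powr s) * (if l < g y then 1 else 0)"
        using s by (auto simp: indicator_def \<phi>_def)
    qed
    finally show "ennreal (a powr (q / p)) \<le> R l" by (simp add: R_def s_def)
  next
    let ?F = "\<lambda>l y. ennreal (l powr (q - 1)) * (ennreal (g y powr (p - q) * \<Psi> (g y / l) powr s) *
       (if l < g y then 1 else 0)) * indicator {0<..} l"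
    have "(\<integral>\<^sup>+l. ennreal (l powr (q - 1)) * R l * indicator {0<..} l \<partial>lborel) =
      (\<integral>\<^sup>+l. ennreal (2 powr s) * (\<integral>\<^sup>+y. ?F l y \<partial>lebesgue) \<partial>lborel)"
      unfolding R_def by (simp add: nn_integral_cmult nn_integral_multc mult_ac)
    also have "\<dots> = ennreal (2 powr s) * (\<integral>\<^sup>+l. (\<integral>\<^sup>+y. ?F l y \<partial>lebesgue) \<partial>lborel)"
      by (rule nn_integral_cmult) measurable
    also have "(\<integral>\<^sup>+l. (\<integral>\<^sup>+y. ?F l y \<partial>lebesgue) \<partial>lborel) = (\<integral>\<^sup>+y. (\<integral>\<^sup>+l. ?F l y \<partial>lborel) \<partial>lebesgue)"
      by (rule lborel_lebesgue.Fubini'[symmetric]) measurable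
    also have "\<dots> \<le> (\<integral>\<^sup>+y. ennreal J * ennreal (g y powr p) \<partial>lebesgue)"
    proof (rule nn_integral_mono)
      fix y :: 'a
      show "(\<integral>\<^sup>+l. ?F l y \<partial>lborel) \<le> ennreal J * ennreal (g y powr p)"
      proof (cases "0 < g y")
        case True
        have "(\<integral>\<^sup>+l. ?F l y \<partial>lborel) = (\<integral>\<^sup>+l. ennreal (g y powr (p - q)) *
          (ennreal (l powr (q - 1) * \<Psi> (g y / l) powr s) * indicator {0<..<g y} l) \<partial>lborel)"
          by (intro nn_integral_cong) (auto simp: indicator_def mult_ac simp flip: ennreal_mult')
        also have "\<dots> = ennreal (g y powr (p - q)) *
          (\<integral>\<^sup>+l. ennreal (l powr (q - 1) * \<Psi> (g y / l) powr s) * indicator {0<..<g y} l \<partial>lborel)"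
          by (rule nn_integral_cmult) measurable
        also have "\<dots> \<le> ennreal (g y powr (p - q)) * (ennreal (g y powr q) * ennreal J)"
        proof (intro mult_left_mono)
          have "(\<integral>\<^sup>+l. ennreal (l powr (q - 1) * \<Psi> (g y / l) powr s) * indicator {0<..<g y} l \<partial>lborel) \<le>
            ennreal (g y powr q) * (\<integral>\<^sup>+t\<in>{1..}. ennreal (\<Psi> t powr s / t powr q / t) \<partial>lborel)"
            by (rule nn_integral_reciprocal_substitution_le) (use True in auto)
          also have "\<dots> \<le> ennreal (g y powr q) * ennreal J"
            using J(1) by (intro mult_left_mono) (auto simp: s_def)
          finally show "(\<integral>\<^sup>+l. ennreal (l powr (q - 1) * \<Psi> (g y / l) powr s) * indicator {0<..<g y} l \<partial>lborel) \<le> \<dots>" .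
        qed auto
        also have "\<dots> = ennreal J * ennreal (g y powr p)"
          using True J(2) by (simp add: ennreal_mult[symmetric] powr_diff)
        finally show ?thesis .
      next
        case False
        then have "g y = 0" using g0[of y] by simp
        then have "(\<integral>\<^sup>+l. ?F l y \<partial>lborel) = (\<integral>\<^sup>+(l::real). 0 \<partial>lborel)"
          by (intro nn_integral_cong) (auto simp: indicator_def)
        then show ?thesis by simp
      qed
    qed
    also have "\<dots> = ennreal J * (\<integral>\<^sup>+y. ennreal (g y powr p) \<partial>lebesgue)"
      by (rule nn_integral_cmult) measurable
    also have "ennreal (2 powr s) * \<dots> \<le> ennreal (2 powr s) * (ennreal J * 1)"
      by (intro mult_left_mono gp) auto
    also have "\<dots> = ennreal (2 powr (q / p) * J)" using J(2) by (simp add: s_def ennreal_mult)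
    finally show "(\<integral>\<^sup>+l. ennreal (l powr (q - 1)) * R l * indicator {0<..} l \<partial>lborel)
      \<le> ennreal (2 powr (q / p) * J)"
      by (simp add: mult_left_mono)
  qed
qed

section \<open>Averages over cubes\<close>

text \<open>Corner and side length are separate parameters because the estimates integrate over
  both.\<close>

definition cube :: "real^'d \<Rightarrow> real \<Rightarrow> (real^'d) set" where
  "cube z \<rho> = {x. \<forall>i. z $ i \<le> x $ i \<and> x $ i \<le> z $ i + \<rho>}"

lemma cube_cbox: "cube z \<rho> = cbox z (z + vec \<rho>)"
  by (auto simp: cube_def mem_box_cart)

lemma cube_measurable [measurable]: "cube z \<rho> \<in> sets borel"
  by (simp add: cube_cbox)

lemma emeasure_lborel_cube:
  assumes "0 \<le> \<rho>"
  shows "emeasure lborel (cube (z :: real^'d) \<rho>) = ennreal (\<rho> ^ CARD('d))"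
proof -
  have "cbox z (z + vec \<rho>) \<noteq> {}" using assms by (simp add: interval_ne_empty_cart)
  then have "measure lborel (cbox z (z + vec \<rho>)) = \<rho> ^ CARD('d)" by (subst content_cbox_cart) auto
  then show ?thesis
    using emeasure_eq_ennreal_measure[of lborel "cbox z (z + vec \<rho>)"] emeasure_lborel_cbox_finite[of z "z + vec \<rho>"]
    by (simp add: cube_cbox less_top[symmetric])
qed

lemma emeasure_lebesgue_cube:
  "0 \<le> \<rho> \<Longrightarrow> emeasure lebesgue (cube (z :: real^'d) \<rho>) = ennreal (\<rho> ^ CARD('d))"
  using emeasure_lborel_cube[of \<rho> z] by simp

lemma integral_cube:
  assumes "0 \<le> \<rho>"
  shows "(\<integral>\<^sup>+x. (if x \<in> cube (z :: real^'d) \<rho> then 1 else 0) \<partial>lborel) = ennreal (\<rho> ^ CARD('d))"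
    "(\<integral>\<^sup>+x. (if x \<in> cube (z :: real^'d) \<rho> then 1 else 0) \<partial>lebesgue) = ennreal (\<rho> ^ CARD('d))"
  using emeasure_lborel_cube[OF assms, of z] emeasure_lebesgue_cube[OF assms, of z]
    nn_integral_indicator[of "cube z \<rho>" lborel] nn_integral_indicator[of "cube z \<rho>" lebesgue]
  by (simp_all add: indicator_def of_bool_def)

text \<open>For fixed \<open>y\<close> and \<open>\<rho>\<close> the corners of the cubes containing
  \<open>y\<close> again form a cube, so an integral over corners is again a volume.\<close>

lemma in_cube_swap: "y \<in> cube z \<rho> \<longleftrightarrow> z \<in> cube (y - vec \<rho>) \<rho>"
  by (auto simp: cube_def algebra_simps)

section \<open>Measurability of cube membership\<close>

lemma lebesgue_to_borel:
  "(\<lambda>x. x) \<in> (lebesgue :: 'a::euclidean_space measure) \<rightarrow>\<^sub>M borel"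
  by (intro measurable_completion) simp

lemma snd_lebesgue_to_borel [measurable]:
  "snd \<in> M \<Otimes>\<^sub>M (lebesgue :: 'a::euclidean_space measure) \<rightarrow>\<^sub>M borel"
  by (rule measurable_compose[OF measurable_snd lebesgue_to_borel])

lemma fst_lebesgue_to_borel [measurable]:
  "fst \<in> (lebesgue :: 'a::euclidean_space measure) \<Otimes>\<^sub>M M \<rightarrow>\<^sub>M borel"
  by (rule measurable_compose[OF measurable_fst lebesgue_to_borel])

lemma pred_cube [measurable]:
  assumes [measurable]: "f \<in> M \<rightarrow>\<^sub>M borel" "g \<in> M \<rightarrow>\<^sub>M borel" "h \<in> borel_measurable M"
  shows "Measurable.pred M (\<lambda>x. f x \<in> cube (g x :: real^'d) (h x))"
  unfolding cube_def mem_Collect_eq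
proof (intro pred_intros_countable pred_intros_logic)
  fix i :: 'd
  have [measurable]: "(\<lambda>x. f x $ i) \<in> borel_measurable M" "(\<lambda>x. g x $ i) \<in> borel_measurable M"
    by (auto intro: measurable_compose[OF assms(1)] measurable_compose[OF assms(2)])
  show "Measurable.pred M (\<lambda>x. g x $ i \<le> f x $ i)" by measurable
  show "Measurable.pred M (\<lambda>x. f x $ i \<le> g x $ i + h x)" by measurable
qed

lemma pred_cube_lebesgue [measurable]:
  assumes "g \<in> lebesgue \<rightarrow>\<^sub>M borel" "h \<in> borel_measurable lebesgue"
  shows "Measurable.pred lebesgue (\<lambda>x. x \<in> cube (g x :: real^'d) (h x))"
  by (rule pred_cube[OF lebesgue_to_borel assms])

text \<open>The Luxemburg modular at scale \<open>l\<close> exceeds 1, with the volume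
  \<open>\<rho> ^ CARD('d)\<close> multiplied out to avoid division of extended reals.\<close>

definition above_one :: "(real \<Rightarrow> real) \<Rightarrow> (real^'d \<Rightarrow> real) \<Rightarrow> real^'d \<Rightarrow> real \<Rightarrow> real \<Rightarrow> bool" where
  "above_one \<Psi> g z \<rho> l \<longleftrightarrow> ennreal (\<rho> ^ CARD('d)) < (\<integral>\<^sup>+y. ennreal (\<Psi> (g y / l)) * (if y \<in> cube z \<rho> then 1 else 0) \<partial>lebesgue)"

text \<open>
  For monotone \<open>\<Psi>\<close> this is the Luxemburg norm \<open>orlicz_norm \<Psi> (cube z \<rho>) g\<close>. Writing it as the
  measure of a set makes it visibly measurable in \<open>z\<close> and \<open>\<rho>\<close>.
\<close>
definition lux :: "(real \<Rightarrow> real) \<Rightarrow> (real^'d \<Rightarrow> real) \<Rightarrow> real^'d \<Rightarrow> real \<Rightarrow> ennreal" where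
  "lux \<Psi> g z \<rho> = (\<integral>\<^sup>+l. (if 0 < l \<and> above_one \<Psi> g z \<rho> l then 1 else 0) \<partial>lborel)"

lemma above_one_measurable [measurable]:
  fixes g :: "real^'d \<Rightarrow> real"
  assumes g[measurable]: "g \<in> borel_measurable lebesgue" and [measurable]: "\<Psi> \<in> borel_measurable borel"
    and [measurable]: "f1 \<in> M \<rightarrow>\<^sub>M borel" "f2 \<in> borel_measurable M" "f3 \<in> borel_measurable M"
  shows "Measurable.pred M (\<lambda>x. above_one \<Psi> g (f1 x) (f2 x) (f3 x))"
proof -
  have "(\<lambda>x. \<integral>\<^sup>+y. ennreal (\<Psi> (g y / f3 x)) * (if y \<in> cube (f1 x) (f2 x) then 1 else 0) \<partial>lebesgue)
      \<in> borel_measurable M"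
    by (rule lebesgue.borel_measurable_nn_integral) measurable
  then have [measurable]: "(\<lambda>x. \<integral>\<^sup>+y. ennreal (\<Psi> (g y / f3 x)) * (if y \<in> cube (f1 x) (f2 x) then 1 else 0) \<partial>lebesgue) \<in> borel_measurable M"
    by (simp add: indicator_def)
  show ?thesis unfolding above_one_def by measurable
qed

text \<open>Where \<open>g \<le> l\<close>, monotonicity bounds \<open>\<Psi>(g/l)\<close> by
  \<open>\<Psi> 1 \<le> 1/2\<close>, so this region accounts for at most half of the volume. The
  region \<open>{g > l}\<close> must supply more than the other half, and doubling
  \<open>\<Psi>\<close> makes up for the loss.\<close>

lemma above_one_truncated:
  fixes g :: "real^'d \<Rightarrow> real"
  assumes [measurable]: "g \<in> borel_measurable lebesgue" and g0: "\<And>y. 0 \<le> g y"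
    and \<Psi>: "mono \<Psi>" "\<And>t. 0 \<le> \<Psi> t" "\<Psi> 1 \<le> 1 / 2" and \<rho>: "0 < \<rho>" and l: "0 < l"
    and above: "above_one \<Psi> g z \<rho> l"
  shows "ennreal (\<rho> ^ CARD('d)) <
    (\<integral>\<^sup>+y. ennreal (2 * \<Psi> (g y / l)) * (if l < g y then 1 else 0) * (if y \<in> cube z \<rho> then 1 else 0) \<partial>lebesgue)"
proof -
  have [measurable]: "\<Psi> \<in> borel_measurable borel" by (rule borel_measurable_mono[OF \<Psi>(1)])
  let ?X = "\<integral>\<^sup>+y. ennreal (\<Psi> (g y / l)) * (if l < g y then 1 else 0) * (if y \<in> cube z \<rho> then 1 else 0) \<partial>lebesgue"
  have "ennreal (\<rho> ^ CARD('d)) < (\<integral>\<^sup>+y. ennreal (\<Psi> (g y / l)) * (if y \<in> cube z \<rho> then 1 else 0) \<partial>lebesgue)"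
    using above by (simp add: above_one_def)
  also have "\<dots> \<le> (\<integral>\<^sup>+y. ennreal (1 / 2) * (if y \<in> cube z \<rho> then 1 else 0) +
      ennreal (\<Psi> (g y / l)) * (if l < g y then 1 else 0) * (if y \<in> cube z \<rho> then 1 else 0) \<partial>lebesgue)"
  proof (rule nn_integral_mono)
    fix y
    have "ennreal (\<Psi> (g y / l)) \<le> ennreal (1 / 2)" if "\<not> l < g y"
    proof -
      have "g y / l \<le> 1" using that l by simp
      from order_trans[OF monoD[OF \<Psi>(1) this] \<Psi>(3)] show ?thesis by (rule ennreal_leI)
    qed
    then show "ennreal (\<Psi> (g y / l)) * (if y \<in> cube z \<rho> then 1 else 0) \<le> ennreal (1 / 2) * (if y \<in> cube z \<rho> then 1 else 0) +
      ennreal (\<Psi> (g y / l)) * (if l < g y then 1 else 0) * (if y \<in> cube z \<rho> then 1 else 0)"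
      by (auto intro: add_increasing2)
  qed
  also have "\<dots> = ennreal (1 / 2) * ennreal (\<rho> ^ CARD('d)) + ?X"
    using \<rho> by (simp add: nn_integral_add nn_integral_cmult integral_cube)
  finally have lt: "ennreal (\<rho> ^ CARD('d)) < ennreal (1 / 2) * ennreal (\<rho> ^ CARD('d)) + ?X" .
  have "(\<integral>\<^sup>+y. ennreal (2 * \<Psi> (g y / l)) * (if l < g y then 1 else 0) * (if y \<in> cube z \<rho> then 1 else 0) \<partial>lebesgue) = 2 * ?X"
    by (subst nn_integral_cmult[symmetric]) (auto simp: ennreal_mult' mult_ac)
  moreover have "ennreal (\<rho> ^ CARD('d)) < 2 * ?X"
  proof (cases "?X = \<infinity>")
    case True
    then show ?thesis by (simp add: ennreal_mult_top)
  next
    case False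
    then obtain x where x: "0 \<le> x" "?X = ennreal x" by (cases ?X) auto
    have eq: "ennreal (1 / 2) * ennreal (\<rho> ^ CARD('d)) + ?X = ennreal (\<rho> ^ CARD('d) / 2 + x)"
      using x \<rho> by (subst ennreal_mult[symmetric]) (auto simp flip: ennreal_plus)
    have "ennreal (\<rho> ^ CARD('d)) < ennreal (\<rho> ^ CARD('d) / 2 + x)" using lt unfolding eq .
    then have "\<rho> ^ CARD('d) < 2 * x" using \<rho> by (subst (asm) ennreal_less_iff) auto
    moreover have "2 * ?X = ennreal (2 * x)" using x by (simp add: ennreal_mult')
    ultimately show ?thesis using \<rho> by (simp add: ennreal_less_iff)
  qed
  ultimately show ?thesis by simp
qed

text \<open>Enlarging the domain from the cube to the whole space removes the dependence on
  \<open>z\<close>: a level can be exceeded only for small \<open>\<rho>\<close>.\<close>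

lemma above_one_level:
  fixes g :: "real^'d \<Rightarrow> real"
  assumes "g \<in> borel_measurable lebesgue" "\<And>y. 0 \<le> g y"
    and "mono \<Psi>" "\<And>t. 0 \<le> \<Psi> t" "\<Psi> 1 \<le> 1 / 2" "0 < \<rho>" "0 < l" "above_one \<Psi> g z \<rho> l"
  shows "ennreal (\<rho> ^ CARD('d)) < level_integral (\<lambda>t. 2 * \<Psi> t) g l"
proof -
  note above_one_truncated[OF assms]
  also have "(\<integral>\<^sup>+y. ennreal (2 * \<Psi> (g y / l)) * (if l < g y then 1 else 0) * (if y \<in> cube z \<rho> then 1 else 0) \<partial>lebesgue)
     \<le> level_integral (\<lambda>t. 2 * \<Psi> t) g l"
    unfolding level_integral_def by (intro nn_integral_mono) (auto simp: indicator_def)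
  finally show ?thesis .
qed

text \<open>Chebyshev's inequality in \<open>z\<close>: wherever the level is exceeded, the
  truncated integral exceeds the volume. After the integrals are exchanged, each \<open>y\<close> is
  counted by corners of total measure \<open>\<rho> ^ CARD('d)\<close>, which cancels.\<close>

lemma above_one_measure:
  fixes g :: "real^'d \<Rightarrow> real"
  assumes g[measurable]: "g \<in> borel_measurable lebesgue" and g0: "\<And>y. 0 \<le> g y"
    and \<Psi>: "mono \<Psi>" "\<And>t. 0 \<le> \<Psi> t" "\<Psi> 1 \<le> 1 / 2" and \<rho>: "0 < \<rho>" and l: "0 < l"
  shows "(\<integral>\<^sup>+z. (if above_one \<Psi> g z \<rho> l then 1 else 0) \<partial>lborel) \<le> level_integral (\<lambda>t. 2 * \<Psi> t) g l"
proof -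
  have [measurable]: "\<Psi> \<in> borel_measurable borel" by (rule borel_measurable_mono[OF \<Psi>(1)])
  let ?n = "ennreal (\<rho> ^ CARD('d))"
  have "?n * (\<integral>\<^sup>+z. (if above_one \<Psi> g z \<rho> l then 1 else 0) \<partial>lborel) =
     (\<integral>\<^sup>+z. ?n * (if above_one \<Psi> g z \<rho> l then 1 else 0) \<partial>lborel)"
    by (rule nn_integral_cmult[symmetric]) measurable
  also have "\<dots> \<le> (\<integral>\<^sup>+z. (\<integral>\<^sup>+y. ennreal (2 * \<Psi> (g y / l)) * (if l < g y then 1 else 0) *
      (if y \<in> cube z \<rho> then 1 else 0) \<partial>lebesgue) \<partial>lborel)"
  proof (rule nn_integral_mono)
    fix z :: "real^'d"
    show "?n * (if above_one \<Psi> g z \<rho> l then 1 else 0) \<le> (\<integral>\<^sup>+y. ennreal (2 * \<Psi> (g y / l)) * (if l < g y then 1 else 0) *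
      (if y \<in> cube z \<rho> then 1 else 0) \<partial>lebesgue)"
      using above_one_truncated[OF g g0 \<Psi> \<rho> l, of z] by (auto simp: indicator_def)
  qed
  also have "\<dots> = (\<integral>\<^sup>+y. (\<integral>\<^sup>+z. ennreal (2 * \<Psi> (g y / l)) * (if l < g y then 1 else 0) *
      (if y \<in> cube z \<rho> then 1 else 0) \<partial>lborel) \<partial>lebesgue)"
    by (rule lborel_lebesgue.Fubini'[symmetric]) measurable
  also have "\<dots> = (\<integral>\<^sup>+y. ?n * (ennreal (2 * \<Psi> (g y / l)) * (if l < g y then 1 else 0)) \<partial>lebesgue)"
  proof (rule nn_integral_cong)
    fix y :: "real^'d"
    have "(\<integral>\<^sup>+z. ennreal (2 * \<Psi> (g y / l)) * (if l < g y then 1 else 0) * (if y \<in> cube z \<rho> then 1 else 0) \<partial>lborel)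
      = (\<integral>\<^sup>+z. ennreal (2 * \<Psi> (g y / l)) * (if l < g y then 1 else 0) * (if z \<in> cube (y - vec \<rho>) \<rho> then 1 else 0) \<partial>lborel)"
      by (rule nn_integral_cong) (simp add: indicator_def in_cube_swap[of y])
    also have "\<dots> = ennreal (2 * \<Psi> (g y / l)) * (if l < g y then 1 else 0) * ?n"
      using \<rho> by (subst nn_integral_cmult) (auto simp: integral_cube)
    finally show "(\<integral>\<^sup>+z. ennreal (2 * \<Psi> (g y / l)) * (if l < g y then 1 else 0) * (if y \<in> cube z \<rho> then 1 else 0) \<partial>lborel)
      = ?n * (ennreal (2 * \<Psi> (g y / l)) * (if l < g y then 1 else 0))" by (simp add: mult.commute)
  qed
  also have "\<dots> = ?n * level_integral (\<lambda>t. 2 * \<Psi> t) g l"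
    unfolding level_integral_def by (rule nn_integral_cmult) measurable
  finally show ?thesis using \<rho> by (subst (asm) ennreal_mult_le_mult_iff) auto
qed

lemma lux_measurable [measurable]:
  fixes g :: "real^'d \<Rightarrow> real"
  assumes [measurable]: "g \<in> borel_measurable lebesgue" "\<Psi> \<in> borel_measurable borel"
    and [measurable]: "f1 \<in> M \<rightarrow>\<^sub>M borel" "f2 \<in> borel_measurable M"
  shows "(\<lambda>x. lux \<Psi> g (f1 x) (f2 x)) \<in> borel_measurable M"
proof -
  have "(\<lambda>x. \<integral>\<^sup>+l. (if 0 < l \<and> above_one \<Psi> g (f1 x) (f2 x) l then 1 else 0) \<partial>lborel) \<in> borel_measurable M"
    by (rule lborel.borel_measurable_nn_integral) measurable
  then show ?thesis by (simp add: lux_def indicator_def)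
qed

text \<open>Both averages are unfolded into levels. For fixed levels, \<open>above_one_level\<close>
  restricts the side, \<open>above_one_measure\<close> restricts the corners, and
  \<open>1 / \<alpha>\<close> comes from integrating \<open>\<rho> powr (\<alpha> - 1)\<close>;
  \<open>power_profile_pairing\<close> then handles the levels.\<close>

lemma lux_pairing:
  fixes g h :: "real^'d \<Rightarrow> real"
  assumes g[measurable]: "g \<in> borel_measurable lebesgue" and g0: "\<And>y. 0 \<le> g y"
    and h[measurable]: "h \<in> borel_measurable lebesgue" and h0: "\<And>y. 0 \<le> h y"
    and \<Psi>: "mono \<Psi>" "\<And>t. 0 \<le> \<Psi> t" "\<Psi> 1 \<le> 1 / 2"
    and \<Phi>: "mono \<Phi>" "\<And>t. 0 \<le> \<Phi> t" "\<Phi> 1 \<le> 1 / 2"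
    and A: "power_profile (level_integral (\<lambda>t. 2 * \<Psi> t) g) s q C"
    and B: "power_profile (level_integral (\<lambda>t. 2 * \<Phi> t) h) s' q' C'"
    and q: "1 < q" "1 / q + 1 / q' = 1" and C: "0 \<le> C" "0 \<le> C'" and s: "0 < s" "0 < s'"
    and \<alpha>: "0 < \<alpha>" "1 + \<alpha> / real CARD('d) = s / q + s' / q'"
  shows "(\<integral>\<^sup>+\<rho>. (\<integral>\<^sup>+z. ennreal (\<rho> powr (\<alpha> - 1)) * indicator {0<..} \<rho> * (lux \<Psi> g z \<rho> * lux \<Phi> h z \<rho>) \<partial>lborel) \<partial>lborel)
    \<le> ennreal ((s / q + s' / q') / \<alpha> * (q / s * C + q' / s' * C'))"
proof -
  have [measurable]: "\<Psi> \<in> borel_measurable borel" "\<Phi> \<in> borel_measurable borel"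
    by (auto intro: borel_measurable_mono \<Psi> \<Phi>)
  let ?n = "real CARD('d)"
  define \<sigma> where "\<sigma> = s / q + s' / q'"
  let ?A = "level_integral (\<lambda>t. 2 * \<Psi> t) g" and ?B = "level_integral (\<lambda>t. 2 * \<Phi> t) h"
  let ?a = "\<lambda>z \<rho> l. (if 0 < l \<and> above_one \<Psi> g z \<rho> l then 1 else 0) :: ennreal"
  let ?b = "\<lambda>z \<rho> l. (if 0 < l \<and> above_one \<Phi> h z \<rho> l then 1 else 0) :: ennreal"
  let ?r = "\<lambda>\<rho>. ennreal (\<rho> powr (\<alpha> - 1)) * indicator {0<..} \<rho>"
  have lux: "lux \<Psi> g z \<rho> = (\<integral>\<^sup>+l. ?a z \<rho> l \<partial>lborel)" "lux \<Phi> h z \<rho> = (\<integral>\<^sup>+l. ?b z \<rho> l \<partial>lborel)" for z \<rho>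
    by (simp_all add: lux_def indicator_def)
  have "(\<integral>\<^sup>+\<rho>. (\<integral>\<^sup>+z. ?r \<rho> * (lux \<Psi> g z \<rho> * lux \<Phi> h z \<rho>) \<partial>lborel) \<partial>lborel) =
     (\<integral>\<^sup>+\<rho>. (\<integral>\<^sup>+z. (\<integral>\<^sup>+l. ?r \<rho> * (?a z \<rho> l * lux \<Phi> h z \<rho>) \<partial>lborel) \<partial>lborel) \<partial>lborel)"
    unfolding lux(1) by (intro nn_integral_cong) (simp add: nn_integral_cmult nn_integral_multc)
  also have "\<dots> = (\<integral>\<^sup>+\<rho>. (\<integral>\<^sup>+l. (\<integral>\<^sup>+z. ?r \<rho> * (?a z \<rho> l * lux \<Phi> h z \<rho>) \<partial>lborel) \<partial>lborel) \<partial>lborel)"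
    by (intro nn_integral_cong lborel_pair.Fubini') measurable
  also have "\<dots> = (\<integral>\<^sup>+l. (\<integral>\<^sup>+\<rho>. (\<integral>\<^sup>+z. ?r \<rho> * (?a z \<rho> l * lux \<Phi> h z \<rho>) \<partial>lborel) \<partial>lborel) \<partial>lborel)"
    by (rule lborel_pair.Fubini') measurable
  also have "\<dots> \<le> (\<integral>\<^sup>+l. (\<integral>\<^sup>+l'. ennreal (1 / \<alpha>) * (ennreal (enn2real (min (?A l) (?B l')) powr \<sigma>) * indicator {0<..} l * indicator {0<..} l') \<partial>lborel) \<partial>lborel)"
  proof (rule nn_integral_mono)
    fix l :: real
    have "(\<integral>\<^sup>+\<rho>. (\<integral>\<^sup>+z. ?r \<rho> * (?a z \<rho> l * lux \<Phi> h z \<rho>) \<partial>lborel) \<partial>lborel) =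
      (\<integral>\<^sup>+\<rho>. (\<integral>\<^sup>+z. (\<integral>\<^sup>+l'. ?r \<rho> * (?a z \<rho> l * ?b z \<rho> l') \<partial>lborel) \<partial>lborel) \<partial>lborel)"
      unfolding lux(2) by (intro nn_integral_cong) (simp add: nn_integral_cmult)
    also have "\<dots> = (\<integral>\<^sup>+\<rho>. (\<integral>\<^sup>+l'. (\<integral>\<^sup>+z. ?r \<rho> * (?a z \<rho> l * ?b z \<rho> l') \<partial>lborel) \<partial>lborel) \<partial>lborel)"
      by (intro nn_integral_cong lborel_pair.Fubini') measurable
    also have "\<dots> = (\<integral>\<^sup>+l'. (\<integral>\<^sup>+\<rho>. (\<integral>\<^sup>+z. ?r \<rho> * (?a z \<rho> l * ?b z \<rho> l') \<partial>lborel) \<partial>lborel) \<partial>lborel)"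
      by (rule lborel_pair.Fubini') measurable
    also have "\<dots> \<le> (\<integral>\<^sup>+l'. ennreal (1 / \<alpha>) * (ennreal (enn2real (min (?A l) (?B l')) powr \<sigma>) * indicator {0<..} l * indicator {0<..} l') \<partial>lborel)"
    proof (rule nn_integral_mono)
      fix l' :: real
      show "(\<integral>\<^sup>+\<rho>. (\<integral>\<^sup>+z. ?r \<rho> * (?a z \<rho> l * ?b z \<rho> l') \<partial>lborel) \<partial>lborel) \<le>
         ennreal (1 / \<alpha>) * (ennreal (enn2real (min (?A l) (?B l')) powr \<sigma>) * indicator {0<..} l * indicator {0<..} l')"
      proof (cases "0 < l \<and> 0 < l'")
        case True
        then have "?A l < \<infinity>" using q s C by (intro power_profile_finite[OF A]) auto
        then have "min (?A l) (?B l') < \<infinity>" by (simp add: min_less_iff_disj)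
        then obtain m where m: "0 \<le> m" "min (?A l) (?B l') = ennreal m" by (cases "min (?A l) (?B l')") auto
        have "(\<integral>\<^sup>+\<rho>. (\<integral>\<^sup>+z. ?r \<rho> * (?a z \<rho> l * ?b z \<rho> l') \<partial>lborel) \<partial>lborel) \<le>
          (\<integral>\<^sup>+\<rho>. ennreal m * (ennreal (\<rho> powr (\<alpha> - 1)) * indicator {0<..<m powr (1 / ?n)} \<rho>) \<partial>lborel)"
        proof (rule nn_integral_mono)
          fix \<rho> :: real
          show "(\<integral>\<^sup>+z. ?r \<rho> * (?a z \<rho> l * ?b z \<rho> l') \<partial>lborel) \<le>
             ennreal m * (ennreal (\<rho> powr (\<alpha> - 1)) * indicator {0<..<m powr (1 / ?n)} \<rho>)"
          proof (cases "0 < \<rho> \<and> \<rho> < m powr (1 / ?n)")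
            case \<rho>: True
            have "(\<integral>\<^sup>+z. ?a z \<rho> l * ?b z \<rho> l' \<partial>lborel) \<le> min (?A l) (?B l')"
            proof (rule min.boundedI)
              have "(\<integral>\<^sup>+z. ?a z \<rho> l * ?b z \<rho> l' \<partial>lborel) \<le> (\<integral>\<^sup>+z. (if above_one \<Psi> g z \<rho> l then 1 else 0) \<partial>lborel)"
                by (rule nn_integral_mono) (auto simp: indicator_def)
              also have "\<dots> \<le> ?A l" using \<rho> True by (intro above_one_measure g g0 \<Psi>) auto
              finally show "(\<integral>\<^sup>+z. ?a z \<rho> l * ?b z \<rho> l' \<partial>lborel) \<le> ?A l" .
              have "(\<integral>\<^sup>+z. ?a z \<rho> l * ?b z \<rho> l' \<partial>lborel) \<le> (\<integral>\<^sup>+z. (if above_one \<Phi> h z \<rho> l' then 1 else 0) \<partial>lborel)"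
                by (rule nn_integral_mono) (auto simp: indicator_def)
              also have "\<dots> \<le> ?B l'" using \<rho> True by (intro above_one_measure h h0 \<Phi>) auto
              finally show "(\<integral>\<^sup>+z. ?a z \<rho> l * ?b z \<rho> l' \<partial>lborel) \<le> ?B l'" .
            qed
            then have "?r \<rho> * (\<integral>\<^sup>+z. ?a z \<rho> l * ?b z \<rho> l' \<partial>lborel) \<le> ?r \<rho> * ennreal m"
              unfolding m(2) by (intro mult_left_mono) auto
            then show ?thesis using \<rho> by (simp add: nn_integral_cmult mult.commute)
          next
            case False
            \<comment> \<open>For positive \<open>\<rho>\<close> outside the range, no corner
              exceeds both levels, since a single one would force
              \<open>\<rho> ^ CARD('d) < m\<close>.\<close>
            have "?r \<rho> * (?a z \<rho> l * ?b z \<rho> l') = 0" for z :: "real^'d"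
            proof (rule ccontr)
              assume "?r \<rho> * (?a z \<rho> l * ?b z \<rho> l') \<noteq> 0"
              then have *: "0 < \<rho>" "above_one \<Psi> g z \<rho> l" "above_one \<Phi> h z \<rho> l'"
                by (auto simp: indicator_def split: if_splits)
              then have "ennreal (\<rho> ^ CARD('d)) < min (?A l) (?B l')"
                using True above_one_level[OF g g0 \<Psi>] above_one_level[OF h h0 \<Phi>] by simp
              then have "\<rho> ^ CARD('d) < m" using * by (simp add: m(2) ennreal_less_iff)
              then have "(\<rho> powr ?n) powr (1 / ?n) < m powr (1 / ?n)"
                using * by (intro powr_less_mono2) (auto simp: powr_realpow)
              then show False using * False by (simp add: powr_powr)
            qed
            then have "(\<integral>\<^sup>+z. ?r \<rho> * (?a z \<rho> l * ?b z \<rho> l') \<partial>lborel) = 0" by (simp only:) simp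
            then show ?thesis by (simp only: zero_le)
          qed
        qed
        also have "\<dots> = ennreal m * ennreal ((m powr (1 / ?n)) powr \<alpha> / \<alpha>)"
          using \<alpha> by (subst nn_integral_cmult) (auto simp: nn_integral_powr_lessThan)
        also have "\<dots> = ennreal (1 / \<alpha>) * ennreal (m powr \<sigma>)"
        proof -
          have "m * (m powr (1 / ?n)) powr \<alpha> = m powr \<sigma>"
            using m(1) \<alpha>(2) by (cases "m = 0") (simp_all add: powr_powr powr_add \<sigma>_def flip: \<alpha>(2))
          then show ?thesis using m(1) \<alpha> by (simp add: ennreal_mult[symmetric])
        qed
        finally show ?thesis using True m by simp
      qed (auto simp: indicator_def)
    qed
    finally show "(\<integral>\<^sup>+\<rho>. (\<integral>\<^sup>+z. ?r \<rho> * (?a z \<rho> l * lux \<Phi> h z \<rho>) \<partial>lborel) \<partial>lborel) \<le> \<dots>" .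
  qed
  also have "\<dots> = ennreal (1 / \<alpha>) * (\<integral>\<^sup>+l. (\<integral>\<^sup>+l'. ennreal (enn2real (min (?A l) (?B l')) powr \<sigma>) * indicator {0<..} l * indicator {0<..} l' \<partial>lborel) \<partial>lborel)"
  proof -
    have [measurable]: "?A \<in> borel_measurable borel" "?B \<in> borel_measurable borel"
      using A B by (auto simp: power_profile_def)
    show ?thesis by (simp add: nn_integral_cmult)
  qed
  also have "\<dots> \<le> ennreal (1 / \<alpha>) * ennreal (\<sigma> * (q / s * C + q' / s' * C'))"
    unfolding \<sigma>_def by (intro mult_left_mono power_profile_pairing[OF A B q C s]) auto
  also have "\<dots> = ennreal (\<sigma> / \<alpha> * (q / s * C + q' / s' * C'))"
    using \<alpha>(1) by (subst ennreal_mult'[symmetric]) auto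
  finally show ?thesis by (simp add: \<sigma>_def)
qed

section \<open>Orlicz averages of extended-valued functions\<close>

lemma young_function_mono: "young_function \<Phi> \<Longrightarrow> 0 \<le> s \<Longrightarrow> s \<le> t \<Longrightarrow> \<Phi> s \<le> \<Phi> t"
  unfolding young_function_def using strict_mono_on_leD[of "{0..}" \<Phi> s t] by simp

lemma young_function_nonneg: "young_function \<Phi> \<Longrightarrow> 0 \<le> s \<Longrightarrow> 0 \<le> \<Phi> s"
  using young_function_mono[of \<Phi> 0 s] by (simp add: young_function_def)

lemma young_ext_mono:
  assumes "young_function \<Phi>" "s \<le> t"
  shows "young_ext \<Phi> s \<le> young_ext \<Phi> t"
proof (cases "t = \<infinity>")
  case False
  then have "s \<noteq> \<infinity>" "enn2real s \<le> enn2real t"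
    using assms(2) by (auto simp: top_unique enn2real_mono less_top)
  then show ?thesis using False young_function_mono[OF assms(1), of "enn2real s" "enn2real t"]
    by (simp add: young_ext_def ennreal_leI)
qed (simp add: young_ext_def)

lemma young_ext_measurable [measurable]:
  assumes \<Phi>: "young_function \<Phi>" and [measurable]: "f \<in> borel_measurable M"
  shows "(\<lambda>x. young_ext \<Phi> (f x)) \<in> borel_measurable M"
proof -
  have "continuous_on {0..} \<Phi>" using \<Phi> by (simp add: young_function_def)
  \<comment> \<open>A Young function is constrained on \<open>{0..}\<close> only; composing with
    \<open>max 0\<close> gives continuity on the whole line and changes nothing at the values of
    \<open>enn2real\<close>.\<close>
  moreover have "continuous_on UNIV (max (0::real))"
    using continuous_on_max[OF continuous_on_const continuous_on_id, of UNIV "0::real"] by simp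
  moreover have "range (max (0::real)) \<subseteq> {0..}" by auto
  ultimately have "continuous_on UNIV (\<lambda>x. \<Phi> (max 0 x))" by (rule continuous_on_compose2)
  then have "(\<lambda>x. \<Phi> (max 0 x)) \<in> borel_measurable borel" by (rule borel_measurable_continuous_onI)
  from measurable_compose[OF _ this, of "\<lambda>x. enn2real (f x)" M]
  have [measurable]: "(\<lambda>x. \<Phi> (enn2real (f x))) \<in> borel_measurable M" by (simp add: max_def)
  show ?thesis unfolding young_ext_def by measurable
qed

lemma ennreal_divide_le_iff:
  assumes "0 < a"
  shows "x / ennreal a \<le> y \<longleftrightarrow> x \<le> y * ennreal a"
proof -
  have *: "v * ennreal a / ennreal a = v" for v
    using assms by (intro mult_divide_eq_ennreal) auto
  have "x / ennreal a * ennreal a = x"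
    by (metis * ennreal_divide_times)
  then show ?thesis
    using mult_right_mono[of "x / ennreal a" y "ennreal a"]
      divide_right_mono_ennreal[of x "y * ennreal a" "ennreal a"] by (auto simp: *)
qed

definition modular :: "(real \<Rightarrow> real) \<Rightarrow> (real^'d) set \<Rightarrow> (real^'d \<Rightarrow> ennreal) \<Rightarrow> real \<Rightarrow> ennreal" where
  "modular \<Phi> Q f l = (\<integral>\<^sup>+y. young_ext \<Phi> (f y / ennreal l) * (if y \<in> Q then 1 else 0) \<partial>lebesgue)"

lemma modular_antimono:
  assumes "young_function \<Phi>" "0 < l" "l \<le> l'"
  shows "modular \<Phi> Q f l' \<le> modular \<Phi> Q f l"
proof -
  have "f y / ennreal l' \<le> f y / ennreal l" for y
    using assms(2,3) by (auto simp: divide_ennreal_def inverse_ennreal intro!: mult_left_mono ennreal_leI)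
  then show ?thesis unfolding modular_def
    by (intro nn_integral_mono mult_right_mono young_ext_mono assms) auto
qed

lemma orlicz_norm_cube:
  fixes z :: "real^'d"
  assumes "0 < \<rho>"
  shows "orlicz_norm \<Phi> (cube z \<rho>) f = Inf {ennreal l |l. 0 < l \<and> modular \<Phi> (cube z \<rho>) f l \<le> ennreal (\<rho> ^ CARD('d))}"
proof -
  have "x / ennreal (\<rho> ^ CARD('d)) \<le> 1 \<longleftrightarrow> x \<le> ennreal (\<rho> ^ CARD('d))" for x
    using assms by (subst ennreal_divide_le_iff) auto
  then show ?thesis using assms unfolding orlicz_norm_def
    by (simp add: emeasure_lborel_cube modular_def indicator_def of_bool_def)
qed

lemma orlicz_norm_less_imp_modular:
  fixes z :: "real^'d"
  assumes "young_function \<Phi>" "0 < \<rho>" "orlicz_norm \<Phi> (cube z \<rho>) f < ennreal L"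
  shows "0 < L \<and> modular \<Phi> (cube z \<rho>) f L \<le> ennreal (\<rho> ^ CARD('d))"
proof -
  obtain l where l: "0 < l" "modular \<Phi> (cube z \<rho>) f l \<le> ennreal (\<rho> ^ CARD('d))" "ennreal l < ennreal L"
    using assms by (auto simp: orlicz_norm_cube Inf_less_iff)
  then have "l < L" by (simp add: ennreal_less_iff)
  then show ?thesis using l modular_antimono[OF assms(1) l(1), of L] by (meson less_imp_le less_trans order_trans)
qed

text \<open>Modulars decrease in the scale, so rational scales suffice. A countable infimum keeps
  the inner average measurable in the outer variable, as the iterated averages require.\<close>

lemma orlicz_norm_rational:
  fixes z :: "real^'d"
  assumes "young_function \<Phi>" "0 < \<rho>"
  shows "orlicz_norm \<Phi> (cube z \<rho>) f =
    (INF r\<in>\<rat> \<inter> {0<..}. if modular \<Phi> (cube z \<rho>) f r \<le> ennreal (\<rho> ^ CARD('d)) then ennreal r else \<infinity>)"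
    (is "_ = ?I")
proof (rule antisym)
  show "orlicz_norm \<Phi> (cube z \<rho>) f \<le> ?I"
    unfolding orlicz_norm_cube[OF assms(2)] by (rule INF_greatest) (auto intro: Inf_lower)
  show "?I \<le> orlicz_norm \<Phi> (cube z \<rho>) f"
  proof (rule dense_ge)
    fix y assume y: "orlicz_norm \<Phi> (cube z \<rho>) f < y"
    then obtain l where l: "0 < l" "modular \<Phi> (cube z \<rho>) f l \<le> ennreal (\<rho> ^ CARD('d))" "ennreal l < y"
      using assms by (auto simp: orlicz_norm_cube Inf_less_iff)
    obtain r where r: "r \<in> \<rat>" "l < r" "ennreal r < y"
    proof (cases y)
      case (real y')
      then have "l < y'" using l by (simp add: ennreal_less_iff)
      then show ?thesis using Rats_dense_in_real[of l y'] that real l by (auto simp: ennreal_less_iff)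
    next
      case top
      then show ?thesis using Rats_dense_in_real[of l "l + 1"] that by auto
    qed
    have "?I \<le> (if modular \<Phi> (cube z \<rho>) f r \<le> ennreal (\<rho> ^ CARD('d)) then ennreal r else \<infinity>)"
      using r l by (intro INF_lower) auto
    also have "\<dots> = ennreal r"
      using modular_antimono[OF assms(1) l(1), of r] l(2) r(2) by (meson less_imp_le order_trans)
    finally show "?I \<le> y" using r by simp
  qed
qed

lemma orlicz_norm_measurable:
  fixes z :: "real^'d"
  assumes \<Phi>: "young_function \<Phi>" and \<rho>: "0 < \<rho>"
    and k: "(\<lambda>w. k (fst w) (snd w)) \<in> borel_measurable (M \<Otimes>\<^sub>M lebesgue)"
  shows "(\<lambda>x. orlicz_norm \<Phi> (cube z \<rho>) (k x)) \<in> borel_measurable M"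
proof -
  note [measurable] = young_ext_measurable[OF \<Phi>] k
  have [measurable]: "(\<lambda>x. modular \<Phi> (cube z \<rho>) (k x) r) \<in> borel_measurable M" for r
    unfolding modular_def by (rule lebesgue.borel_measurable_nn_integral) (simp add: case_prod_beta', measurable)
  show ?thesis unfolding orlicz_norm_rational[OF \<Phi> \<rho>]
    by (intro borel_measurable_INF countable_Int1 countable_rat) measurable
qed

text \<open>Normalising by \<open>L\<close> and \<open>m\<close> and applying the Young-type
  inequality pointwise leaves two modulars, each at most the volume; hence the factor 2. A scale
  \<open>L\<close> strictly above the norm is admissible even if the infimum is not
  attained.\<close>

lemma orlicz_Hoelder:
  fixes z :: "real^'d" and w :: "real^'d \<Rightarrow> real"
  assumes \<Phi>: "young_function \<Phi>" and \<rho>: "0 < \<rho>"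
    and f[measurable]: "f \<in> borel_measurable lebesgue"
    and w[measurable]: "w \<in> borel_measurable lebesgue" and w0: "\<And>y. 0 \<le> w y"
    and \<Psi>: "mono \<Psi>" "\<And>t. 0 \<le> \<Psi> t"
    and c: "0 < c" "\<And>s t. 0 \<le> s \<Longrightarrow> 0 \<le> t \<Longrightarrow> s * t \<le> c * (\<Phi> s + \<Psi> t)"
    and L: "orlicz_norm \<Phi> (cube z \<rho>) f < ennreal L" and m: "0 < m" "\<not> above_one \<Psi> w z \<rho> m"
  shows "(\<integral>\<^sup>+y. f y * ennreal (w y) * (if y \<in> cube z \<rho> then 1 else 0) \<partial>lebesgue) \<le> ennreal (2 * c * \<rho> ^ CARD('d) * m * L)"
proof -
  note [measurable] = young_ext_measurable[OF \<Phi>]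
  have [measurable]: "\<Psi> \<in> borel_measurable borel" by (rule borel_measurable_mono[OF \<Psi>(1)])
  have LL: "0 < L" "modular \<Phi> (cube z \<rho>) f L \<le> ennreal (\<rho> ^ CARD('d))"
    using orlicz_norm_less_imp_modular[OF \<Phi> \<rho> L] by auto
  have pt: "f y * ennreal (w y) \<le> ennreal (c * m * L) * (young_ext \<Phi> (f y / ennreal L) + ennreal (\<Psi> (w y / m)))" for y
  proof (cases "f y")
    case (real a)
    have "a * w y = L * m * (a / L * (w y / m))" using LL m by simp
    also have "\<dots> \<le> L * m * (c * (\<Phi> (a / L) + \<Psi> (w y / m)))"
      using LL m real w0[of y] by (intro mult_left_mono c) auto
    finally have "a * w y \<le> c * m * L * (\<Phi> (a / L) + \<Psi> (w y / m))" by (simp add: mult_ac)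
    moreover have "0 \<le> \<Phi> (a / L)" using young_function_nonneg[OF \<Phi>] real LL by simp
    ultimately show ?thesis using real LL m c \<Psi>(2) w0[of y]
      by (simp add: young_ext_def divide_ennreal ennreal_mult[symmetric] ennreal_plus[symmetric] ennreal_leI
          del: ennreal_plus)
  next
    \<comment> \<open>Where \<open>f\<close> is infinite the right side is infinite as well, because
      \<open>c * m * L\<close> is positive.\<close>
    case top
    then show ?thesis using LL m c by (simp add: young_ext_def ennreal_top_divide ennreal_mult_top)
  qed
  have "(\<integral>\<^sup>+y. f y * ennreal (w y) * (if y \<in> cube z \<rho> then 1 else 0) \<partial>lebesgue) \<le>
    (\<integral>\<^sup>+y. ennreal (c * m * L) * (young_ext \<Phi> (f y / ennreal L) * (if y \<in> cube z \<rho> then 1 else 0) +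
        ennreal (\<Psi> (w y / m)) * (if y \<in> cube z \<rho> then 1 else 0)) \<partial>lebesgue)"
    using pt by (intro nn_integral_mono) auto
  also have "\<dots> = ennreal (c * m * L) * (modular \<Phi> (cube z \<rho>) f L +
     (\<integral>\<^sup>+y. ennreal (\<Psi> (w y / m)) * (if y \<in> cube z \<rho> then 1 else 0) \<partial>lebesgue))"
    unfolding modular_def by (subst nn_integral_cmult, measurable, subst nn_integral_add, measurable)
  also have "\<dots> \<le> ennreal (c * m * L) * (ennreal (\<rho> ^ CARD('d)) + ennreal (\<rho> ^ CARD('d)))"
    using LL m(2) by (intro mult_left_mono add_mono) (auto simp: above_one_def not_less)
  also have "\<dots> = ennreal (2 * c * \<rho> ^ CARD('d) * m * L)"
    using LL m c \<rho> by (simp add: ennreal_mult[symmetric] ennreal_plus[symmetric] algebra_simps del: ennreal_plus)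
  finally show ?thesis .
qed

text \<open>\<open>L\<close> is let down to the norm. The norm itself has to appear, since it is the
  function of \<open>x\<close> to which Hoelder's inequality is applied a second time.\<close>

lemma orlicz_Hoelder_norm:
  fixes z :: "real^'d" and w :: "real^'d \<Rightarrow> real"
  assumes \<Phi>: "young_function \<Phi>" and \<rho>: "0 < \<rho>"
    and f: "f \<in> borel_measurable lebesgue"
    and w: "w \<in> borel_measurable lebesgue" and w0: "\<And>y. 0 \<le> w y"
    and \<Psi>: "mono \<Psi>" "\<And>t. 0 \<le> \<Psi> t"
    and c: "0 < c" "\<And>s t. 0 \<le> s \<Longrightarrow> 0 \<le> t \<Longrightarrow> s * t \<le> c * (\<Phi> s + \<Psi> t)"
    and m: "0 < m" "\<not> above_one \<Psi> w z \<rho> m"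
  shows "(\<integral>\<^sup>+y. f y * ennreal (w y) * (if y \<in> cube z \<rho> then 1 else 0) \<partial>lebesgue) \<le>
    ennreal (2 * c * \<rho> ^ CARD('d) * m) * orlicz_norm \<Phi> (cube z \<rho>) f" (is "?X \<le> ennreal ?c * ?N")
proof -
  have c0: "0 < ?c" using c m \<rho> by simp
  have "?X / ennreal ?c \<le> ?N"
  proof (rule dense_ge)
    fix y assume y: "?N < y"
    show "?X / ennreal ?c \<le> y"
    proof (cases y)
      case (real L)
      have "?X \<le> ennreal (?c * L)"
        using orlicz_Hoelder[OF \<Phi> \<rho> f w w0 \<Psi> c _ m, of L] y real by simp
      also have "\<dots> = ennreal ?c * y" using real c0 by (simp add: ennreal_mult)
      finally show ?thesis using c0 by (simp add: ennreal_divide_le_iff mult.commute)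
    qed simp
  qed
  then show ?thesis using c0 by (simp add: ennreal_divide_le_iff mult.commute)
qed

section \<open>The bilinear estimate\<close>

lemma above_one_antimono:
  assumes \<Psi>: "mono \<Psi>" and g0: "\<And>y. 0 \<le> g y" and l: "0 < l" "l \<le> m" and m: "above_one \<Psi> g z \<rho> m"
  shows "above_one \<Psi> g z \<rho> l"
proof -
  have "g y / m \<le> g y / l" for y using l g0 by (intro divide_left_mono) auto
  then have "(\<integral>\<^sup>+y. ennreal (\<Psi> (g y / m)) * (if y \<in> cube z \<rho> then 1 else 0) \<partial>lebesgue) \<le>
    (\<integral>\<^sup>+y. ennreal (\<Psi> (g y / l)) * (if y \<in> cube z \<rho> then 1 else 0) \<partial>lebesgue)"
    using monoD[OF \<Psi>] by (intro nn_integral_mono mult_right_mono ennreal_leI) auto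
  then show ?thesis using m unfolding above_one_def by (rule less_le_trans[rotated])
qed

text \<open>If the level \<open>m\<close> were exceeded, so would be all smaller positive ones, and
  \<open>lux\<close> would be at least \<open>m\<close>.\<close>

lemma lux_less_imp_not_above_one:
  assumes "mono \<Psi>" "\<And>y. 0 \<le> g y" "0 \<le> m" "lux \<Psi> g z \<rho> < ennreal m"
  shows "\<not> above_one \<Psi> g z \<rho> m"
proof
  assume m: "above_one \<Psi> g z \<rho> m"
  have "ennreal m = (\<integral>\<^sup>+l. indicator {0<..<m} l \<partial>lborel)" using assms(3) by simp
  also have "\<dots> \<le> lux \<Psi> g z \<rho>"
    unfolding lux_def using above_one_antimono[OF assms(1,2) _ _ m]
    by (intro nn_integral_mono) (auto simp: indicator_def)
  finally show False using assms(4) by simp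
qed

text \<open>At every level exceeded on this cube, \<open>level_integral\<close> exceeds the volume,
  so \<open>profile_dist\<close> at the volume is a bound.\<close>

lemma lux_finite:
  fixes g :: "real^'d \<Rightarrow> real"
  assumes g: "g \<in> borel_measurable lebesgue" "\<And>y. 0 \<le> g y"
    and \<Psi>: "mono \<Psi>" "\<And>t. 0 \<le> \<Psi> t" "\<Psi> 1 \<le> 1 / 2"
    and A: "power_profile (level_integral (\<lambda>t. 2 * \<Psi> t) g) s q C" and q: "0 < q" "0 \<le> C" and \<rho>: "0 < \<rho>"
  shows "lux \<Psi> g z \<rho> < \<infinity>"
proof -
  have "lux \<Psi> g z \<rho> \<le> profile_dist (level_integral (\<lambda>t. 2 * \<Psi> t) g) (\<rho> ^ CARD('d))"
    unfolding lux_def profile_dist_def using above_one_level[OF g \<Psi> \<rho>] by (intro nn_integral_mono) auto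
  also have "\<dots> < \<infinity>" using profile_dist_finite[OF A q] \<rho> by simp
  finally show ?thesis .
qed

text \<open>Hoelder's inequality in \<open>y\<close> leaves the inner average as a function of
  \<open>x\<close>, and a second application in \<open>x\<close> meets the outer average. Each
  contributes a factor 2 and a volume.\<close>

lemma cube_bilinear:
  fixes g h :: "real^'d \<Rightarrow> real"
  assumes k: "(\<lambda>w. k (fst w) (snd w)) \<in> borel_measurable (lebesgue \<Otimes>\<^sub>M lebesgue)"
    and g[measurable]: "g \<in> borel_measurable lebesgue" and g0: "\<And>y. 0 \<le> g y"
    and h[measurable]: "h \<in> borel_measurable lebesgue" and h0: "\<And>y. 0 \<le> h y"
    and \<Phi>: "young_function \<Phi>" "young_function \<Phi>'"
    and \<Psi>: "mono \<Psi>" "\<And>t. 0 \<le> \<Psi> t" and \<Psi>': "mono \<Psi>'" "\<And>t. 0 \<le> \<Psi>' t"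
    and c: "0 < c" "\<And>s t. 0 \<le> s \<Longrightarrow> 0 \<le> t \<Longrightarrow> s * t \<le> c * (\<Phi> s + \<Psi> t)"
    and c': "0 < c'" "\<And>s t. 0 \<le> s \<Longrightarrow> 0 \<le> t \<Longrightarrow> s * t \<le> c' * (\<Phi>' s + \<Psi>' t)"
    and \<rho>: "0 < \<rho>"
    and \<kappa>: "orlicz_norm \<Phi>' (cube z \<rho>) (\<lambda>x. orlicz_norm \<Phi> (cube z \<rho>) (k x)) < ennreal \<kappa>"
    and m: "0 < m" "\<not> above_one \<Psi> g z \<rho> m" and m': "0 < m'" "\<not> above_one \<Psi>' h z \<rho> m'"
  shows "(\<integral>\<^sup>+x. (\<integral>\<^sup>+y. k x y * ennreal (g y) * (if y \<in> cube z \<rho> then 1 else 0) \<partial>lebesgue) *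
      ennreal (h x) * (if x \<in> cube z \<rho> then 1 else 0) \<partial>lebesgue)
    \<le> ennreal (4 * c * c' * (\<rho> ^ CARD('d))\<^sup>2 * \<kappa> * (m * m'))"
proof -
  let ?N = "\<lambda>x. orlicz_norm \<Phi> (cube z \<rho>) (k x)"
  have [measurable]: "?N \<in> borel_measurable lebesgue" by (rule orlicz_norm_measurable[OF \<Phi>(1) \<rho> k])
  have kx: "k x \<in> borel_measurable lebesgue" for x
    using measurable_compose[OF measurable_Pair1'[of x lebesgue lebesgue] k] by simp
  have \<kappa>0: "0 \<le> \<kappa>" using \<kappa> by (metis ennreal_neg linear not_less_zero)
  let ?c = "2 * c * \<rho> ^ CARD('d) * m"
  have "(\<integral>\<^sup>+x. (\<integral>\<^sup>+y. k x y * ennreal (g y) * (if y \<in> cube z \<rho> then 1 else 0) \<partial>lebesgue) *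
      ennreal (h x) * (if x \<in> cube z \<rho> then 1 else 0) \<partial>lebesgue) \<le>
    (\<integral>\<^sup>+x. ennreal ?c * (?N x * ennreal (h x) * (if x \<in> cube z \<rho> then 1 else 0)) \<partial>lebesgue)"
  proof (rule nn_integral_mono)
    fix x
    have "(\<integral>\<^sup>+y. k x y * ennreal (g y) * (if y \<in> cube z \<rho> then 1 else 0) \<partial>lebesgue) \<le> ennreal ?c * ?N x"
      by (rule orlicz_Hoelder_norm[OF \<Phi>(1) \<rho> kx g g0 \<Psi> c m])
    then show "(\<integral>\<^sup>+y. k x y * ennreal (g y) * (if y \<in> cube z \<rho> then 1 else 0) \<partial>lebesgue) *
      ennreal (h x) * (if x \<in> cube z \<rho> then 1 else 0) \<le>
      ennreal ?c * (?N x * ennreal (h x) * (if x \<in> cube z \<rho> then 1 else 0))"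
      unfolding mult.assoc[symmetric] by (intro mult_right_mono) auto
  qed
  also have "\<dots> = ennreal ?c * (\<integral>\<^sup>+x. ?N x * ennreal (h x) * (if x \<in> cube z \<rho> then 1 else 0) \<partial>lebesgue)"
    by (rule nn_integral_cmult) measurable
  also have "\<dots> \<le> ennreal ?c * ennreal (2 * c' * \<rho> ^ CARD('d) * m' * \<kappa>)"
    by (intro mult_left_mono orlicz_Hoelder[OF \<Phi>(2) \<rho> _ h h0 \<Psi>' c' \<kappa> m']) measurable
  also have "\<dots> = ennreal (4 * c * c' * (\<rho> ^ CARD('d))\<^sup>2 * \<kappa> * (m * m'))"
    using c m \<rho> c' m' \<kappa>0 by (subst ennreal_mult[symmetric]) (auto simp: power2_eq_square mult_ac)
  finally show ?thesis .
qed

lemma cube_bilinear_lux: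
  fixes g h :: "real^'d \<Rightarrow> real"
  assumes k: "(\<lambda>w. k (fst w) (snd w)) \<in> borel_measurable (lebesgue \<Otimes>\<^sub>M lebesgue)"
    and g: "g \<in> borel_measurable lebesgue" and g0: "\<And>y. 0 \<le> g y"
    and h: "h \<in> borel_measurable lebesgue" and h0: "\<And>y. 0 \<le> h y"
    and \<Phi>: "young_function \<Phi>" "young_function \<Phi>'"
    and \<Psi>: "mono \<Psi>" "\<And>t. 0 \<le> \<Psi> t" and \<Psi>': "mono \<Psi>'" "\<And>t. 0 \<le> \<Psi>' t"
    and c: "0 < c" "\<And>s t. 0 \<le> s \<Longrightarrow> 0 \<le> t \<Longrightarrow> s * t \<le> c * (\<Phi> s + \<Psi> t)"
    and c': "0 < c'" "\<And>s t. 0 \<le> s \<Longrightarrow> 0 \<le> t \<Longrightarrow> s * t \<le> c' * (\<Phi>' s + \<Psi>' t)"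
    and \<rho>: "0 < \<rho>"
    and \<kappa>: "0 \<le> \<kappa>" "orlicz_norm \<Phi>' (cube z \<rho>) (\<lambda>x. orlicz_norm \<Phi> (cube z \<rho>) (k x)) \<le> ennreal \<kappa>"
    and fin: "lux \<Psi> g z \<rho> < \<infinity>" "lux \<Psi>' h z \<rho> < \<infinity>"
  shows "(\<integral>\<^sup>+x. (\<integral>\<^sup>+y. k x y * ennreal (g y) * (if y \<in> cube z \<rho> then 1 else 0) \<partial>lebesgue) *
      ennreal (h x) * (if x \<in> cube z \<rho> then 1 else 0) \<partial>lebesgue)
    \<le> ennreal (4 * c * c' * (\<rho> ^ CARD('d))\<^sup>2 * \<kappa>) * (lux \<Psi> g z \<rho> * lux \<Psi>' h z \<rho>)" (is "?X \<le> _")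
proof -
  obtain G where G: "0 \<le> G" "lux \<Psi> g z \<rho> = ennreal G" using fin(1) by (cases "lux \<Psi> g z \<rho>") auto
  obtain H where H: "0 \<le> H" "lux \<Psi>' h z \<rho> = ennreal H" using fin(2) by (cases "lux \<Psi>' h z \<rho>") auto
  \<comment> \<open>\<open>cube_bilinear\<close> wants a bound strictly above the iterated norm and
    levels that are not exceeded; adding \<open>e\<close> to \<open>\<kappa>\<close> and to both
    averages provides them, and then \<open>e\<close> tends to 0.\<close>
  let ?f = "\<lambda>e. 4 * c * c' * (\<rho> ^ CARD('d))\<^sup>2 * (\<kappa> + e) * ((G + e) * (H + e))"
  have "?X \<le> ennreal (?f e)" if e: "0 < e" for e
  proof (rule cube_bilinear[OF k g g0 h h0 \<Phi> \<Psi> \<Psi>' c c' \<rho>])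
    show "orlicz_norm \<Phi>' (cube z \<rho>) (\<lambda>x. orlicz_norm \<Phi> (cube z \<rho>) (k x)) < ennreal (\<kappa> + e)"
      using \<kappa> e by (intro le_less_trans[OF \<kappa>(2)]) (auto simp: ennreal_less_iff)
    show "\<not> above_one \<Psi> g z \<rho> (G + e)"
      by (rule lux_less_imp_not_above_one[OF \<Psi>(1) g0]) (use G e in \<open>auto simp: ennreal_less_iff\<close>)
    show "\<not> above_one \<Psi>' h z \<rho> (H + e)"
      by (rule lux_less_imp_not_above_one[OF \<Psi>'(1) h0]) (use H e in \<open>auto simp: ennreal_less_iff\<close>)
  qed (use G H e in auto)
  then have ev: "\<forall>\<^sub>F e in at_right 0. ?X \<le> ennreal (?f e)"
    by (intro eventually_at_rightI[of 0 1]) auto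
  have "(?f \<longlongrightarrow> ?f 0) (at_right 0)" by (intro tendsto_intros)
  then have "((\<lambda>e. ennreal (?f e)) \<longlongrightarrow> ennreal (?f 0)) (at_right 0)" by (rule tendsto_ennrealI)
  then have "?X \<le> ennreal (?f 0)"
    by (rule tendsto_lowerbound[OF _ ev]) simp
  also have "\<dots> = ennreal (4 * c * c' * (\<rho> ^ CARD('d))\<^sup>2 * \<kappa>) * (lux \<Psi> g z \<rho> * lux \<Psi>' h z \<rho>)"
    using G H c(1) c'(1) \<kappa> by (simp add: ennreal_mult[symmetric])
  finally show ?thesis .
qed

text \<open>If \<open>\<rho>\<close> is at least twice the distance of the points, the corners of
  the cubes of side \<open>\<rho>\<close> containing both include a cube of side
  \<open>\<rho>/2\<close>, which costs \<open>2 ^ CARD('d)\<close>; the integral over these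
  \<open>\<rho>\<close> gives the remaining constant. The factor
  \<open>\<rho> powr (- 2 * n)\<close> in the weight will cancel against the two volumes from
  \<open>cube_bilinear\<close>.\<close>

lemma riesz_kernel_le_cubes:
  fixes x y :: "real^'d"
  assumes \<alpha>: "\<alpha> < real CARD('d)"
  defines "n \<equiv> real CARD('d)"
  shows "ennreal (1 / norm (x - y) powr (n - \<alpha>)) \<le> ennreal (2 ^ CARD('d) * (n - \<alpha>) * 2 powr (n - \<alpha>)) *
    (\<integral>\<^sup>+\<rho>. (\<integral>\<^sup>+z. ennreal (\<rho> powr (\<alpha> - 2 * n - 1)) * indicator {0<..} \<rho> *
      ((if x \<in> cube z \<rho> then 1 else 0) * (if y \<in> cube z \<rho> then 1 else 0)) \<partial>lborel) \<partial>lborel)"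
proof (cases "x = y")
  case False
  define a where "a = norm (x - y)"
  have a: "0 < a" using False by (simp add: a_def)
  have n\<alpha>: "0 < n - \<alpha>" using \<alpha> by (simp add: n_def)
  have card: "ennreal (\<rho> ^ CARD('d)) \<le> 2 ^ CARD('d) *
      (\<integral>\<^sup>+z. ((if x \<in> cube z \<rho> then 1 else 0) * (if y \<in> cube z \<rho> then 1 else 0)) \<partial>lborel)"
    if \<rho>: "2 * a \<le> \<rho>" for \<rho>
  proof -
    \<comment> \<open>The lowest corner from which a cube of side \<open>\<rho>\<close> reaches both
      points. Raising its coordinates by up to \<open>\<rho>/2\<close> keeps both inside, because
      the coordinates of \<open>x\<close> and \<open>y\<close> differ by at most
      \<open>\<rho>/2\<close>.\<close>
    define w where "w = (\<chi> i. max (x $ i) (y $ i) - \<rho>)"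
    have sub: "x \<in> cube z \<rho> \<and> y \<in> cube z \<rho>" if "z \<in> cube w (\<rho> / 2)" for z
    proof -
      have "\<bar>x $ i - y $ i\<bar> \<le> \<rho> / 2" for i
        using component_le_norm_cart[of "x - y" i] \<rho> by (simp add: a_def)
      then show ?thesis using that unfolding cube_def w_def by (simp add: max_def) (smt (verit) field_sum_of_halves)
    qed
    have "2 ^ CARD('d) * (\<rho> / 2) ^ CARD('d) = \<rho> ^ CARD('d)" by (simp flip: power_mult_distrib)
    then have "ennreal (\<rho> ^ CARD('d)) = 2 ^ CARD('d) * ennreal ((\<rho> / 2) ^ CARD('d))"
      by (metis ennreal_mult' ennreal_numeral ennreal_power zero_le_numeral zero_le_power)
    also have "ennreal ((\<rho> / 2) ^ CARD('d)) = (\<integral>\<^sup>+z. (if z \<in> cube w (\<rho> / 2) then 1 else 0) \<partial>lborel)"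
      using \<rho> a by (subst integral_cube) auto
    finally have "ennreal (\<rho> ^ CARD('d)) = 2 ^ CARD('d) * (\<integral>\<^sup>+z. (if z \<in> cube w (\<rho> / 2) then 1 else 0) \<partial>lborel)" .
    moreover have "(\<integral>\<^sup>+z. (if z \<in> cube w (\<rho> / 2) then 1 else 0) \<partial>lborel) \<le>
       (\<integral>\<^sup>+z. ((if x \<in> cube z \<rho> then 1 else 0) * (if y \<in> cube z \<rho> then 1 else 0)) \<partial>lborel)"
      by (rule nn_integral_mono) (use sub in auto)
    ultimately show ?thesis by (simp add: mult_left_mono)
  qed
  let ?J = "\<lambda>\<rho>. (\<integral>\<^sup>+z. ((if x \<in> cube z \<rho> then 1 else 0) * (if y \<in> cube z \<rho> then 1 else 0)) \<partial>lborel) :: ennreal"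
  have [measurable]: "?J \<in> borel_measurable borel" by measurable
  have "ennreal (1 / a powr (n - \<alpha>)) =
    ennreal ((n - \<alpha>) * 2 powr (n - \<alpha>)) * (\<integral>\<^sup>+\<rho>. ennreal (\<rho> powr (- (n - \<alpha>) - 1)) * indicator {2 * a..} \<rho> \<partial>lborel)"
  proof -
    have "(2 * a) powr (- (n - \<alpha>)) = 1 / (2 powr (n - \<alpha>) * a powr (n - \<alpha>))"
      using a by (simp only: powr_minus_divide powr_mult)
    then show ?thesis
      using a n\<alpha> by (subst nn_integral_powr_atLeast) (auto simp: ennreal_mult[symmetric])
  qed
  also have "\<dots> \<le> ennreal ((n - \<alpha>) * 2 powr (n - \<alpha>)) *
    (\<integral>\<^sup>+\<rho>. 2 ^ CARD('d) * (ennreal (\<rho> powr (\<alpha> - 2 * n - 1)) * indicator {0<..} \<rho> * ?J \<rho>) \<partial>lborel)"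
  proof (intro mult_left_mono nn_integral_mono)
    fix \<rho>
    show "ennreal (\<rho> powr (- (n - \<alpha>) - 1)) * indicator {2 * a..} \<rho> \<le>
      2 ^ CARD('d) * (ennreal (\<rho> powr (\<alpha> - 2 * n - 1)) * indicator {0<..} \<rho> * ?J \<rho>)"
    proof (cases "2 * a \<le> \<rho>")
      case True
      then have \<rho>: "0 < \<rho>" using a by linarith
      have "\<rho> powr (- (n - \<alpha>) - 1) = \<rho> powr (\<alpha> - 2 * n - 1) * \<rho> ^ CARD('d)"
        using \<rho> by (simp add: n_def powr_add[symmetric] algebra_simps flip: powr_realpow)
      then have "ennreal (\<rho> powr (- (n - \<alpha>) - 1)) = ennreal (\<rho> powr (\<alpha> - 2 * n - 1)) * ennreal (\<rho> ^ CARD('d))"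
        using \<rho> by (simp add: ennreal_mult)
      also have "\<dots> \<le> ennreal (\<rho> powr (\<alpha> - 2 * n - 1)) * (2 ^ CARD('d) * ?J \<rho>)"
        by (intro mult_left_mono card True) simp
      finally show ?thesis using True \<rho> by (simp add: mult_ac)
    qed simp
  qed simp
  also have "\<dots> = ennreal (2 ^ CARD('d) * (n - \<alpha>) * 2 powr (n - \<alpha>)) *
     (\<integral>\<^sup>+\<rho>. ennreal (\<rho> powr (\<alpha> - 2 * n - 1)) * indicator {0<..} \<rho> * ?J \<rho> \<partial>lborel)"
  proof -
    have "ennreal (2 ^ CARD('d) * (n - \<alpha>) * 2 powr (n - \<alpha>)) = ennreal ((n - \<alpha>) * 2 powr (n - \<alpha>)) * 2 ^ CARD('d)"
      using n\<alpha> by (simp add: ennreal_mult ennreal_power[symmetric] mult_ac)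
    then show ?thesis by (simp add: nn_integral_cmult mult.assoc)
  qed
  also have "(\<lambda>\<rho>. ennreal (\<rho> powr (\<alpha> - 2 * n - 1)) * indicator {0<..} \<rho> * ?J \<rho>) =
    (\<lambda>\<rho>. \<integral>\<^sup>+z. ennreal (\<rho> powr (\<alpha> - 2 * n - 1)) * indicator {0<..} \<rho> *
      ((if x \<in> cube z \<rho> then 1 else 0) * (if y \<in> cube z \<rho> then 1 else 0)) \<partial>lborel)"
    by (rule ext) (rule nn_integral_cmult[symmetric], measurable)
  finally show ?thesis by (simp add: a_def)
\<comment> \<open>For \<open>x = y\<close> the left side is 0, by the conventions
  \<open>0 powr a = 0\<close> and \<open>1 / 0 = 0\<close>.\<close>
qed simp

text \<open>Expanding the kernel over cubes gives a nonnegative integrand in \<open>x\<close>,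
  \<open>y\<close>, \<open>\<rho>\<close> and \<open>z\<close>. With the cube variables moved
  outermost, \<open>cube_bilinear_lux\<close> applies on each cube, and what remains is
  \<open>lux_pairing\<close>.\<close>

theorem bilinear_estimate:
  fixes g h :: "real^'d \<Rightarrow> real"
  assumes k: "(\<lambda>w. k (fst w) (snd w)) \<in> borel_measurable (lebesgue \<Otimes>\<^sub>M lebesgue)"
    and g[measurable]: "g \<in> borel_measurable lebesgue" and g0: "\<And>y. 0 \<le> g y"
    and h[measurable]: "h \<in> borel_measurable lebesgue" and h0: "\<And>y. 0 \<le> h y"
    and \<Phi>: "young_function \<Phi>" "young_function \<Phi>'"
    and \<Psi>: "mono \<Psi>" "\<And>t. 0 \<le> \<Psi> t" "\<Psi> 1 \<le> 1 / 2"
    and \<Psi>': "mono \<Psi>'" "\<And>t. 0 \<le> \<Psi>' t" "\<Psi>' 1 \<le> 1 / 2"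
    and c: "0 < c" "\<And>s t. 0 \<le> s \<Longrightarrow> 0 \<le> t \<Longrightarrow> s * t \<le> c * (\<Phi> s + \<Psi> t)"
    and c': "0 < c'" "\<And>s t. 0 \<le> s \<Longrightarrow> 0 \<le> t \<Longrightarrow> s * t \<le> c' * (\<Phi>' s + \<Psi>' t)"
    and \<kappa>: "0 \<le> \<kappa>" "\<And>z \<rho>. 0 < \<rho> \<Longrightarrow>
        orlicz_norm \<Phi>' (cube z \<rho>) (\<lambda>x. orlicz_norm \<Phi> (cube z \<rho>) (k x)) \<le> ennreal \<kappa>"
    and A: "power_profile (level_integral (\<lambda>t. 2 * \<Psi> t) g) s q C"
    and B: "power_profile (level_integral (\<lambda>t. 2 * \<Psi>' t) h) s' q' C'"
    and q: "1 < q" "1 / q + 1 / q' = 1" and C: "0 \<le> C" "0 \<le> C'" and s: "0 < s" "0 < s'"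
    and \<alpha>: "0 < \<alpha>" "\<alpha> < real CARD('d)" "1 + \<alpha> / real CARD('d) = s / q + s' / q'"
  defines "n \<equiv> real CARD('d)"
  shows "(\<integral>\<^sup>+x. (\<integral>\<^sup>+y. k x y * ennreal (g y) * ennreal (h x) * ennreal (1 / norm (x - y) powr (n - \<alpha>)) \<partial>lebesgue) \<partial>lebesgue)
    \<le> ennreal (2 ^ CARD('d) * (n - \<alpha>) * 2 powr (n - \<alpha>) * (4 * c * c' *
        ((s / q + s' / q') / \<alpha> * (q / s * C + q' / s' * C')))) * ennreal \<kappa>"
proof -
  have q': "1 < q'" using q by (rule conjugate_exponent_gt_1)
  have [measurable]: "\<Psi> \<in> borel_measurable borel" "\<Psi>' \<in> borel_measurable borel"
    by (auto intro: borel_measurable_mono \<Psi> \<Psi>')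
  have [measurable (raw)]: "(\<lambda>w. k (f1 w) (f2 w)) \<in> borel_measurable M"
    if "f1 \<in> M \<rightarrow>\<^sub>M lebesgue" "f2 \<in> M \<rightarrow>\<^sub>M lebesgue" for f1 f2 and M :: "'x measure"
    using measurable_compose[OF measurable_Pair[OF that] k] by simp
  let ?c0 = "ennreal (2 ^ CARD('d) * (n - \<alpha>) * 2 powr (n - \<alpha>))"
  let ?r = "\<lambda>\<rho>. ennreal (\<rho> powr (\<alpha> - 2 * n - 1)) * indicator {0<..} \<rho>"
  let ?Q = "\<lambda>x z \<rho>. (if x \<in> cube z \<rho> then 1 else 0) :: ennreal"
  let ?K = "\<lambda>x y. k x y * ennreal (g y) * ennreal (h x)"
  let ?F = "\<lambda>x y \<rho> z. ?K x y * (?r \<rho> * (?Q x z \<rho> * ?Q y z \<rho>))"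
  have "(\<integral>\<^sup>+x. (\<integral>\<^sup>+y. ?K x y * ennreal (1 / norm (x - y) powr (n - \<alpha>)) \<partial>lebesgue) \<partial>lebesgue) \<le>
    (\<integral>\<^sup>+x. (\<integral>\<^sup>+y. ?K x y * (?c0 * (\<integral>\<^sup>+\<rho>. (\<integral>\<^sup>+z. ?r \<rho> * (?Q x z \<rho> * ?Q y z \<rho>) \<partial>lborel) \<partial>lborel)) \<partial>lebesgue) \<partial>lebesgue)"
    unfolding n_def by (intro nn_integral_mono mult_left_mono riesz_kernel_le_cubes \<alpha>) auto
  also have "\<dots> = (\<integral>\<^sup>+x. (\<integral>\<^sup>+y. ?c0 * (\<integral>\<^sup>+\<rho>. (\<integral>\<^sup>+z. ?F x y \<rho> z \<partial>lborel) \<partial>lborel) \<partial>lebesgue) \<partial>lebesgue)"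
  proof (intro nn_integral_cong)
    fix x y :: "real^'d"
    have "(\<integral>\<^sup>+\<rho>. (\<integral>\<^sup>+z. ?F x y \<rho> z \<partial>lborel) \<partial>lborel) = (\<integral>\<^sup>+\<rho>. ?K x y * (\<integral>\<^sup>+z. ?r \<rho> * (?Q x z \<rho> * ?Q y z \<rho>) \<partial>lborel) \<partial>lborel)"
      by (intro nn_integral_cong nn_integral_cmult) measurable
    also have "\<dots> = ?K x y * (\<integral>\<^sup>+\<rho>. (\<integral>\<^sup>+z. ?r \<rho> * (?Q x z \<rho> * ?Q y z \<rho>) \<partial>lborel) \<partial>lborel)"
      by (rule nn_integral_cmult) measurable
    finally show "?K x y * (?c0 * (\<integral>\<^sup>+\<rho>. (\<integral>\<^sup>+z. ?r \<rho> * (?Q x z \<rho> * ?Q y z \<rho>) \<partial>lborel) \<partial>lborel)) =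
      ?c0 * (\<integral>\<^sup>+\<rho>. (\<integral>\<^sup>+z. ?F x y \<rho> z \<partial>lborel) \<partial>lborel)" by (simp only: mult_ac)
  qed
  also have "\<dots> = (\<integral>\<^sup>+x. ?c0 * (\<integral>\<^sup>+y. (\<integral>\<^sup>+\<rho>. (\<integral>\<^sup>+z. ?F x y \<rho> z \<partial>lborel) \<partial>lborel) \<partial>lebesgue) \<partial>lebesgue)"
    by (intro nn_integral_cong nn_integral_cmult) measurable
  also have "\<dots> = ?c0 * (\<integral>\<^sup>+x. (\<integral>\<^sup>+y. (\<integral>\<^sup>+\<rho>. (\<integral>\<^sup>+z. ?F x y \<rho> z \<partial>lborel) \<partial>lborel) \<partial>lebesgue) \<partial>lebesgue)"
    by (rule nn_integral_cmult) measurable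
  finally have step1: "(\<integral>\<^sup>+x. (\<integral>\<^sup>+y. ?K x y * ennreal (1 / norm (x - y) powr (n - \<alpha>)) \<partial>lebesgue) \<partial>lebesgue) \<le>
    ?c0 * (\<integral>\<^sup>+x. (\<integral>\<^sup>+y. (\<integral>\<^sup>+\<rho>. (\<integral>\<^sup>+z. ?F x y \<rho> z \<partial>lborel) \<partial>lborel) \<partial>lebesgue) \<partial>lebesgue)" .
  have "(\<integral>\<^sup>+x. (\<integral>\<^sup>+y. (\<integral>\<^sup>+\<rho>. (\<integral>\<^sup>+z. ?F x y \<rho> z \<partial>lborel) \<partial>lborel) \<partial>lebesgue) \<partial>lebesgue) =
    (\<integral>\<^sup>+x. (\<integral>\<^sup>+\<rho>. (\<integral>\<^sup>+y. (\<integral>\<^sup>+z. ?F x y \<rho> z \<partial>lborel) \<partial>lebesgue) \<partial>lborel) \<partial>lebesgue)"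
    by (intro nn_integral_cong lborel_lebesgue.Fubini') measurable
  also have "\<dots> = (\<integral>\<^sup>+\<rho>. (\<integral>\<^sup>+x. (\<integral>\<^sup>+y. (\<integral>\<^sup>+z. ?F x y \<rho> z \<partial>lborel) \<partial>lebesgue) \<partial>lebesgue) \<partial>lborel)"
    by (rule lborel_lebesgue.Fubini') measurable
  also have "\<dots> = (\<integral>\<^sup>+\<rho>. (\<integral>\<^sup>+x. (\<integral>\<^sup>+z. (\<integral>\<^sup>+y. ?F x y \<rho> z \<partial>lebesgue) \<partial>lborel) \<partial>lebesgue) \<partial>lborel)"
    by (intro nn_integral_cong lborel_lebesgue.Fubini') measurable
  also have "\<dots> = (\<integral>\<^sup>+\<rho>. (\<integral>\<^sup>+z. (\<integral>\<^sup>+x. (\<integral>\<^sup>+y. ?F x y \<rho> z \<partial>lebesgue) \<partial>lebesgue) \<partial>lborel) \<partial>lborel)"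
    by (intro nn_integral_cong lborel_lebesgue.Fubini') measurable
  finally have step2: "(\<integral>\<^sup>+x. (\<integral>\<^sup>+y. (\<integral>\<^sup>+\<rho>. (\<integral>\<^sup>+z. ?F x y \<rho> z \<partial>lborel) \<partial>lborel) \<partial>lebesgue) \<partial>lebesgue) =
    (\<integral>\<^sup>+\<rho>. (\<integral>\<^sup>+z. (\<integral>\<^sup>+x. (\<integral>\<^sup>+y. ?F x y \<rho> z \<partial>lebesgue) \<partial>lebesgue) \<partial>lborel) \<partial>lborel)" .
  have "(\<integral>\<^sup>+\<rho>. (\<integral>\<^sup>+z. (\<integral>\<^sup>+x. (\<integral>\<^sup>+y. ?F x y \<rho> z \<partial>lebesgue) \<partial>lebesgue) \<partial>lborel) \<partial>lborel) \<le>
    (\<integral>\<^sup>+\<rho>. (\<integral>\<^sup>+z. ennreal (4 * c * c' * \<kappa>) * (ennreal (\<rho> powr (\<alpha> - 1)) * indicator {0<..} \<rho> *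
       (lux \<Psi> g z \<rho> * lux \<Psi>' h z \<rho>)) \<partial>lborel) \<partial>lborel)"
  proof (intro nn_integral_mono)
    fix \<rho> :: real and z :: "real^'d"
    show "(\<integral>\<^sup>+x. (\<integral>\<^sup>+y. ?F x y \<rho> z \<partial>lebesgue) \<partial>lebesgue) \<le>
      ennreal (4 * c * c' * \<kappa>) * (ennreal (\<rho> powr (\<alpha> - 1)) * indicator {0<..} \<rho> * (lux \<Psi> g z \<rho> * lux \<Psi>' h z \<rho>))"
    proof (cases "0 < \<rho>")
      case \<rho>: True
      have fin: "lux \<Psi> g z \<rho> < \<infinity>" "lux \<Psi>' h z \<rho> < \<infinity>"
        using q q' by (auto intro!: lux_finite[OF g g0 \<Psi> A _ C(1) \<rho>, simplified] lux_finite[OF h h0 \<Psi>' B _ C(2) \<rho>, simplified])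
      have "(\<integral>\<^sup>+x. (\<integral>\<^sup>+y. ?F x y \<rho> z \<partial>lebesgue) \<partial>lebesgue) =
        (\<integral>\<^sup>+x. ?r \<rho> * ((\<integral>\<^sup>+y. k x y * ennreal (g y) * ?Q y z \<rho> \<partial>lebesgue) * ennreal (h x) * ?Q x z \<rho>) \<partial>lebesgue)"
      proof (rule nn_integral_cong)
        fix x :: "real^'d"
        have "(\<integral>\<^sup>+y. ?F x y \<rho> z \<partial>lebesgue) = (\<integral>\<^sup>+y. (?r \<rho> * ennreal (h x) * ?Q x z \<rho>) * (k x y * ennreal (g y) * ?Q y z \<rho>) \<partial>lebesgue)"
          by (intro nn_integral_cong) (simp only: mult_ac)
        also have "\<dots> = (?r \<rho> * ennreal (h x) * ?Q x z \<rho>) * (\<integral>\<^sup>+y. k x y * ennreal (g y) * ?Q y z \<rho> \<partial>lebesgue)"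
          by (rule nn_integral_cmult) measurable
        finally show "(\<integral>\<^sup>+y. ?F x y \<rho> z \<partial>lebesgue) =
          ?r \<rho> * ((\<integral>\<^sup>+y. k x y * ennreal (g y) * ?Q y z \<rho> \<partial>lebesgue) * ennreal (h x) * ?Q x z \<rho>)"
          by (simp only: mult_ac)
      qed
      also have "\<dots> = ?r \<rho> * (\<integral>\<^sup>+x. (\<integral>\<^sup>+y. k x y * ennreal (g y) * ?Q y z \<rho> \<partial>lebesgue) * ennreal (h x) * ?Q x z \<rho> \<partial>lebesgue)"
        by (rule nn_integral_cmult) measurable
      also have "\<dots> \<le> ?r \<rho> * (ennreal (4 * c * c' * (\<rho> ^ CARD('d))\<^sup>2 * \<kappa>) * (lux \<Psi> g z \<rho> * lux \<Psi>' h z \<rho>))"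
        by (intro mult_left_mono cube_bilinear_lux[OF k g g0 h h0 \<Phi> \<Psi>(1,2) \<Psi>'(1,2) c c' \<rho> \<kappa>(1) \<kappa>(2)[OF \<rho>] fin]) simp_all
      also have "\<dots> = ennreal (4 * c * c' * \<kappa>) * (ennreal (\<rho> powr (\<alpha> - 1)) * indicator {0<..} \<rho> * (lux \<Psi> g z \<rho> * lux \<Psi>' h z \<rho>))"
      proof -
        have "\<rho> powr (\<alpha> - 2 * n - 1) * (\<rho> ^ CARD('d))\<^sup>2 = \<rho> powr (\<alpha> - 1)"
          using \<rho> by (simp add: n_def power2_eq_square powr_add[symmetric] flip: powr_realpow)
        then have "\<rho> powr (\<alpha> - 2 * n - 1) * (4 * c * c' * (\<rho> ^ CARD('d))\<^sup>2 * \<kappa>) = 4 * c * c' * \<kappa> * \<rho> powr (\<alpha> - 1)"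
          by (metis mult.assoc mult.commute)
        then have "ennreal (\<rho> powr (\<alpha> - 2 * n - 1)) * ennreal (4 * c * c' * (\<rho> ^ CARD('d))\<^sup>2 * \<kappa>) =
           ennreal (4 * c * c' * \<kappa>) * ennreal (\<rho> powr (\<alpha> - 1))"
          using c c' \<kappa> by (simp add: ennreal_mult[symmetric])
        then show ?thesis using \<rho> by (simp add: mult.assoc[symmetric])
      qed
      finally show ?thesis .
    qed simp
  qed
  also have "\<dots> = (\<integral>\<^sup>+\<rho>. ennreal (4 * c * c' * \<kappa>) * (\<integral>\<^sup>+z. ennreal (\<rho> powr (\<alpha> - 1)) * indicator {0<..} \<rho> *
       (lux \<Psi> g z \<rho> * lux \<Psi>' h z \<rho>) \<partial>lborel) \<partial>lborel)"
  proof (rule nn_integral_cong)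
    fix \<rho> :: real
    have [measurable]: "(\<lambda>z. lux \<Psi> g z \<rho> * lux \<Psi>' h z \<rho>) \<in> borel_measurable lborel"
      by measurable
    show "(\<integral>\<^sup>+z. ennreal (4 * c * c' * \<kappa>) * (ennreal (\<rho> powr (\<alpha> - 1)) * indicator {0<..} \<rho> *
       (lux \<Psi> g z \<rho> * lux \<Psi>' h z \<rho>)) \<partial>lborel) = ennreal (4 * c * c' * \<kappa>) *
       (\<integral>\<^sup>+z. ennreal (\<rho> powr (\<alpha> - 1)) * indicator {0<..} \<rho> * (lux \<Psi> g z \<rho> * lux \<Psi>' h z \<rho>) \<partial>lborel)"
      by (rule nn_integral_cmult) measurable
  qed
  also have "\<dots> = ennreal (4 * c * c' * \<kappa>) * (\<integral>\<^sup>+\<rho>. (\<integral>\<^sup>+z. ennreal (\<rho> powr (\<alpha> - 1)) * indicator {0<..} \<rho> *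
       (lux \<Psi> g z \<rho> * lux \<Psi>' h z \<rho>) \<partial>lborel) \<partial>lborel)"
    by (rule nn_integral_cmult) measurable
  also have "\<dots> \<le> ennreal (4 * c * c' * \<kappa>) * ennreal ((s / q + s' / q') / \<alpha> * (q / s * C + q' / s' * C'))"
    by (intro mult_left_mono lux_pairing[OF g g0 h h0 \<Psi> \<Psi>' A B q C s \<alpha>(1,3)]) simp
  finally have step3: "(\<integral>\<^sup>+\<rho>. (\<integral>\<^sup>+z. (\<integral>\<^sup>+x. (\<integral>\<^sup>+y. ?F x y \<rho> z \<partial>lebesgue) \<partial>lebesgue) \<partial>lborel) \<partial>lborel) \<le> \<dots>" .
  have eq: "?c0 * (ennreal (4 * c * c' * \<kappa>) * ennreal ((s / q + s' / q') / \<alpha> * (q / s * C + q' / s' * C'))) =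
    ennreal (2 ^ CARD('d) * (n - \<alpha>) * 2 powr (n - \<alpha>) * (4 * c * c' *
        ((s / q + s' / q') / \<alpha> * (q / s * C + q' / s' * C')))) * ennreal \<kappa>"
    using c c' \<kappa> \<alpha> q q' s C by (simp add: n_def ennreal_mult[symmetric] mult_ac)
  show ?thesis
    using order_trans[OF step1[unfolded step2] mult_left_mono[OF step3 zero_le]] unfolding eq .
qed

section \<open>Associate functions\<close>

lemma young_assoc_bdd_above:
  assumes "young_function \<Phi>"
  shows "bdd_above ((\<lambda>s. s * t - \<Phi> s) ` {0<..})"
proof -
  have "filterlim (\<lambda>s. \<Phi> s / s) at_top at_top" using assms by (simp add: young_function_def)
  then have "\<forall>\<^sub>F s in at_top. t \<le> \<Phi> s / s" by (simp add: filterlim_at_top)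
  then obtain N where N: "\<And>s. N \<le> s \<Longrightarrow> t \<le> \<Phi> s / s" by (auto simp: eventually_at_top_linorder)
  \<comment> \<open>Beyond \<open>N\<close> superlinear growth makes the difference nonpositive;
    below \<open>N\<close> the product is small enough.\<close>
  have "s * t - \<Phi> s \<le> \<bar>N\<bar> * \<bar>t\<bar>" if s: "0 < s" for s
  proof (cases "N \<le> s")
    case True
    then have "s * t \<le> \<Phi> s" using N[of s] s by (simp add: field_simps)
    then show ?thesis by (meson abs_ge_zero diff_le_0_iff_le mult_nonneg_nonneg order_trans)
  next
    case False
    have "s * t \<le> s * \<bar>t\<bar>" using s by (intro mult_left_mono) auto
    also have "\<dots> \<le> \<bar>N\<bar> * \<bar>t\<bar>" using False s by (intro mult_right_mono) auto
    finally show ?thesis using young_function_nonneg[OF assms, of s] s by linarith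
  qed
  then show ?thesis by (auto intro!: bdd_aboveI[of _ "\<bar>N\<bar> * \<bar>t\<bar>"])
qed

lemma young_assoc_upper: "young_function \<Phi> \<Longrightarrow> 0 < s \<Longrightarrow> s * t - \<Phi> s \<le> young_assoc \<Phi> t"
  unfolding young_assoc_def by (rule cSUP_upper) (auto intro: young_assoc_bdd_above)

lemma young_assoc_mono:
  assumes "young_function \<Phi>" "t \<le> t'"
  shows "young_assoc \<Phi> t \<le> young_assoc \<Phi> t'"
  unfolding young_assoc_def
proof (rule cSUP_mono)
  show "\<exists>m\<in>{0<..}. n * t - \<Phi> n \<le> m * t' - \<Phi> m" if "n \<in> {0<..}" for n
    using that assms(2) by (intro bexI[of _ n]) auto
qed (auto intro: young_assoc_bdd_above assms)

text \<open>Convexity and \<open>\<Phi> 0 = 0\<close> give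
  \<open>\<Phi> s \<le> s * \<Phi> 1\<close> for \<open>s \<le> 1\<close>, so the terms of the
  supremum are at least \<open>- s * \<Phi> 1\<close>, which tends to 0 with
  \<open>s\<close>.\<close>

lemma young_assoc_nonneg:
  assumes \<Phi>: "young_function \<Phi>" and t: "0 \<le> t"
  shows "0 \<le> young_assoc \<Phi> t"
proof (rule ccontr)
  assume "\<not> 0 \<le> young_assoc \<Phi> t"
  then have neg: "young_assoc \<Phi> t < 0" by simp
  have conv: "convex_on {0..} \<Phi>" and \<Phi>0: "\<Phi> 0 = 0" using \<Phi> by (auto simp: young_function_def)
  have \<Phi>1: "0 \<le> \<Phi> 1" using young_function_nonneg[OF \<Phi>] by simp
  define s where "s = min 1 (- young_assoc \<Phi> t / (2 * (\<Phi> 1 + 1)))"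
  have "0 < - young_assoc \<Phi> t / (2 * (\<Phi> 1 + 1))" using neg \<Phi>1 by (intro divide_pos_pos) auto
  then have s: "0 < s" "s \<le> 1" by (auto simp: s_def)
  have "s * \<Phi> 1 \<le> - young_assoc \<Phi> t / (2 * (\<Phi> 1 + 1)) * (\<Phi> 1 + 1)"
    using \<Phi>1 s by (intro mult_mono) (auto simp: s_def)
  also have "\<dots> = - young_assoc \<Phi> t / 2" using \<Phi>1 by (simp add: field_simps)
  finally have "s * \<Phi> 1 \<le> - young_assoc \<Phi> t / 2" .
  moreover have "\<Phi> s \<le> s * \<Phi> 1"
    using convex_onD[OF conv, of s 0 1] s \<Phi>0 by simp
  moreover have "s * t - \<Phi> s \<le> young_assoc \<Phi> t" by (rule young_assoc_upper[OF \<Phi> s(1)])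
  moreover have "0 \<le> s * t" using s t by simp
  ultimately show False using neg by linarith
qed

lemma young_assoc_scale:
  assumes \<Phi>: "young_function \<Phi>" and e: "0 \<le> e" "e \<le> 1"
  shows "young_assoc \<Phi> (e * t) \<le> e * young_assoc \<Phi> t"
  unfolding young_assoc_def[of \<Phi> "e * t"]
proof (rule cSUP_least)
  fix s :: real assume "s \<in> {0<..}"
  then have s: "0 < s" by simp
  have "e * \<Phi> s \<le> \<Phi> s" using young_function_nonneg[OF \<Phi>, of s] e s by (simp add: mult_left_le_one_le)
  then have "s * (e * t) - \<Phi> s \<le> e * (s * t - \<Phi> s)" by (simp add: algebra_simps)
  also have "\<dots> \<le> e * young_assoc \<Phi> t" by (intro mult_left_mono young_assoc_upper[OF \<Phi> s] e)
  finally show "s * (e * t) - \<Phi> s \<le> e * young_assoc \<Phi> t" .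
qed simp

lemma young_inequality:
  assumes \<Phi>: "young_function \<Phi>" and "0 \<le> s" "0 \<le> t"
  shows "s * t \<le> \<Phi> s + young_assoc \<Phi> t"
proof (cases "s = 0")
  case True
  then show ?thesis using young_assoc_nonneg[OF \<Phi> assms(3)] young_function_nonneg[OF \<Phi>, of 0] by simp
next
  case False
  then show ?thesis using young_assoc_upper[OF \<Phi>, of s t] assms by simp
qed

text \<open>The associate function itself may violate \<open>\<Psi> 1 \<le> 1/2\<close>, on which
  the truncation at level \<open>l\<close> rests. Dilating its argument by \<open>e\<close> repairs
  this, and Young's inequality survives with \<open>c = 1/e\<close>.\<close>

lemma young_companion:
  assumes \<Phi>: "young_function \<Phi>"
  obtains \<Psi> c where "mono \<Psi>" "\<And>t. 0 \<le> \<Psi> t" "\<Psi> 1 \<le> 1 / 2" "0 < c"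
    "\<And>s t. 0 \<le> s \<Longrightarrow> 0 \<le> t \<Longrightarrow> s * t \<le> c * (\<Phi> s + \<Psi> t)"
    "\<And>t. 0 \<le> t \<Longrightarrow> \<Psi> t \<le> young_assoc \<Phi> t"
proof -
  define M where "M = young_assoc \<Phi> 1"
  have M: "0 \<le> M" by (simp add: M_def young_assoc_nonneg[OF \<Phi>])
  \<comment> \<open>Makes \<open>e * M \<le> 1/2\<close>, also when \<open>M = 0\<close>; and
    \<open>e \<le> 1\<close> keeps the dilate below the associate function.\<close>
  define e where "e = 1 / (2 * (1 + M))"
  have e: "0 < e" "e \<le> 1" "e * M \<le> 1 / 2" using M by (auto simp: e_def field_simps)
  \<comment> \<open>\<open>max 0\<close> makes monotonicity and nonnegativity hold on the whole
    line.\<close>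
  define \<Psi> where "\<Psi> t = young_assoc \<Phi> (e * max 0 t)" for t
  show ?thesis
  proof (rule that[of \<Psi> "1 / e"])
    show "mono \<Psi>" unfolding \<Psi>_def using e
      by (intro monoI young_assoc_mono[OF \<Phi>] mult_left_mono) auto
    show "0 \<le> \<Psi> t" for t unfolding \<Psi>_def using e by (intro young_assoc_nonneg[OF \<Phi>]) auto
    show "\<Psi> 1 \<le> 1 / 2" using young_assoc_scale[OF \<Phi>, of e 1] e by (simp add: \<Psi>_def M_def)
    show "s * t \<le> 1 / e * (\<Phi> s + \<Psi> t)" if "0 \<le> s" "0 \<le> t" for s t
      using young_inequality[OF \<Phi> that(1), of "e * t"] that e by (simp add: \<Psi>_def field_simps)
    show "\<Psi> t \<le> young_assoc \<Phi> t" if "0 \<le> t" for t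
      unfolding \<Psi>_def using that e by (intro young_assoc_mono[OF \<Phi>]) (simp add: mult_left_le_one_le)
  qed (use e in simp)
qed

text \<open>The factor 2 left by the truncation multiplies the integral by at most
  \<open>2 powr e\<close>, so the growth conditions on the associates pass to their
  companions.\<close>

lemma companion_integral_finite:
  assumes \<Psi>: "\<And>t. 0 \<le> \<Psi> t" "\<And>t. 0 \<le> t \<Longrightarrow> \<Psi> t \<le> \<Theta> t" and e: "0 < e"
    and fin: "(\<integral>\<^sup>+t\<in>{1..}. ennreal (\<Theta> t powr e / t powr q / t) \<partial>lborel) < \<infinity>"
    and \<Theta>: "\<And>t t'. t \<le> t' \<Longrightarrow> \<Theta> t \<le> \<Theta> t'"
  obtains J where "0 \<le> J" "(\<integral>\<^sup>+t\<in>{1..}. ennreal ((2 * \<Psi> t) powr e / t powr q / t) \<partial>lborel) \<le> ennreal J"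
proof -
  have [measurable]: "\<Theta> \<in> borel_measurable borel" by (intro borel_measurable_mono monoI \<Theta>)
  have "(\<integral>\<^sup>+t\<in>{1..}. ennreal ((2 * \<Psi> t) powr e / t powr q / t) \<partial>lborel) \<le>
     (\<integral>\<^sup>+t. ennreal (2 powr e) * (ennreal (\<Theta> t powr e / t powr q / t) * indicator {1..} t) \<partial>lborel)"
  proof (rule nn_integral_mono)
    fix t :: real
    show "ennreal ((2 * \<Psi> t) powr e / t powr q / t) * indicator {1..} t \<le>
      ennreal (2 powr e) * (ennreal (\<Theta> t powr e / t powr q / t) * indicator {1..} t)"
    proof (cases "1 \<le> t")
      case True
      have "(2 * \<Psi> t) powr e / t powr q / t \<le> (2 * \<Theta> t) powr e / t powr q / t"
        using True \<Psi>(1)[of t] \<Psi>(2)[of t] e by (intro divide_right_mono powr_mono2) auto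
      also have "\<dots> = 2 powr e * (\<Theta> t powr e / t powr q / t)"
        using True \<Psi>(1)[of t] \<Psi>(2)[of t] by (simp add: powr_mult)
      finally show ?thesis using True by (simp add: ennreal_mult'[symmetric] ennreal_leI)
    qed simp
  qed
  also have "\<dots> = ennreal (2 powr e) * (\<integral>\<^sup>+t\<in>{1..}. ennreal (\<Theta> t powr e / t powr q / t) \<partial>lborel)"
    by (rule nn_integral_cmult) measurable
  also have "\<dots> < \<infinity>" using fin by (simp add: ennreal_mult_less_top)
  finally obtain r where "0 \<le> r" "(\<integral>\<^sup>+t\<in>{1..}. ennreal ((2 * \<Psi> t) powr e / t powr q / t) \<partial>lborel) = ennreal r"
    by (cases "\<integral>\<^sup>+t\<in>{1..}. ennreal ((2 * \<Psi> t) powr e / t powr q / t) \<partial>lborel") auto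
  then show ?thesis using that[of r] by simp
qed

text \<open>\<open>k\<close>, \<open>g\<close> and \<open>h\<close> are quantified after
  \<open>K\<close>, which makes the constant uniform. With \<open>C\<close> outermost the bound is
  \<open>bilinear_estimate\<close> directly; with \<open>D\<close> outermost it follows by
  exchanging \<open>x\<close> with \<open>y\<close>, \<open>g\<close> with \<open>h\<close> and
  \<open>C\<close> with \<open>D\<close>.\<close>

theorem scalar_bilinear_bound:
  fixes \<alpha> p q :: real and C D :: "real \<Rightarrow> real"
  assumes \<alpha>: "0 < \<alpha>" "\<alpha> < real CARD('d::finite)" and p: "1 < p" and q: "1 < q" "1 / q + 1 / q' = 1"
    and rel: "\<alpha> / real CARD('d) + 1 / q = 1 / p"
    and CD: "young_function C" "young_function D"
    and DB: "young_assoc D \<in> B_class2 p q" and CB: "young_assoc C \<in> B_class q'"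
  obtains K where "0 < K"
    "\<And>(k :: real^'d \<Rightarrow> real^'d \<Rightarrow> ennreal) (g :: real^'d \<Rightarrow> real) (h :: real^'d \<Rightarrow> real) \<kappa>.
      (\<lambda>w. k (fst w) (snd w)) \<in> borel_measurable (lebesgue \<Otimes>\<^sub>M lebesgue) \<Longrightarrow>
      g \<in> borel_measurable lebesgue \<Longrightarrow> (\<And>y. 0 \<le> g y) \<Longrightarrow> (\<integral>\<^sup>+y. ennreal (g y powr p) \<partial>lebesgue) \<le> 1 \<Longrightarrow>
      h \<in> borel_measurable lebesgue \<Longrightarrow> (\<And>y. 0 \<le> h y) \<Longrightarrow> (\<integral>\<^sup>+x. ennreal (h x powr q') \<partial>lebesgue) \<le> 1 \<Longrightarrow>
      0 \<le> \<kappa> \<Longrightarrow>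
      (\<forall>z \<rho>. 0 < \<rho> \<longrightarrow> orlicz_norm C (cube z \<rho>) (\<lambda>x. orlicz_norm D (cube z \<rho>) (\<lambda>y. k x y)) \<le> ennreal \<kappa>) \<or>
      (\<forall>z \<rho>. 0 < \<rho> \<longrightarrow> orlicz_norm D (cube z \<rho>) (\<lambda>y. orlicz_norm C (cube z \<rho>) (\<lambda>x. k x y)) \<le> ennreal \<kappa>) \<Longrightarrow>
      (\<integral>\<^sup>+x. (\<integral>\<^sup>+y. k x y * ennreal (g y) * ennreal (h x) *
          ennreal (1 / norm (x - y) powr (real CARD('d) - \<alpha>)) \<partial>lebesgue) \<partial>lebesgue) \<le> ennreal K * ennreal \<kappa>"
proof -
  have q': "1 < q'" using q by (rule conjugate_exponent_gt_1)
  have pq: "p \<le> q"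
  proof -
    have "0 \<le> \<alpha> / real CARD('d)" using \<alpha> by simp
    then have "1 / q \<le> 1 / p" using rel by linarith
    then show ?thesis using p q by (simp add: field_simps)
  qed
  obtain \<Psi> c where \<Psi>: "mono \<Psi>" "\<And>t. 0 \<le> \<Psi> t" "\<Psi> 1 \<le> 1 / 2" and c: "0 < c"
    "\<And>s t. 0 \<le> s \<Longrightarrow> 0 \<le> t \<Longrightarrow> s * t \<le> c * (D s + \<Psi> t)" and \<Psi>D: "\<And>t. 0 \<le> t \<Longrightarrow> \<Psi> t \<le> young_assoc D t"
    using young_companion[OF CD(2)] by blast
  obtain \<Psi>' c' where \<Psi>': "mono \<Psi>'" "\<And>t. 0 \<le> \<Psi>' t" "\<Psi>' 1 \<le> 1 / 2" and c': "0 < c'"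
    "\<And>s t. 0 \<le> s \<Longrightarrow> 0 \<le> t \<Longrightarrow> s * t \<le> c' * (C s + \<Psi>' t)" and \<Psi>C: "\<And>t. 0 \<le> t \<Longrightarrow> \<Psi>' t \<le> young_assoc C t"
    using young_companion[OF CD(1)] by blast
  obtain J where J: "0 \<le> J" "(\<integral>\<^sup>+t\<in>{1..}. ennreal ((2 * \<Psi> t) powr (q / p) / t powr q / t) \<partial>lborel) \<le> ennreal J"
    using companion_integral_finite[where \<Psi> = \<Psi> and \<Theta> = "young_assoc D", OF \<Psi>(2) \<Psi>D, where e = "q / p" and q = q] p q DB young_assoc_mono[OF CD(2)]
    by (auto simp: B_class2_def)
  \<comment> \<open>\<open>B_class\<close> has no power on its function, while
    \<open>companion_integral_finite\<close> has one; nonnegativity makes \<open>powr 1\<close> the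
    identity.\<close>
  have "(\<integral>\<^sup>+t\<in>{1..}. ennreal (young_assoc C t powr 1 / t powr q' / t) \<partial>lborel) =
      (\<integral>\<^sup>+t\<in>{1..}. ennreal (young_assoc C t / t powr q' / t) \<partial>lborel)"
    by (rule nn_integral_cong) (auto simp: indicator_def young_assoc_nonneg[OF CD(1)])
  then obtain J' where J': "0 \<le> J'" "(\<integral>\<^sup>+t\<in>{1..}. ennreal ((2 * \<Psi>' t) powr 1 / t powr q' / t) \<partial>lborel) \<le> ennreal J'"
    using companion_integral_finite[where \<Psi> = \<Psi>' and \<Theta> = "young_assoc C", OF \<Psi>'(2) \<Psi>C, where e = 1 and q = q'] CB young_assoc_mono[OF CD(1)]
    by (auto simp: B_class_def)
  have A: "power_profile (level_integral (\<lambda>t. 2 * \<Psi> t) g) (q / p) q (2 powr (q / p) * J)"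
    if "g \<in> borel_measurable lebesgue" "\<And>y. 0 \<le> g y" "(\<integral>\<^sup>+y. ennreal (g y powr p) \<partial>lebesgue) \<le> 1" for g :: "real^'d \<Rightarrow> real"
    using that p pq \<Psi> J by (intro level_integral_profile) (auto simp: mono_def)
  have B: "power_profile (level_integral (\<lambda>t. 2 * \<Psi>' t) h) 1 q' (2 * J')"
    if "h \<in> borel_measurable lebesgue" "\<And>y. 0 \<le> h y" "(\<integral>\<^sup>+y. ennreal (h y powr q') \<partial>lebesgue) \<le> 1" for h :: "real^'d \<Rightarrow> real"
    using level_integral_profile[OF that(1,2), of "\<lambda>t. 2 * \<Psi>' t" q' q' J'] that(3) q' \<Psi>' J' by (auto simp: mono_def)
  define n where "n = real CARD('d)"
  \<comment> \<open>The scaling relation as \<open>lux_pairing\<close> asks for it, with the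
    exponent \<open>q/p\<close> for \<open>g\<close> and 1 for \<open>h\<close>, in both
    orders.\<close>
  have \<sigma>: "1 + \<alpha> / real CARD('d) = q / p / q + 1 / q'" "1 + \<alpha> / real CARD('d) = 1 / q' + q / p / q"
    using rel q by (auto simp: algebra_simps)
  define K where "K = 2 ^ CARD('d) * (n - \<alpha>) * 2 powr (n - \<alpha>) * (4 * c * c' *
        ((q / p / q + 1 / q') / \<alpha> * (q / (q / p) * (2 powr (q / p) * J) + q' / 1 * (2 * J'))))"
  \<comment> \<open>The same constant in the form in which the exchanged variables produce
    it.\<close>
  have K': "K = 2 ^ CARD('d) * (n - \<alpha>) * 2 powr (n - \<alpha>) * (4 * c' * c *
        ((1 / q' + q / p / q) / \<alpha> * (q' / 1 * (2 * J') + q / (q / p) * (2 powr (q / p) * J))))"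
    by (simp add: K_def add.commute mult.commute mult.left_commute)
  have K0: "0 \<le> K" using \<alpha> c c' p q q' J J' by (simp add: K_def n_def)
  show ?thesis
  \<comment> \<open>\<open>K\<close> is only known to be nonnegative; adding 1 provides
    positivity.\<close>
  proof (rule that[of "K + 1"])
    show "0 < K + 1" using K0 by simp
    fix k :: "real^'d \<Rightarrow> real^'d \<Rightarrow> ennreal" and g h :: "real^'d \<Rightarrow> real" and \<kappa>
    assume k: "(\<lambda>w. k (fst w) (snd w)) \<in> borel_measurable (lebesgue \<Otimes>\<^sub>M lebesgue)"
      and g: "g \<in> borel_measurable lebesgue" "\<And>y. 0 \<le> g y" "(\<integral>\<^sup>+y. ennreal (g y powr p) \<partial>lebesgue) \<le> 1"
      and h: "h \<in> borel_measurable lebesgue" "\<And>y. 0 \<le> h y" "(\<integral>\<^sup>+x. ennreal (h x powr q') \<partial>lebesgue) \<le> 1"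
      and \<kappa>: "0 \<le> \<kappa>"
      and or: "(\<forall>z \<rho>. 0 < \<rho> \<longrightarrow> orlicz_norm C (cube z \<rho>) (\<lambda>x. orlicz_norm D (cube z \<rho>) (\<lambda>y. k x y)) \<le> ennreal \<kappa>) \<or>
      (\<forall>z \<rho>. 0 < \<rho> \<longrightarrow> orlicz_norm D (cube z \<rho>) (\<lambda>y. orlicz_norm C (cube z \<rho>) (\<lambda>x. k x y)) \<le> ennreal \<kappa>)"
    let ?X = "\<integral>\<^sup>+x. (\<integral>\<^sup>+y. k x y * ennreal (g y) * ennreal (h x) *
          ennreal (1 / norm (x - y) powr (real CARD('d) - \<alpha>)) \<partial>lebesgue) \<partial>lebesgue"
    from or have "?X \<le> ennreal K * ennreal \<kappa>"
    proof
      assume *: "\<forall>z \<rho>. 0 < \<rho> \<longrightarrow> orlicz_norm C (cube z \<rho>) (\<lambda>x. orlicz_norm D (cube z \<rho>) (\<lambda>y. k x y)) \<le> ennreal \<kappa>"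
      show ?thesis unfolding K_def n_def
        by (rule bilinear_estimate[OF k g(1,2) h(1,2) CD(2,1) \<Psi> \<Psi>' c c' \<kappa> _ A[OF g] B[OF h] q _ _ _ _ \<alpha> \<sigma>(1)])
           (use * p q J J' in auto)
    next
      assume *: "\<forall>z \<rho>. 0 < \<rho> \<longrightarrow> orlicz_norm D (cube z \<rho>) (\<lambda>y. orlicz_norm C (cube z \<rho>) (\<lambda>x. k x y)) \<le> ennreal \<kappa>"
      note [measurable] = g(1) h(1)
      have [measurable (raw)]: "(\<lambda>w. k (f1 w) (f2 w)) \<in> borel_measurable M"
        if "f1 \<in> M \<rightarrow>\<^sub>M lebesgue" "f2 \<in> M \<rightarrow>\<^sub>M lebesgue" for f1 f2 and M :: "'x measure"
        using measurable_compose[OF measurable_Pair[OF that] k] by simp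
      have k': "(\<lambda>w. k (snd w) (fst w)) \<in> borel_measurable (lebesgue \<Otimes>\<^sub>M lebesgue)" by measurable
      have q'': "1 / q' + 1 / q = 1" using q by simp
      have "?X = (\<integral>\<^sup>+y. (\<integral>\<^sup>+x. k x y * ennreal (g y) * ennreal (h x) *
          ennreal (1 / norm (x - y) powr (real CARD('d) - \<alpha>)) \<partial>lebesgue) \<partial>lebesgue)"
        by (rule lebesgue_pair.Fubini') measurable
      also have "\<dots> = (\<integral>\<^sup>+y. (\<integral>\<^sup>+x. k x y * ennreal (h x) * ennreal (g y) *
          ennreal (1 / norm (y - x) powr (real CARD('d) - \<alpha>)) \<partial>lebesgue) \<partial>lebesgue)"
        by (simp add: norm_minus_commute mult_ac)
      also have "\<dots> \<le> ennreal K * ennreal \<kappa>" unfolding K' n_def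
        by (rule bilinear_estimate[OF k' h(1,2) g(1,2) CD(1,2) \<Psi>' \<Psi> c' c \<kappa> _ B[OF h] A[OF g] q' q'' _ _ _ _ \<alpha> \<sigma>(2)])
           (use * p q J J' in auto)
      finally show ?thesis .
    qed
    also have "\<dots> \<le> ennreal (K + 1) * ennreal \<kappa>" by (intro mult_right_mono ennreal_leI) auto
    finally show "?X \<le> ennreal (K + 1) * ennreal \<kappa>" .
  qed
qed

section \<open>Duality and the commutator\<close>

text \<open>The extremal test function, a multiple of \<open>u powr (q - 1)\<close>, requires a
  finite norm, so \<open>T\<close> is first cut off at height \<open>N\<close> and to the ball of
  radius \<open>N\<close>; monotone convergence removes the cut-off. \<open>F\<close> enters only
  through its measurable majorant \<open>T\<close>, so the commutator itself never has to be shown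
  measurable.\<close>

lemma nn_integral_powr_duality:
  fixes T :: "real^'d \<Rightarrow> ennreal" and F :: "real^'d \<Rightarrow> real"
  assumes T[measurable]: "T \<in> borel_measurable lebesgue"
    and F: "\<And>x. 0 \<le> F x" "AE x in lebesgue. ennreal (F x) \<le> T x"
    and q: "1 < q" "1 / q + 1 / q' = 1" and M: "0 \<le> M"
    and dual: "\<And>h. h \<in> borel_measurable lebesgue \<Longrightarrow> (\<And>x. 0 \<le> h x) \<Longrightarrow>
      (\<integral>\<^sup>+x. ennreal (h x powr q') \<partial>lebesgue) \<le> 1 \<Longrightarrow> (\<integral>\<^sup>+x. T x * ennreal (h x) \<partial>lebesgue) \<le> ennreal M"
  shows "(\<integral>\<^sup>+x. ennreal (F x powr q) \<partial>lebesgue) \<le> ennreal (M powr q)"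
proof -
  have q': "1 < q'" using q by (rule conjugate_exponent_gt_1)
  have qq: "(q - 1) * q' = q"
  proof -
    have "1 / q' = (q - 1) / q" using q by (simp add: field_simps)
    then show ?thesis using q q' by (simp add: field_simps)
  qed
  have [measurable]: "Measurable.pred lebesgue (\<lambda>x. x \<in> ball (0 :: real^'d) r)" for r
    by (simp add: pred_def)
  define u where "u N x = enn2real (min (T x) (ennreal (real N))) * indicator (ball 0 (real N)) x" for N and x :: "real^'d"
  have u0: "0 \<le> u N x" for N x by (simp add: u_def)
  have [measurable]: "u N \<in> borel_measurable lebesgue" for N unfolding u_def by measurable
  have uN: "u N x \<le> real N * indicator (ball 0 (real N)) x" for N x
  proof -
    have "enn2real (min (T x) (ennreal (real N))) \<le> enn2real (ennreal (real N))"
      by (intro enn2real_mono) auto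
    then show ?thesis by (simp add: u_def indicator_def)
  qed
  have uT: "ennreal (u N x) \<le> T x" for N x
  proof -
    have "min (T x) (ennreal (real N)) < \<infinity>" by (simp add: min_less_iff_disj)
    then have "ennreal (enn2real (min (T x) (ennreal (real N)))) \<le> T x" by (simp add: ennreal_enn2real_if)
    then show ?thesis by (simp add: u_def indicator_def)
  qed
  have inc: "u N x \<le> u (Suc N) x" for N x
  proof -
    have "min (T x) (ennreal (real (Suc N))) < \<infinity>" by (simp add: min_less_iff_disj)
    moreover have "min (T x) (ennreal (real N)) \<le> min (T x) (ennreal (real (Suc N)))"
      by (intro min.mono ennreal_leI) auto
    ultimately have "enn2real (min (T x) (ennreal (real N))) \<le> enn2real (min (T x) (ennreal (real (Suc N))))"
      by (intro enn2real_mono) auto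
    then show ?thesis unfolding u_def by (intro mult_mono) (auto simp: indicator_def)
  qed
  have bound: "(\<integral>\<^sup>+x. ennreal (u N x powr q) \<partial>lebesgue) \<le> ennreal (M powr q)" for N
  proof -
    have "(\<integral>\<^sup>+x. ennreal (u N x powr q) \<partial>lebesgue) \<le> (\<integral>\<^sup>+x. ennreal (real N powr q) * indicator (ball (0::real^'d) (real N)) x \<partial>lebesgue)"
    proof (rule nn_integral_mono)
      fix x
      have "u N x powr q \<le> (real N * indicator (ball 0 (real N)) x) powr q"
        using uN u0 q by (intro powr_mono2) auto
      then show "ennreal (u N x powr q) \<le> ennreal (real N powr q) * indicator (ball (0::real^'d) (real N)) x"
        by (auto simp: indicator_def intro: ennreal_leI)
    qed
    also have "\<dots> = ennreal (real N powr q) * emeasure lebesgue (ball (0::real^'d) (real N))"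
      by (subst nn_integral_cmult_indicator) auto
    also have "\<dots> < \<infinity>"
      using emeasure_bounded_finite[of "ball (0::real^'d) (real N)"] by (simp add: ennreal_mult_less_top)
    finally obtain X where X: "0 \<le> X" "(\<integral>\<^sup>+x. ennreal (u N x powr q) \<partial>lebesgue) = ennreal X"
      by (cases "\<integral>\<^sup>+x. ennreal (u N x powr q) \<partial>lebesgue") auto
    show ?thesis
    proof (cases "X = 0")
      case False
      then have X0: "0 < X" using X by simp
      \<comment> \<open>Normalises \<open>h\<close>, because \<open>(q - 1) * q' = q\<close>;
        testing with \<open>h\<close> then yields \<open>X powr (1 / q) \<le> M\<close>.\<close>
      define c where "c = X powr (- (1 / q'))"
      have "c powr q' = X powr (- 1)" unfolding c_def powr_powr using q' by simp
      then have c: "0 < c" "c powr q' = 1 / X" using X0 by (auto simp: c_def powr_minus_divide)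
      define h where "h x = c * u N x powr (q - 1)" for x
      have hq: "ennreal (h x powr q') = ennreal (1 / X) * ennreal (u N x powr q)" for x
        using c u0 X0 by (simp add: h_def powr_mult powr_powr qq ennreal_mult[symmetric])
      have "(\<integral>\<^sup>+x. ennreal (h x powr q') \<partial>lebesgue) = ennreal (1 / X) * ennreal X"
        unfolding hq X(2)[symmetric] by (rule nn_integral_cmult) measurable
      also have "\<dots> = 1" using X0 by (simp add: ennreal_mult[symmetric])
      finally have h1: "(\<integral>\<^sup>+x. ennreal (h x powr q') \<partial>lebesgue) \<le> 1" by simp
      have "ennreal (c * X) = (\<integral>\<^sup>+x. ennreal c * ennreal (u N x powr q) \<partial>lebesgue)"
        using c X by (subst nn_integral_cmult) (auto simp: ennreal_mult)
      also have "\<dots> \<le> (\<integral>\<^sup>+x. T x * ennreal (h x) \<partial>lebesgue)"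
      proof (rule nn_integral_mono)
        fix x
        have "c * u N x powr q = u N x * h x"
          using u0[of N x] by (cases "u N x = 0") (auto simp: h_def powr_diff)
        then have "ennreal c * ennreal (u N x powr q) = ennreal (u N x) * ennreal (h x)"
          using c u0[of N x] by (simp add: ennreal_mult[symmetric] h_def)
        also have "\<dots> \<le> T x * ennreal (h x)" by (intro mult_right_mono uT) auto
        finally show "ennreal c * ennreal (u N x powr q) \<le> T x * ennreal (h x)" .
      qed
      also have "\<dots> \<le> ennreal M"
        by (rule dual[OF _ _ h1]) (use c in \<open>auto simp: h_def\<close>)
      finally have "c * X \<le> M" using M by simp
      moreover have "c * X = X powr (1 / q)"
      proof -
        have "1 / q = 1 - 1 / q'" using q by simp
        then show ?thesis using X0 by (simp add: c_def powr_diff powr_minus_divide)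
      qed
      ultimately have "(X powr (1 / q)) powr q \<le> M powr q" using q by (intro powr_mono2) auto
      then show ?thesis using X X0 q by (simp add: powr_powr ennreal_leI)
    qed (simp add: X)
  qed
  have "(\<integral>\<^sup>+x. ennreal (F x powr q) \<partial>lebesgue) \<le> (\<integral>\<^sup>+x. (SUP N. ennreal (u N x powr q)) \<partial>lebesgue)"
  proof (rule nn_integral_mono_AE, use F(2) in eventually_elim)
    fix x assume Fx: "ennreal (F x) \<le> T x"
    \<comment> \<open>Large enough that neither the height nor the ball cuts off anything below
      \<open>F x\<close>.\<close>
    obtain N where N: "max (F x) (norm x) < real N" using reals_Archimedean2 by blast
    have "ennreal (F x) \<le> min (T x) (ennreal (real N))" using Fx N by (auto intro: ennreal_leI)
    moreover have "min (T x) (ennreal (real N)) < \<infinity>" by (simp add: min_less_iff_disj)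
    ultimately have "F x \<le> enn2real (min (T x) (ennreal (real N)))"
      using F(1)[of x] by (metis enn2real_ennreal enn2real_mono infinity_ennreal_def)
    then have "F x \<le> u N x" using N by (simp add: u_def)
    then show "ennreal (F x powr q) \<le> (SUP N. ennreal (u N x powr q))"
      using F(1) q by (intro SUP_upper2[of N] ennreal_leI powr_mono2) auto
  qed
  also have "\<dots> = (SUP N. (\<integral>\<^sup>+x. ennreal (u N x powr q) \<partial>lebesgue))"
    by (rule nn_integral_monotone_convergence_SUP)
       (use inc u0 q in \<open>auto intro!: incseq_SucI le_funI ennreal_leI powr_mono2\<close>)
  also have "\<dots> \<le> ennreal (M powr q)" by (rule SUP_least) (rule bound)
  finally show ?thesis .
qed

lemma ennreal_powr_le:
  assumes "I \<le> ennreal (M powr q)" "0 < q" "0 \<le> M"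
  shows "ennreal_powr I (1 / q) \<le> ennreal M"
proof -
  have "I < \<infinity>" using assms(1) le_less_trans by fastforce
  then obtain r where r: "0 \<le> r" "I = ennreal r" by (cases I) auto
  have "r \<le> M powr q" using assms r by simp
  then have "r powr (1 / q) \<le> (M powr q) powr (1 / q)" using r assms by (intro powr_mono2) auto
  then show ?thesis using assms r by (simp add: ennreal_powr_def powr_powr ennreal_leI)
qed

lemma ennreal_powr_le_1:
  assumes "ennreal_powr I (1 / p) \<le> 1" "0 < p"
  shows "I \<le> 1"
proof -
  have "I \<noteq> \<infinity>" using assms by (auto simp: ennreal_powr_def top_unique)
  then obtain r where r: "0 \<le> r" "I = ennreal r" by (cases I) auto
  then have "r powr (1 / p) \<le> 1" using assms by (simp add: ennreal_powr_def)
  then have "(r powr (1 / p)) powr p \<le> 1 powr p" using assms by (intro powr_mono2) auto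
  then show ?thesis using r assms by (simp add: powr_powr)
qed

section \<open>Reduction of the commutator to a scalar kernel\<close>

lemma locally_integrable_measurable:
  fixes B :: "real^'d \<Rightarrow> complex^'m^'m"
  assumes "locally_integrable B"
  shows "B \<in> borel_measurable lebesgue"
proof (rule borel_measurable_LIMSEQ_metric)
  fix N :: nat
  show "(\<lambda>x. indicator (cball 0 (real N)) x *\<^sub>R B x) \<in> borel_measurable lebesgue"
    using assms unfolding locally_integrable_def set_integrable_def by (auto intro: borel_measurable_integrable)
next
  fix x :: "real^'d"
  obtain N where "norm x < real N" using reals_Archimedean2 by blast
  then have "\<forall>n\<ge>N. indicator (cball 0 (real n)) x *\<^sub>R B x = B x" by (auto simp: indicator_def)
  then have "\<forall>\<^sub>F n in sequentially. indicator (cball 0 (real n)) x *\<^sub>R B x = B x"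
    by (auto simp: eventually_sequentially)
  then show "(\<lambda>n. indicator (cball 0 (real n)) x *\<^sub>R B x) \<longlonglongrightarrow> B x" by (rule tendsto_eventually)
qed

text \<open>\<open>frac_int\<close> is defined coordinate by coordinate; as one vector-valued
  integral it can be exchanged with multiplication by a matrix.\<close>

lemma integrable_vec_components:
  fixes f :: "'a \<Rightarrow> complex^'m"
  assumes "\<And>i. integrable M (\<lambda>y. f y $ i)"
  shows "integrable M f" "(\<integral>y. f y \<partial>M) = (\<chi> i. \<integral>y. f y $ i \<partial>M)"
proof -
  have ax: "bounded_linear (axis i :: complex \<Rightarrow> complex^'m)" for i
    unfolding linear_conv_bounded_linear[symmetric] by (rule linearI) (auto simp: axis_def vec_eq_iff)
  have "f y = (\<Sum>i\<in>UNIV. axis i (f y $ i))" for y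
    by (simp add: vec_eq_iff axis_def if_distrib cong: if_cong)
  moreover have "integrable M (\<lambda>y. \<Sum>i\<in>UNIV. axis i (f y $ i))"
    by (intro Bochner_Integration.integrable_sum integrable_bounded_linear[OF ax] assms)
  ultimately show int: "integrable M f" by simp
  show "(\<integral>y. f y \<partial>M) = (\<chi> i. \<integral>y. f y $ i \<partial>M)"
    using integral_bounded_linear[OF bounded_linear_vec_nth int] by (simp add: vec_eq_iff)
qed

text \<open>Both integrals converge absolutely at \<open>x\<close>, so \<open>B x\<close> moves
  under the first and the two merge into one with the factor \<open>B x - B y\<close>. Inserting
  \<open>mat_powr (U y) (- s) ** mat_powr (U y) s\<close> before \<open>f y\<close> and taking norms
  leaves a scalar integrand.\<close>

lemma norm_frac_commutator_le:
  fixes f :: "real^'d \<Rightarrow> complex^'m" and W :: "complex^'m^'m"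
  assumes f: "\<And>i. integrable lebesgue (frac_kernel \<alpha> (\<lambda>z. f z $ i) x)"
    and Bf: "\<And>i. integrable lebesgue (frac_kernel \<alpha> (\<lambda>z. mult_op B f z $ i) x)"
    and U: "AE y in lebesgue. pos_def (U y)"
  shows "ennreal (norm (W *v frac_commutator B \<alpha> f x)) \<le>
    (\<integral>\<^sup>+y. ennreal (mat_norm (W ** (B x - B y) ** mat_powr (U y) (- s))) * ennreal (norm (mat_powr (U y) s *v f y)) *
       ennreal (1 / norm (x - y) powr (real CARD('d) - \<alpha>)) \<partial>lebesgue)"
proof -
  define r where "r y = 1 / norm (x - y) powr (real CARD('d) - \<alpha>)" for y
  have r0: "0 \<le> r y" for y by (simp add: r_def)
  have comp: "frac_kernel \<alpha> (\<lambda>z. h z $ i) x y = (r y *\<^sub>R h y) $ i" for h :: "real^'d \<Rightarrow> complex^'m" and i y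
    by (simp add: frac_kernel_def r_def scaleR_conv_of_real[where 'a = complex])
  have int: "integrable lebesgue (\<lambda>y. r y *\<^sub>R h y)" "frac_int \<alpha> h x = (\<integral>y. r y *\<^sub>R h y \<partial>lebesgue)"
    if h: "\<And>i. integrable lebesgue (frac_kernel \<alpha> (\<lambda>z. h z $ i) x)" for h :: "real^'d \<Rightarrow> complex^'m"
  proof -
    have h': "integrable lebesgue (\<lambda>y. (r y *\<^sub>R h y) $ i)" for i
      using h[of i] unfolding comp[symmetric] .
    show "integrable lebesgue (\<lambda>y. r y *\<^sub>R h y)" by (rule integrable_vec_components(1)[OF h'])
    show "frac_int \<alpha> h x = (\<integral>y. r y *\<^sub>R h y \<partial>lebesgue)"
      unfolding integrable_vec_components(2)[OF h'] frac_int_def comp ..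
  qed
  note P = int[OF f] and R = int[OF Bf]
  have BxP: "integrable lebesgue (\<lambda>y. B x *v (r y *\<^sub>R f y))"
    "(\<integral>y. B x *v (r y *\<^sub>R f y) \<partial>lebesgue) = B x *v (\<integral>y. r y *\<^sub>R f y \<partial>lebesgue)"
    using integrable_bounded_linear[OF matrix_vector_mul_bounded_linear P(1)]
      integral_bounded_linear[OF matrix_vector_mul_bounded_linear P(1)] by auto
  have D: "integrable lebesgue (\<lambda>y. B x *v (r y *\<^sub>R f y) - r y *\<^sub>R mult_op B f y)"
    by (rule Bochner_Integration.integrable_diff[OF BxP(1) R(1)])
  have fc: "frac_commutator B \<alpha> f x = (\<integral>y. B x *v (r y *\<^sub>R f y) - r y *\<^sub>R mult_op B f y \<partial>lebesgue)"
    using BxP R by (simp add: frac_commutator_def mult_op_def[of B "frac_int \<alpha> f"] P(2)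
        Bochner_Integration.integral_diff)
  let ?Y = "\<lambda>y. W *v (B x *v (r y *\<^sub>R f y) - r y *\<^sub>R mult_op B f y)"
  have Y: "integrable lebesgue ?Y" "(\<integral>y. ?Y y \<partial>lebesgue) = W *v frac_commutator B \<alpha> f x"
    using integrable_bounded_linear[OF matrix_vector_mul_bounded_linear D]
      integral_bounded_linear[OF matrix_vector_mul_bounded_linear D] by (auto simp: fc)
  have "ennreal (norm (W *v frac_commutator B \<alpha> f x)) \<le> (\<integral>\<^sup>+y. ennreal (norm (?Y y)) \<partial>lebesgue)"
    unfolding Y(2)[symmetric] by (rule integral_norm_bound_ennreal[OF Y(1)])
  also have "\<dots> \<le> (\<integral>\<^sup>+y. ennreal (mat_norm (W ** (B x - B y) ** mat_powr (U y) (- s))) * ennreal (norm (mat_powr (U y) s *v f y)) *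
       ennreal (r y) \<partial>lebesgue)"
  proof (rule nn_integral_mono_AE, use U in eventually_elim)
    fix y assume pd: "pos_def (U y)"
    have sc: "A *v (c *\<^sub>R v) = c *\<^sub>R (A *v v)" for A :: "complex^'m^'m" and c :: real and v
      by (simp add: matrix_vector_mult_def vec_eq_iff scaleR_sum_right)
    have "?Y y = r y *\<^sub>R (W ** (B x - B y) *v f y)"
      by (simp add: sc mult_op_def matrix_vector_mult_diff_rdistrib flip: matrix_vector_mul_assoc scaleR_diff_right)
    also have "W ** (B x - B y) *v f y = (W ** (B x - B y) ** mat_powr (U y) (- s)) *v (mat_powr (U y) s *v f y)"
      by (simp add: matrix_vector_mul_assoc mat_powr_minus_mult[OF pd] flip: matrix_mul_assoc)
    finally have "norm (?Y y) = r y * norm ((W ** (B x - B y) ** mat_powr (U y) (- s)) *v (mat_powr (U y) s *v f y))"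
      using r0 by simp
    also have "\<dots> \<le> r y * (mat_norm (W ** (B x - B y) ** mat_powr (U y) (- s)) * norm (mat_powr (U y) s *v f y))"
      by (intro mult_left_mono norm_matrix_vector_le r0)
    finally have "ennreal (norm (?Y y)) \<le> ennreal \<dots>" by (rule ennreal_leI)
    also have "\<dots> = ennreal (mat_norm (W ** (B x - B y) ** mat_powr (U y) (- s))) *
        ennreal (norm (mat_powr (U y) s *v f y)) * ennreal (r y)"
      by (simp add: ennreal_mult' r0 mat_norm_nonneg mult_ac)
    finally show "ennreal (norm (?Y y)) \<le> \<dots>" .
  qed
  finally show ?thesis by (simp only: r_def)
qed

lemma borel_measurable_bump_kernel:
  fixes U V B :: "real^'d \<Rightarrow> complex^'m^'m"
  assumes "matrix_weight U" "matrix_weight V" "locally_integrable B"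
  shows "(\<lambda>w. bump_kernel q U V B (fst w) (snd w)) \<in> borel_measurable (lebesgue \<Otimes>\<^sub>M lebesgue)"
proof -
  note [measurable] = measurable_mat_powr[OF assms(1)] measurable_mat_powr[OF assms(2)]
    locally_integrable_measurable[OF assms(3)]
  show ?thesis unfolding bump_kernel_def by measurable
qed

theorem proposition1p5:
  fixes \<alpha> p q :: real
    and C D :: "real \<Rightarrow> real"
  assumes "0 < \<alpha>" and "\<alpha> < real CARD('d::finite)"
    and "1 < p" and "1 < q"
    and "\<alpha> / real CARD('d) + 1 / q = 1 / p"
    and "young_function C" and "young_function D"
    and "young_assoc D \<in> B_class2 p q"
    and "young_assoc C \<in> B_class (q / (q - 1))"
  shows "\<exists>K::real. 0 < K \<and>
    (\<forall>(U :: real^'d \<Rightarrow> complex^'m^'m) (V :: real^'d \<Rightarrow> complex^'m^'m)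
       (B :: real^'d \<Rightarrow> complex^'m^'m).
       matrix_weight U \<longrightarrow> matrix_weight V \<longrightarrow> locally_integrable B \<longrightarrow>
       weighted_op_norm p (\<lambda>x. mat_powr (U x) (p / q)) q V
           (frac_commutator_dom B \<alpha>) (frac_commutator B \<alpha>)
         \<le> ennreal K * min (kappa1 q C D U V B) (kappa2 q C D U V B))"
proof -
  define q' where "q' = q / (q - 1)"
  have qq': "1 / q + 1 / q' = 1" using \<open>1 < q\<close> by (simp add: q'_def field_simps)
  \<comment> \<open>Chosen before \<open>U\<close>, \<open>V\<close> and \<open>B\<close>, hence
    independent of them.\<close>
  obtain K where K: "0 < K" and bilinear:
    "\<And>(k :: real^'d \<Rightarrow> real^'d \<Rightarrow> ennreal) (g :: real^'d \<Rightarrow> real) (h :: real^'d \<Rightarrow> real) \<kappa>.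
      (\<lambda>w. k (fst w) (snd w)) \<in> borel_measurable (lebesgue \<Otimes>\<^sub>M lebesgue) \<Longrightarrow>
      g \<in> borel_measurable lebesgue \<Longrightarrow> (\<And>y. 0 \<le> g y) \<Longrightarrow> (\<integral>\<^sup>+y. ennreal (g y powr p) \<partial>lebesgue) \<le> 1 \<Longrightarrow>
      h \<in> borel_measurable lebesgue \<Longrightarrow> (\<And>y. 0 \<le> h y) \<Longrightarrow> (\<integral>\<^sup>+x. ennreal (h x powr q') \<partial>lebesgue) \<le> 1 \<Longrightarrow>
      0 \<le> \<kappa> \<Longrightarrow>
      (\<forall>z \<rho>. 0 < \<rho> \<longrightarrow> orlicz_norm C (cube z \<rho>) (\<lambda>x. orlicz_norm D (cube z \<rho>) (\<lambda>y. k x y)) \<le> ennreal \<kappa>) \<or>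
      (\<forall>z \<rho>. 0 < \<rho> \<longrightarrow> orlicz_norm D (cube z \<rho>) (\<lambda>y. orlicz_norm C (cube z \<rho>) (\<lambda>x. k x y)) \<le> ennreal \<kappa>) \<Longrightarrow>
      (\<integral>\<^sup>+x. (\<integral>\<^sup>+y. k x y * ennreal (g y) * ennreal (h x) *
          ennreal (1 / norm (x - y) powr (real CARD('d) - \<alpha>)) \<partial>lebesgue) \<partial>lebesgue) \<le> ennreal K * ennreal \<kappa>"
    using scalar_bilinear_bound[OF assms(1-4) qq' assms(5-8) assms(9)[folded q'_def]] by blast
  show ?thesis
  proof (intro exI[of _ K] conjI K allI impI)
    fix U V B :: "real^'d \<Rightarrow> complex^'m^'m"
    assume U: "matrix_weight U" and V: "matrix_weight V" and B: "locally_integrable B"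
    let ?k = "bump_kernel q U V B"
    note k = borel_measurable_bump_kernel[OF U V B, of q]
    have pdU: "AE y in lebesgue. pos_def (U y)" using U by (simp add: matrix_weight_def)
    have cubes: "cube z \<rho> \<in> cubes" if "0 < \<rho>" for z :: "real^'d" and \<rho>
      using that by (auto simp: cubes_def cube_cbox)
    have main: "weighted_norm q V (frac_commutator B \<alpha> f) \<le> ennreal K * \<kappa>"
      if f: "f \<in> weighted_Lp p (\<lambda>x. mat_powr (U x) (p / q))" "f \<in> frac_commutator_dom B \<alpha>"
        "weighted_norm p (\<lambda>x. mat_powr (U x) (p / q)) f \<le> 1"
        and \<kappa>: "\<kappa> = kappa1 q C D U V B \<or> \<kappa> = kappa2 q C D U V B" for f \<kappa>
    proof (cases \<kappa>)
      case top
      \<comment> \<open>Positivity of \<open>K\<close> matters here, since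
        \<open>0 * \<infinity> = 0\<close> in \<open>ennreal\<close>.\<close>
      then show ?thesis using K by (simp add: ennreal_mult_top)
    next
      case (real r)
      \<comment> \<open>The norm of \<open>f\<close> in \<open>L^p(U^(p/q))\<close> is the
        unweighted \<open>L^p\<close> norm of this scalar function, as
        \<open>(U^(p/q))^(1/p) = U^(1/q)\<close> almost everywhere.\<close>
      define g where "g y = norm (mat_powr (U y) (1 / q) *v f y)" for y
      have [measurable]: "f \<in> borel_measurable lebesgue" using f(1) by (simp add: weighted_Lp_def)
      note [measurable] = measurable_mat_powr[OF U]
      have g: "g \<in> borel_measurable lebesgue" "\<And>y. 0 \<le> g y" unfolding g_def by auto
      have "(\<integral>\<^sup>+y. ennreal (g y powr p) \<partial>lebesgue) =
        (\<integral>\<^sup>+y. ennreal (norm (mat_powr (mat_powr (U y) (p / q)) (1 / p) *v f y) powr p) \<partial>lebesgue)"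
        by (rule nn_integral_cong_AE, use pdU in eventually_elim)
           (use assms in \<open>simp add: g_def mat_powr_mat_powr\<close>)
      also have "\<dots> \<le> 1" 
        by (rule ennreal_powr_le_1[of _ p]) (use f(3) assms(3) in \<open>simp_all add: weighted_norm_def\<close>)
      finally have gp: "(\<integral>\<^sup>+y. ennreal (g y powr p) \<partial>lebesgue) \<le> 1" .
      have orlicz: "(\<forall>z \<rho>. 0 < \<rho> \<longrightarrow> orlicz_norm C (cube z \<rho>) (\<lambda>x. orlicz_norm D (cube z \<rho>) (\<lambda>y. ?k x y)) \<le> ennreal r) \<or>
        (\<forall>z \<rho>. 0 < \<rho> \<longrightarrow> orlicz_norm D (cube z \<rho>) (\<lambda>y. orlicz_norm C (cube z \<rho>) (\<lambda>x. ?k x y)) \<le> ennreal r)"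
        using \<kappa>
      proof
        assume "\<kappa> = kappa1 q C D U V B"
        then show ?thesis using real cubes unfolding kappa1_def by (auto intro!: SUP_upper disjI2)
      next
        assume "\<kappa> = kappa2 q C D U V B"
        then show ?thesis using real cubes unfolding kappa2_def by (auto intro!: SUP_upper disjI1)
      qed
      have [measurable (raw)]: "(\<lambda>w. ?k (f1 w) (f2 w)) \<in> borel_measurable M"
        if "f1 \<in> M \<rightarrow>\<^sub>M lebesgue" "f2 \<in> M \<rightarrow>\<^sub>M lebesgue" for f1 f2 and M :: "'x measure"
        using measurable_compose[OF measurable_Pair[OF that] k] by simp
      note [measurable] = g(1)
      define T where "T x = (\<integral>\<^sup>+y. ?k x y * ennreal (g y) * ennreal (1 / norm (x - y) powr (real CARD('d) - \<alpha>)) \<partial>lebesgue)" for x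
      have T: "T \<in> borel_measurable lebesgue" unfolding T_def by measurable
      define F where "F x = norm (mat_powr (V x) (1 / q) *v frac_commutator B \<alpha> f x)" for x
      have FT: "AE x in lebesgue. ennreal (F x) \<le> T x"
      proof -
        have "AE x in lebesgue. \<forall>i. integrable lebesgue (frac_kernel \<alpha> (\<lambda>z. f z $ i) x)"
          "AE x in lebesgue. \<forall>i. integrable lebesgue (frac_kernel \<alpha> (\<lambda>z. mult_op B f z $ i) x)"
          using f(2) by (auto simp: frac_commutator_dom_def frac_int_dom_def)
        then show ?thesis
        proof eventually_elim
          case (elim x)
          show ?case unfolding F_def T_def bump_kernel_def g_def
            by (rule norm_frac_commutator_le) (use elim pdU in auto)
        qed
      qed
      have "(\<integral>\<^sup>+x. ennreal (F x powr q) \<partial>lebesgue) \<le> ennreal ((K * r) powr q)"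
      proof (rule nn_integral_powr_duality[OF T _ FT assms(4) qq'])
        show "0 \<le> F x" for x by (simp add: F_def)
        show "0 \<le> K * r" using K real by simp
        fix h :: "real^'d \<Rightarrow> real"
        assume h[measurable]: "h \<in> borel_measurable lebesgue" and h0: "\<And>x. 0 \<le> h x"
          and hq: "(\<integral>\<^sup>+x. ennreal (h x powr q') \<partial>lebesgue) \<le> 1"
        have "(\<integral>\<^sup>+x. T x * ennreal (h x) \<partial>lebesgue) = (\<integral>\<^sup>+x. (\<integral>\<^sup>+y. ?k x y * ennreal (g y) * ennreal (h x) *
          ennreal (1 / norm (x - y) powr (real CARD('d) - \<alpha>)) \<partial>lebesgue) \<partial>lebesgue)"
        proof (rule nn_integral_cong)
          fix x :: "real^'d"
          have [measurable]: "(\<lambda>y. 1 / norm (x - y) powr (real CARD('d) - \<alpha>)) \<in> borel_measurable lebesgue"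
            by (intro measurable_completion) measurable
          have "T x * ennreal (h x) = (\<integral>\<^sup>+y. ?k x y * ennreal (g y) *
             ennreal (1 / norm (x - y) powr (real CARD('d) - \<alpha>)) * ennreal (h x) \<partial>lebesgue)"
            unfolding T_def by (rule nn_integral_multc[symmetric]) measurable
          then show "T x * ennreal (h x) = (\<integral>\<^sup>+y. ?k x y * ennreal (g y) * ennreal (h x) *
             ennreal (1 / norm (x - y) powr (real CARD('d) - \<alpha>)) \<partial>lebesgue)" by (simp only: mult_ac)
        qed
        also have "\<dots> \<le> ennreal K * ennreal r"
          by (rule bilinear[OF k g gp h h0 hq _ orlicz]) (use real in simp)
        also have "\<dots> = ennreal (K * r)" using K real by (simp add: ennreal_mult)
        finally show "(\<integral>\<^sup>+x. T x * ennreal (h x) \<partial>lebesgue) \<le> ennreal (K * r)" .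
      qed
      then have "weighted_norm q V (frac_commutator B \<alpha> f) \<le> ennreal (K * r)"
        unfolding weighted_norm_def F_def using K real assms(4) by (intro ennreal_powr_le) auto
      also have "\<dots> = ennreal K * \<kappa>" using K real by (simp add: ennreal_mult)
      finally show ?thesis .
    qed
    show "weighted_op_norm p (\<lambda>x. mat_powr (U x) (p / q)) q V (frac_commutator_dom B \<alpha>) (frac_commutator B \<alpha>)
      \<le> ennreal K * min (kappa1 q C D U V B) (kappa2 q C D U V B)"
      unfolding weighted_op_norm_def
      \<comment> \<open>The minimum is one of the two constants, and \<open>main\<close> covers
        either.\<close>
      by (rule SUP_least, use main in \<open>auto simp: min_def\<close>)
  qed
qed

end
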